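(* Let $X=(X_n)_{n\in\mathbb Z}$ be a stationary process with values in a finite set $A$ which satisfies the priming condition: for every $a\in A$, $p(a|X^{\lhd}_{-1})>0$ almost surely. If $\sum_{n=0}^{\infty}\eta_n<+\infty$, then the natural filtration $\mathcal F^X$ is standard.
   Context: All $\sigma$-fields are complete. For a process $\xi$, $\xi^{\lhd}_n=(\xi_k)_{k\le n}$, $\mathcal F^\xi_n=\sigma(\xi^{\lhd}_n)$, $\mathcal F^\xi=(\mathcal F^\xi_n)_{n\in\mathbb Z}$, and $\xi_{i:j}=(\xi_n)_{i\le n\le j}$. $A^\lhd$ is the set of $A$-valued sequences $(x_n)_{n\le-1}$; $(\xi_n)_{n\le i}$ is identified with an element of $A^\lhd$ by shifting indices. For $x\in A^\lhd$, $z=(z_1,\dots,z_n)\in A^n$, $xz=(\dots,x_{-1},z_1,\dots,z_n)\in A^\lhd$. For $z\in A^n$ ($n\ge0$) and $a\in A$, $p(a|z)=\mathbb P(X_0=a\mid X_{-n:-1}=z)$, with the convention $p(a|z)=\mathbb P(X_0=a)$ if $\mathbb P(X_{-n:-1}=z)=0$. $p(\cdot|x)$, $x\in A^\lhd$, is a fixed regular version of the conditional law of $X_0$ given $X^\lhd_{-1}=x$. $\|\mu-\nu\|=\frac12\sum_a|\mu(a)-\nu(a)|$. For $n\ge0$, $$\eta_n=\sum_{z\in A^n}\mathbb E\big[\|p(\cdot|z)-p(\cdot|X^{\lhd}_{-n-1}z)\|\big]\,\mathbb P[X_{-n:-1}=z].$$ A filtration $\mathcal F^X$ is standard if, possibly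 after enlarging the probability space, it is immersed in the natural filtration of some i.i.d. process ($\mathcal F^X$ immersed in $\mathcal G$: $\mathcal F^X_n\subset\mathcal G_n$ for all $n$ and $\mathcal F^X_{n+1}$, $\mathcal G_n$ are conditionally independent given $\mathcal F^X_n$ for all $n$). *)

theory Defs
  imports "HOL-Probability.Probability"
begin

abbreviation Past :: "(int \<Rightarrow> 'a) measure" where
  "Past \<equiv> PiM {..(-1::int)} (\<lambda>_. count_space UNIV)"

text \<open>(X_k)_{k \<le> i} identified with an element of A^lhd by shifting indices (i goes to -1).\<close>
definition past_of :: "(int \<Rightarrow> 'w \<Rightarrow> 'a) \<Rightarrow> int \<Rightarrow> 'w \<Rightarrow> (int \<Rightarrow> 'a)" where
  "past_of X i \<omega> = restrict (\<lambda>k. X (k + i + 1) \<omega>) {..(-1::int)}"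

text \<open>Concatenation x z = (..., x_{-1}, z_1, ..., z_n) in A^lhd (z given as a list).\<close>
definition past_concat :: "(int \<Rightarrow> 'a) \<Rightarrow> 'a list \<Rightarrow> (int \<Rightarrow> 'a)" where
  "past_concat x z = restrict
     (\<lambda>k. if - int (length z) \<le> k then z ! nat (k + int (length z)) else x (k + int (length z)))
     {..(-1::int)}"

definition block_event :: "'w measure \<Rightarrow> (int \<Rightarrow> 'w \<Rightarrow> 'a) \<Rightarrow> 'a list \<Rightarrow> 'w set" where
  "block_event M X z = {\<omega> \<in> space M. \<forall>i<length z. X (int i - int (length z)) \<omega> = z ! i}"

text \<open>p(a|z) = P(X_0 = a | X_{-n:-1} = z), with convention P(X_0 = a) on null conditioning events.\<close>
definition cprob :: "'w measure \<Rightarrow> (int \<Rightarrow> 'w \<Rightarrow> 'a) \<Rightarrow> 'a list \<Rightarrow> 'a \<Rightarrow> real" where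
  "cprob M X z a =
     (if measure M (block_event M X z) = 0
      then measure M {\<omega> \<in> space M. X 0 \<omega> = a}
      else measure M ({\<omega> \<in> space M. X 0 \<omega> = a} \<inter> block_event M X z) / measure M (block_event M X z))"

definition tv_dist :: "('a::finite \<Rightarrow> real) \<Rightarrow> ('a \<Rightarrow> real) \<Rightarrow> real" where
  "tv_dist \<mu> \<nu> = (1/2) * (\<Sum>a\<in>UNIV. \<bar>\<mu> a - \<nu> a\<bar>)"

definition regular_cond_law ::
  "'w measure \<Rightarrow> (int \<Rightarrow> 'w \<Rightarrow> 'a::finite) \<Rightarrow> ((int \<Rightarrow> 'a) \<Rightarrow> 'a \<Rightarrow> real) \<Rightarrow> bool" where
  "regular_cond_law M X q \<longleftrightarrow>
     (\<forall>x\<in>space Past. (\<forall>a. 0 \<le> q x a) \<and> (\<Sum>a\<in>UNIV. q x a) = 1) \<and>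
     (\<forall>a. (\<lambda>x. q x a) \<in> borel_measurable Past) \<and>
     (\<forall>a. \<forall>B\<in>sets Past.
        measure M {\<omega> \<in> space M. X 0 \<omega> = a \<and> past_of X (-1) \<omega> \<in> B} =
        (\<integral>\<omega>. indicator B (past_of X (-1) \<omega>) * q (past_of X (-1) \<omega>) a \<partial>M))"

definition eta ::
  "'w measure \<Rightarrow> (int \<Rightarrow> 'w \<Rightarrow> 'a::finite) \<Rightarrow> ((int \<Rightarrow> 'a) \<Rightarrow> 'a \<Rightarrow> real) \<Rightarrow> nat \<Rightarrow> real" where
  "eta M X q n =
     (\<Sum>z\<in>{z::'a list. length z = n}.
        (\<integral>\<omega>. tv_dist (cprob M X z) (q (past_concat (past_of X (- int n - 1) \<omega>) z)) \<partial>M)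
        * measure M (block_event M X z))"

definition stationary :: "'w measure \<Rightarrow> (int \<Rightarrow> 'w \<Rightarrow> 'a) \<Rightarrow> bool" where
  "stationary M X \<longleftrightarrow>
     (\<forall>k::int. distr M (PiM UNIV (\<lambda>_. count_space UNIV)) (\<lambda>\<omega> n. X (n + k) \<omega>) =
               distr M (PiM UNIV (\<lambda>_. count_space UNIV)) (\<lambda>\<omega> n. X n \<omega>))"

definition nat_filt :: "'w measure \<Rightarrow> 'b measure \<Rightarrow> (int \<Rightarrow> 'w \<Rightarrow> 'b) \<Rightarrow> int \<Rightarrow> 'w measure" where
  "nat_filt M N Y n = sigma (space M)
     ((\<Union>k\<in>{..n}. {Y k -` B \<inter> space M | B. B \<in> sets N}) \<union> null_sets M)"

definition cond_indep :: "'w measure \<Rightarrow> 'w measure \<Rightarrow> 'w set set \<Rightarrow> 'w set set \<Rightarrow> bool" where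
  "cond_indep M G F1 F2 \<longleftrightarrow>
     (\<forall>A\<in>F1. \<forall>B\<in>F2. AE \<omega> in M.
        real_cond_exp M G (indicator (A \<inter> B)) \<omega> =
        real_cond_exp M G (indicator A) \<omega> * real_cond_exp M G (indicator B) \<omega>)"

definition immersed :: "'w measure \<Rightarrow> (int \<Rightarrow> 'w measure) \<Rightarrow> (int \<Rightarrow> 'w measure) \<Rightarrow> bool" where
  "immersed M F G \<longleftrightarrow>
     (\<forall>n. sets (F n) \<subseteq> sets (G n)) \<and>
     (\<forall>n. cond_indep M (F n) (sets (F (n + 1))) (sets (G n)))"

definition iid_process :: "'w measure \<Rightarrow> (int \<Rightarrow> 'w \<Rightarrow> real) \<Rightarrow> bool" where
  "iid_process M Y \<longleftrightarrow>
     prob_space.indep_vars M (\<lambda>_. borel) Y UNIV \<and>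
     (\<forall>n. distr M borel (Y n) = distr M borel (Y 0))"

text \<open>F^X is standard: after enlarging the probability space (a probability space M' on
  'w \<times> (int \<Rightarrow> real) whose image under fst is M), the natural filtration of
  X \<circ> fst is immersed in the natural filtration of some i.i.d. process.\<close>
definition standard_nat_filt :: "'w measure \<Rightarrow> (int \<Rightarrow> 'w \<Rightarrow> 'a) \<Rightarrow> bool" where
  "standard_nat_filt M X \<longleftrightarrow>
     (\<exists>(M' :: ('w \<times> (int \<Rightarrow> real)) measure) Y.
        prob_space M' \<and> fst \<in> measurable M' M \<and> distr M' M fst = M \<and>
        iid_process M' Y \<and>
        immersed M' (nat_filt M' (count_space UNIV) (\<lambda>n. X n \<circ> fst)) (nat_filt M' borel Y))"

end

theory Submission
  imports Defs
begin

text \<open>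
  A single map \<open>letter\<close> turns a probability vector \<open>p\<close> and one real random number into a letter of law
  \<open>p\<close>, in such a way that two close vectors produce the same letter with high probability and any
  letter charged by both vectors is produced by both at once with positive probability.  After
  enlarging the space, \<open>X n = letter (q (past)) (Y n)\<close> with \<open>Y\<close> i.i.d. and \<open>Y n\<close> independent of
  everything before \<open>n\<close>, so immersion is clear as soon as \<open>X\<close> is a function of \<open>Y\<close>.  For this, run a second
  chain with the same \<open>Y\<close> from a fixed past \<open>x0\<close> at a remote time.  Comparing both chains with the chain of
  the finite-memory laws \<open>cprob\<close>, the summability of \<open>eta\<close> bounds the cost of agreeing after the first \<open>j\<close>
  letters and the priming condition makes agreement on these \<open>j\<close> letters possible; so the two chains agree
  for ever with a probability bounded below on a large set of pasts.  Stationarity of both marginals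
  brings the chains back to this set at every time, and a zero-one argument shows that they
  coalesce almost surely.
\<close>

section \<open>A universal coupling of the laws on a finite alphabet\<close>

text \<open>In \<open>eta\<close> the past is averaged independently of the word. So
  \<open>psi n x\<close>, the share of one past x, weighs words by \<open>word_prob\<close> whatever
  x is, and is summable in n for almost every x. This is why two pasts are compared through the laws
  \<open>cprob\<close> and not directly: along that common chain the losses of both pasts are plain
  sums of \<open>psi\<close>. The sum of all losses may exceed one, so additive bookkeeping can only
  begin at some j, and the first j letters need a multiplicative bound, uniform only on a good set
  of pasts. The joint law of the coupled chains is out of reach, but each chain alone is stationary
  when started under \<open>past_law\<close>, and a union bound then keeps both in the good set.
  Hence both pasts are averaged until the end, where a suitable fixed \<open>x0\<close> is selected
  by Fubini. The process X is given, so its noise has to be manufactured: \<open>Y n\<close> is a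
  uniform point of the region of the letter that actually occurred, picked with an independent
  randomiser.\<close>

definition prob_vec :: "('a::finite \<Rightarrow> real) \<Rightarrow> bool" where
  "prob_vec p \<longleftrightarrow> (\<forall>a. 0 \<le> p a) \<and> sum p UNIV = 1"

definition idx :: "'a::finite \<Rightarrow> nat" where
  "idx = to_nat_on UNIV"

text \<open>The integer part of the noise selects the letter \<open>i\<close> that is put first in the order used for
  inverting the distribution function.  Its slot then starts at the left end of the unit cell whatever
  the law is, so the slots of two laws overlap there.\<close>

definition before :: "'a::finite \<Rightarrow> 'a \<Rightarrow> 'a set" where
  "before i a = {b. b \<noteq> a \<and> (b = i \<or> (a \<noteq> i \<and> idx b < idx a))}"

definition slot_start :: "('a::finite \<Rightarrow> real) \<Rightarrow> 'a \<Rightarrow> 'a \<Rightarrow> real" where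
  "slot_start p i a = real (idx i) + sum p (before i a)"

definition slot :: "('a::finite \<Rightarrow> real) \<Rightarrow> 'a \<Rightarrow> 'a \<Rightarrow> real set" where
  "slot p i a = {slot_start p i a ..< slot_start p i a + p a}"

definition region :: "('a::finite \<Rightarrow> real) \<Rightarrow> 'a \<Rightarrow> real set" where
  "region p a = (\<Union>i. slot p i a)"

definition noise :: "'a::finite itself \<Rightarrow> real measure" where
  "noise _ = uniform_measure lborel {0..<real CARD('a)}"

text \<open>Regions of distinct letters are disjoint and cover almost all of the noise, so the
  choice is almost surely forced.\<close>

definition letter :: "('a::finite \<Rightarrow> real) \<Rightarrow> real \<Rightarrow> 'a" where
  "letter p y = (SOME a. y \<in> region p a)"

text \<open>A right inverse of \<open>letter p\<close>: the cell of i is mapped affinely onto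
  \<open>slot p i a\<close>, so for \<open>0 < p a\<close> a uniform v becomes a uniform point of
  \<open>region p a\<close>, that is, the noise conditioned on producing a. The sum of indicators
  encodes the case distinction on the cell in a visibly measurable form.\<close>

definition sample :: "('a::finite \<Rightarrow> real) \<Rightarrow> 'a \<Rightarrow> real \<Rightarrow> real" where
  "sample p a v = (\<Sum>i\<in>UNIV. indicator {real (idx i)..<real (idx i) + 1} v *
     (slot_start p i a + p a * (v - real (idx i))))"

lemma prob_vec_nonneg: "prob_vec p \<Longrightarrow> 0 \<le> p a"
  and prob_vec_sum: "prob_vec p \<Longrightarrow> sum p UNIV = 1"
  by (auto simp: prob_vec_def)

lemma prob_vec_le_1: "prob_vec p \<Longrightarrow> p a \<le> 1"
  using member_le_sum[of a UNIV p] by (auto simp: prob_vec_def)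

lemma bij_idx: "bij_betw (idx :: 'a::finite \<Rightarrow> nat) UNIV {..<CARD('a)}"
  unfolding idx_def by (rule to_nat_on_finite) simp

lemma idx_less: "idx (i::'a::finite) < CARD('a)"
  using bij_betwE[OF bij_idx] by blast

lemma idx_eq_iff [simp]: "idx i = idx j \<longleftrightarrow> i = j"
  using bij_betw_imp_inj_on[OF bij_idx] by (auto simp: inj_on_def)

lemma unit_cell_unique:
  "v \<in> {real (idx i)..<real (idx i) + 1} \<Longrightarrow> v \<in> {real (idx j)..<real (idx j) + 1} \<Longrightarrow> i = j"
proof -
  assume "v \<in> {real (idx i)..<real (idx i) + 1}" "v \<in> {real (idx j)..<real (idx j) + 1}"
  then have "real (idx i) < real (idx j) + 1" "real (idx j) < real (idx i) + 1" by auto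
  then have "idx i = idx j" by linarith
  then show "i = j" by simp
qed

lemma unit_cells: "(\<Union>i::'a::finite. {real (idx i)..<real (idx i) + 1}) = {0..<real CARD('a)}"
proof safe
  fix v i assume "v \<in> {real (idx (i::'a))..<real (idx i) + 1}"
  moreover have "real (idx i) + 1 \<le> real CARD('a)" using idx_less[of i] by linarith
  ultimately show "v \<in> {0..<real CARD('a)}" by auto
next
  fix v assume v: "v \<in> {0..<real CARD('a)}"
  then have "nat \<lfloor>v\<rfloor> < CARD('a)" by (auto simp: nat_less_iff floor_less_iff)
  then obtain i :: 'a where i: "idx i = nat \<lfloor>v\<rfloor>"
    using bij_betw_imp_surj_on[OF bij_idx] by (metis (full_types) imageE lessThan_iff)
  have "v \<in> {real (idx i)..<real (idx i) + 1}"
    using v unfolding i by (auto simp: of_nat_nat)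
  then show "v \<in> (\<Union>i::'a. {real (idx i)..<real (idx i) + 1})" by blast
qed

lemma slot_start_ge: "prob_vec p \<Longrightarrow> real (idx i) \<le> slot_start p i a"
  by (auto simp: slot_start_def prob_vec_def intro!: sum_nonneg)

lemma slot_start_mono:
  assumes "prob_vec p" "insert a (before i a) \<subseteq> B"
  shows "slot_start p i a + p a \<le> real (idx i) + sum p B"
proof -
  have "sum p (insert a (before i a)) \<le> sum p B"
    using assms by (intro sum_mono2) (auto simp: prob_vec_def)
  moreover have "a \<notin> before i a" by (simp add: before_def)
  ultimately show ?thesis by (simp add: slot_start_def)
qed

lemma slot_end_le: "prob_vec p \<Longrightarrow> slot_start p i a + p a \<le> real (idx i) + 1"
  using slot_start_mono[of p a i UNIV] by (simp add: prob_vec_def)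

lemma slot_subset: "prob_vec p \<Longrightarrow> slot p i a \<subseteq> {real (idx i)..<real (idx i) + 1}"
  using slot_start_ge[of p i a] slot_end_le[of p i a] by (auto simp: slot_def)

text \<open>Different first letters live in different unit cells. Within one cell,
  \<open>before i\<close> lists the predecessors in a linear order with least element i, so one of
  two letters, together with its predecessors, precedes the other and its slot ends no later than
  the other begins.\<close>

lemma slot_unique:
  assumes p: "prob_vec p" and y: "y \<in> slot p i a" "y \<in> slot p j b"
  shows "i = j" "a = b"
proof -
  show ij: "i = j" using slot_subset[OF p] y unit_cell_unique by blast
  show "a = b"
  proof (rule ccontr)
    assume "a \<noteq> b"
    then consider "insert a (before i a) \<subseteq> before i b" | "insert b (before i b) \<subseteq> before i a"
    proof -
      have "idx a \<noteq> idx b" using \<open>a \<noteq> b\<close> by simp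
      then have "insert a (before i a) \<subseteq> before i b \<or> insert b (before i b) \<subseteq> before i a"
        unfolding before_def using \<open>a \<noteq> b\<close>
        by (cases "a = i"; cases "b = i"; cases "idx a < idx b") (auto simp del: idx_eq_iff)
      then show thesis using that by blast
    qed
    then show False
    proof cases
      case 1
      from slot_start_mono[OF p 1] y show False by (auto simp: slot_def slot_start_def ij)
    next
      case 2
      from slot_start_mono[OF p 2] y show False by (auto simp: slot_def slot_start_def ij)
    qed
  qed
qed

lemma slot_sets [measurable]: "slot p i a \<in> sets borel"
  by (simp add: slot_def)

lemma region_sets [measurable]: "region p a \<in> sets borel"
  by (auto simp: region_def)

lemma region_unique: "prob_vec p \<Longrightarrow> y \<in> region p a \<Longrightarrow> y \<in> region p b \<Longrightarrow> a = b"
  using slot_unique by (auto simp: region_def)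

lemma letter_eq: "prob_vec p \<Longrightarrow> y \<in> region p a \<Longrightarrow> letter p y = a"
  unfolding letter_def using region_unique by (blast intro: someI2)

lemma region_subset: "prob_vec p \<Longrightarrow> region p a \<subseteq> {0..<real CARD('a)}" for p :: "'a::finite \<Rightarrow> real"
  unfolding region_def unit_cells[symmetric] using slot_subset by blast

lemma prob_space_noise: "prob_space (noise TYPE('a::finite))"
  unfolding noise_def by (intro prob_space_uniform_measure) auto

lemma sets_noise [measurable_cong, simp]: "sets (noise T) = sets borel"
  by (simp add: noise_def)

lemma space_noise [simp]: "space (noise T) = UNIV"
  by (simp add: noise_def)

lemma emeasure_noise:
  "C \<in> sets borel \<Longrightarrow>
    emeasure (noise TYPE('a::finite)) C = emeasure lborel ({0..<real CARD('a)} \<inter> C) / ennreal (real CARD('a))"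
  unfolding noise_def by (subst emeasure_uniform_measure) auto

lemma emeasure_lborel_cells:
  assumes "C \<in> sets borel" "\<And>i::'a::finite. S i \<in> sets borel"
    "\<And>i::'a. S i \<subseteq> {real (idx i)..<real (idx i) + 1}"
  shows "emeasure lborel (C \<inter> (\<Union>i. S i)) = (\<Sum>i\<in>UNIV. emeasure lborel (C \<inter> S i))"
proof -
  have "(\<Sum>i\<in>UNIV. emeasure lborel (C \<inter> S i)) = emeasure lborel (\<Union>i. C \<inter> S i)"
  proof (rule sum_emeasure)
    show "disjoint_family_on (\<lambda>i. C \<inter> S i) UNIV"
      unfolding disjoint_family_on_def
    proof safe
      fix i j v assume "i \<noteq> j" "v \<in> S i" "v \<in> S j"
      with assms(3) have "i = j" by (intro unit_cell_unique[of v]) blast+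
      with \<open>i \<noteq> j\<close> show "v \<in> {}" by simp
    qed
  qed (use assms in auto)
  then show ?thesis by simp
qed

lemma emeasure_noise_region_Int:
  fixes p :: "'a::finite \<Rightarrow> real"
  assumes "prob_vec p" "C \<in> sets borel"
  shows "emeasure (noise TYPE('a)) (C \<inter> region p a) =
    (\<Sum>i\<in>UNIV. emeasure lborel (C \<inter> slot p i a)) / ennreal (real CARD('a))"
proof -
  have "{0..<real CARD('a)} \<inter> (C \<inter> region p a) = C \<inter> (\<Union>i. slot p i a)"
    using region_subset[OF assms(1), of a] by (auto simp: region_def)
  then show ?thesis
    using assms slot_subset[OF assms(1)]
    by (subst emeasure_noise) (auto simp: region_def emeasure_lborel_cells[where S="\<lambda>i. slot p i a"])
qed

lemma measure_noise_region:
  fixes p :: "'a::finite \<Rightarrow> real"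
  assumes p: "prob_vec p"
  shows "measure (noise TYPE('a)) (region p a) = p a"
proof -
  have "emeasure (noise TYPE('a)) (UNIV \<inter> region p a) =
    (\<Sum>i\<in>(UNIV::'a set). ennreal (p a)) / ennreal (real CARD('a))"
    using p by (subst emeasure_noise_region_Int) (auto simp: slot_def prob_vec_nonneg)
  also have "\<dots> = ennreal (p a)"
    using p by (simp add: prob_vec_nonneg ennreal_of_nat_eq_real_of_nat divide_ennreal flip: ennreal_mult)
  finally show ?thesis
    using p by (simp add: measure_def prob_vec_nonneg)
qed

text \<open>No geometric tiling is needed: the regions are disjoint and their measures already add
  up to one.\<close>

lemma AE_noise_region:
  fixes p :: "'a::finite \<Rightarrow> real"
  assumes p: "prob_vec p"
  shows "AE y in noise TYPE('a). \<exists>a. y \<in> region p a"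
proof -
  interpret N: prob_space "noise TYPE('a)" by (rule prob_space_noise)
  have "N.prob (\<Union>a. region p a) = (\<Sum>a\<in>UNIV. N.prob (region p a))"
    using region_unique[OF p] by (intro N.finite_measure_finite_Union) (auto simp: disjoint_family_on_def)
  also have "\<dots> = 1" using p by (simp add: measure_noise_region prob_vec_sum)
  finally have "N.prob (\<Union>a. region p a) = 1" .
  then have "AE y in noise TYPE('a). y \<in> (\<Union>a. region p a)"
    by (intro N.AE_prob_1) auto
  then show ?thesis by simp
qed

text \<open>Only slots with the same i can meet, and \<open>l i\<close> is a lower bound for the
  length of their intersection. The alternative \<open>l i = 0\<close> allows a cell to be given
  up.\<close>

lemma measure_noise_Int_region_ge:
  fixes p p' :: "'a::finite \<Rightarrow> real"
  assumes p: "prob_vec p" and p': "prob_vec p'"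
    and l: "\<And>i. 0 \<le> l i" "\<And>i. l i \<le> min (slot_start p i a + p a) (slot_start p' i a + p' a)
            - max (slot_start p i a) (slot_start p' i a) \<or> l i = 0"
  shows "sum l UNIV / real CARD('a) \<le> measure (noise TYPE('a)) (region p a \<inter> region p' a)"
proof -
  interpret N: prob_space "noise TYPE('a)" by (rule prob_space_noise)
  have "ennreal (sum l UNIV / real CARD('a)) = (\<Sum>i\<in>UNIV. ennreal (l i)) / ennreal (real CARD('a))"
    using l by (simp add: sum_nonneg divide_ennreal)
  also have "\<dots> \<le> (\<Sum>i\<in>UNIV. emeasure lborel (region p a \<inter> slot p' i a)) / ennreal (real CARD('a))"
  proof (intro divide_right_mono_ennreal sum_mono)
    fix i
    have "ennreal (l i) \<le> emeasure lborel (slot p i a \<inter> slot p' i a)"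
    proof (cases "l i = 0")
      case False
      define u where "u = max (slot_start p i a) (slot_start p' i a)"
      define v where "v = min (slot_start p i a + p a) (slot_start p' i a + p' a)"
      from False l[of i] have "l i \<le> v - u" "0 < l i" by (auto simp: u_def v_def less_le)
      moreover have "slot p i a \<inter> slot p' i a = {u..<v}" by (auto simp: slot_def u_def v_def)
      ultimately show ?thesis by (auto intro!: ennreal_leI)
    qed simp
    also have "\<dots> \<le> emeasure lborel (region p a \<inter> slot p' i a)"
      by (intro emeasure_mono) (auto simp: region_def)
    finally show "ennreal (l i) \<le> emeasure lborel (region p a \<inter> slot p' i a)" .
  qed
  also have "\<dots> = ennreal (N.prob (region p a \<inter> region p' a))"
    unfolding N.emeasure_eq_measure[symmetric] using p' by (subst emeasure_noise_region_Int) auto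
  finally show ?thesis by (simp add: ennreal_le_iff)
qed

text \<open>The cell i = a suffices: a comes first there, so both slots start at the same point. It
  is one cell out of \<open>CARD('a)\<close>, whence the divisor. The bound stays positive however
  far apart the two vectors are.\<close>

lemma measure_noise_Int_region_ge_min:
  fixes p p' :: "'a::finite \<Rightarrow> real"
  assumes p: "prob_vec p" and p': "prob_vec p'"
  shows "min (p a) (p' a) / real CARD('a) \<le> measure (noise TYPE('a)) (region p a \<inter> region p' a)"
proof -
  define l where "l i = (if i = a then min (p a) (p' a) else 0)" for i
  have "before a a = {}" by (auto simp: before_def)
  then have "sum l UNIV / real CARD('a) \<le> measure (noise TYPE('a)) (region p a \<inter> region p' a)"
    using p p' by (intro measure_noise_Int_region_ge) (auto simp: l_def slot_start_def prob_vec_nonneg)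
  then show ?thesis by (simp add: l_def)
qed

text \<open>The start of a slot is a partial sum of the vector, hence moves by at most the l1
  distance, which is \<open>2 * tv_dist p p'\<close>. The same loss occurs in each cell, so
  averaging over the cells costs no factor.\<close>

lemma measure_noise_Int_region_ge_diff:
  fixes p p' :: "'a::finite \<Rightarrow> real"
  assumes p: "prob_vec p" and p': "prob_vec p'"
  shows "min (p a) (p' a) - 2 * tv_dist p p' \<le> measure (noise TYPE('a)) (region p a \<inter> region p' a)"
proof -
  define l where "l = max 0 (min (p a) (p' a) - 2 * tv_dist p p')"
  have "\<bar>slot_start p i a - slot_start p' i a\<bar> \<le> 2 * tv_dist p p'" for i
  proof -
    have "\<bar>slot_start p i a - slot_start p' i a\<bar> = \<bar>\<Sum>b\<in>before i a. p b - p' b\<bar>"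
      by (simp add: slot_start_def sum_subtractf)
    also have "\<dots> \<le> (\<Sum>b\<in>before i a. \<bar>p b - p' b\<bar>)" by (rule sum_abs)
    also have "\<dots> \<le> (\<Sum>b\<in>UNIV. \<bar>p b - p' b\<bar>)" by (intro sum_mono2) auto
    finally show ?thesis by (simp add: tv_dist_def)
  qed
  then have "l \<le> min (slot_start p i a + p a) (slot_start p' i a + p' a)
            - max (slot_start p i a) (slot_start p' i a) \<or> l = 0" for i
    unfolding l_def by (smt (verit, best))
  from measure_noise_Int_region_ge[OF p p', of "\<lambda>_. l" a] this
  have "l \<le> measure (noise TYPE('a)) (region p a \<inter> region p' a)" by (simp add: l_def)
  then show ?thesis by (simp add: l_def)
qed

section \<open>Recovering the noise from the letter\<close>

lemma sample_eq:
  assumes "v \<in> {real (idx i)..<real (idx i) + 1}"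
  shows "sample p a v = slot_start p i a + p a * (v - real (idx i))"
proof -
  have "sample p a v = (\<Sum>j\<in>UNIV. if j = i then slot_start p i a + p a * (v - real (idx i)) else 0)"
    unfolding sample_def
  proof (rule sum.cong, rule refl)
    fix j :: 'a
    show "indicator {real (idx j)..<real (idx j) + 1} v * (slot_start p j a + p a * (v - real (idx j))) =
      (if j = i then slot_start p i a + p a * (v - real (idx i)) else 0)"
    proof (cases "j = i")
      case False
      then have "v \<notin> {real (idx j)..<real (idx j) + 1}" using unit_cell_unique[OF assms] by blast
      with False show ?thesis by (simp only: indicator_simps) simp
    qed (use assms in simp)
  qed
  then show ?thesis by simp
qed

lemma sample_in_region:
  fixes p :: "'a::finite \<Rightarrow> real"
  assumes "v \<in> {0..<real CARD('a)}" "0 < p a"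
  shows "sample p a v \<in> region p a"
proof -
  obtain i :: 'a where i: "v \<in> {real (idx i)..<real (idx i) + 1}"
    using assms(1) unfolding unit_cells[symmetric] by blast
  have "p a * (v - real (idx i)) < p a * 1" "0 \<le> p a * (v - real (idx i))"
    using i assms(2) by (intro mult_strict_left_mono mult_nonneg_nonneg; simp)+
  then have "sample p a v \<in> slot p i a"
    unfolding sample_eq[OF i] by (simp add: slot_def)
  then show ?thesis by (auto simp: region_def)
qed

lemma AE_noise_range: "AE v in noise TYPE('a::finite). v \<in> {0..<real CARD('a)}"
  unfolding noise_def by (intro AE_uniform_measureI) auto

lemma sample_measurable [measurable]:
  assumes [measurable]: "\<And>a. (\<lambda>x. p x a) \<in> borel_measurable M" "v \<in> borel_measurable M"
  shows "(\<lambda>x. sample (p x) a (v x)) \<in> borel_measurable M"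
  unfolding sample_def slot_start_def by measurable

text \<open>In each cell \<open>sample p a\<close> has slope \<open>p a\<close>, so the factor
  \<open>p a\<close> is the Jacobian. Summed over a, this says that a letter drawn from p, followed
  by \<open>sample\<close> at an independent v, restores the law \<open>noise\<close>.\<close>

lemma emeasure_noise_sample:
  fixes p :: "'a::finite \<Rightarrow> real"
  assumes p: "prob_vec p" and C[measurable]: "C \<in> sets borel"
  shows "ennreal (p a) * emeasure (noise TYPE('a)) {v. sample p a v \<in> C} =
    emeasure (noise TYPE('a)) (C \<inter> region p a)"
proof -
  have [measurable]: "{v. sample p a v \<in> C} \<in> sets borel"
    using measurable_sets_borel[OF sample_measurable[of "\<lambda>_. p" borel "\<lambda>v. v" a] C]
    unfolding vimage_def by measurable
  have cell: "ennreal (p a) * emeasure lborel ({v. sample p a v \<in> C} \<inter> {real (idx i)..<real (idx i) + 1}) =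
     emeasure lborel (C \<inter> slot p i a)" for i
  proof (cases "p a = 0")
    case True
    then show ?thesis by (simp add: slot_def)
  next
    case False
    with p have pa: "p a > 0" by (simp add: prob_vec_nonneg less_le)
    have "emeasure lborel (C \<inter> slot p i a) = (\<integral>\<^sup>+y. indicator (C \<inter> slot p i a) y \<partial>lborel)"
      by simp
    also have "\<dots> = \<bar>p a\<bar> * (\<integral>\<^sup>+v. indicator (C \<inter> slot p i a) ((slot_start p i a - p a * real (idx i)) + p a * v) \<partial>lborel)"
      using pa by (intro nn_integral_real_affine) auto
    also have "(\<integral>\<^sup>+v. indicator (C \<inter> slot p i a) ((slot_start p i a - p a * real (idx i)) + p a * v) \<partial>lborel) =
      (\<integral>\<^sup>+v. indicator ({v. sample p a v \<in> C} \<inter> {real (idx i)..<real (idx i) + 1}) v \<partial>lborel)"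
    proof (intro nn_integral_cong)
      fix v
      define y where "y = (slot_start p i a - p a * real (idx i)) + p a * v"
      have y: "y = slot_start p i a + p a * (v - real (idx i))" by (simp add: y_def algebra_simps)
      have "y \<in> slot p i a \<longleftrightarrow> p a * 0 \<le> p a * (v - real (idx i)) \<and> p a * (v - real (idx i)) < p a * 1"
        by (simp add: slot_def y)
      also have "\<dots> \<longleftrightarrow> v \<in> {real (idx i)..<real (idx i) + 1}"
        unfolding mult_less_cancel_left_pos[OF pa] mult_le_cancel_left_pos[OF pa] by auto
      finally have "y \<in> C \<inter> slot p i a \<longleftrightarrow> v \<in> {v. sample p a v \<in> C} \<inter> {real (idx i)..<real (idx i) + 1}"
        using sample_eq[of v i p a] y by auto
      then show "indicator (C \<inter> slot p i a) ((slot_start p i a - p a * real (idx i)) + p a * v) =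
        indicator ({v. sample p a v \<in> C} \<inter> {real (idx i)..<real (idx i) + 1}) v"
        unfolding y_def[symmetric] indicator_def by (rule arg_cong)
    qed
    finally show ?thesis using pa by simp
  qed
  have "ennreal (p a) * emeasure (noise TYPE('a)) {v. sample p a v \<in> C} =
    ennreal (p a) * emeasure lborel ({v. sample p a v \<in> C} \<inter> (\<Union>i::'a. {real (idx i)..<real (idx i) + 1})) / ennreal (real CARD('a))"
    by (subst emeasure_noise) (auto simp: unit_cells Int_commute ennreal_times_divide)
  also have "\<dots> = (\<Sum>i\<in>UNIV. emeasure lborel (C \<inter> slot p i a)) / ennreal (real CARD('a))"
    by (subst emeasure_lborel_cells) (auto simp: sum_distrib_left cell)
  also have "\<dots> = emeasure (noise TYPE('a)) (C \<inter> region p a)"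
    using p by (subst emeasure_noise_region_Int) auto
  finally show ?thesis .
qed

lemma region_measurable [measurable]:
  assumes [measurable]: "\<And>a. (\<lambda>x. p x a) \<in> borel_measurable M" "y \<in> borel_measurable M"
  shows "Measurable.pred M (\<lambda>x. y x \<in> region (p x) a)"
  unfolding region_def slot_def slot_start_def by simp

text \<open>The map factors through the set of admissible letters, which takes finitely many values;
  on a discrete space the choice operator is measurable.\<close>

lemma letter_measurable [measurable]:
  assumes [measurable]: "\<And>a. (\<lambda>x. p x a) \<in> borel_measurable M" "y \<in> borel_measurable M"
  shows "(\<lambda>x. letter (p x) (y x)) \<in> measurable M (count_space UNIV)"
proof -
  have "(\<lambda>x. {a. y x \<in> region (p x) a}) \<in> measurable M (count_space UNIV)"
  proof (subst measurable_count_space_eq2, simp, safe)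
    fix S
    have "(\<lambda>x. {a. y x \<in> region (p x) a}) -` {S} \<inter> space M = {x \<in> space M. \<forall>a. (y x \<in> region (p x) a) = (a \<in> S)}"
      by auto
    also have "\<dots> \<in> sets M" by measurable
    finally show "(\<lambda>x. {a. y x \<in> region (p x) a}) -` {S} \<inter> space M \<in> sets M" .
  qed simp
  from measurable_compose[OF this, of "\<lambda>S. SOME a. a \<in> S"]
  show ?thesis by (simp add: letter_def)
qed

section \<open>Pasts and one-step laws\<close>

lemma space_Past: "space Past = extensional {..(-1::int)}"
  by (simp add: space_PiM PiE_def)

lemma past_concat_space [simp]: "past_concat x z \<in> space Past"
  by (simp add: space_Past past_concat_def)

lemma past_of_space [simp]: "past_of X n \<omega> \<in> space Past"
  by (simp add: space_Past past_of_def)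

lemma past_concat_Nil: "x \<in> space Past \<Longrightarrow> past_concat x [] = x"
  by (auto simp: past_concat_def space_Past extensional_def)

lemma past_concat_append: "past_concat x (z @ w) = past_concat (past_concat x z) w"
proof
  fix k :: int
  show "past_concat x (z @ w) k = past_concat (past_concat x z) w k"
  proof (cases "k \<le> -1 \<and> k < - int (length w)")
    case True
    then show ?thesis
      by (auto simp: past_concat_def nth_append algebra_simps)
  next
    case False
    then have "\<not> nat (k + (int (length z) + int (length w))) < length z \<and>
      nat (k + (int (length z) + int (length w))) - length z = nat (k + int (length w))" if "k \<le> -1"
      using that by auto
    with False show ?thesis
      by (auto simp: past_concat_def nth_append)
  qed
qed

lemma past_concat_Cons: "past_concat x (a # z) = past_concat (past_concat x [a]) z"
  using past_concat_append[of x "[a]" z] by simp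

lemma past_of_concat: "past_of X n \<omega> = past_concat (past_of X (n - 1) \<omega>) [X n \<omega>]"
  by (auto simp: past_of_def past_concat_def fun_eq_iff algebra_simps)

lemma past_concat_measurable [measurable]: "(\<lambda>x. past_concat x z) \<in> measurable Past Past"
  unfolding past_concat_def
proof (rule measurable_restrict)
  fix k :: int assume k: "k \<in> {..-1}"
  show "(\<lambda>x. if - int (length z) \<le> k then z ! nat (k + int (length z)) else x (k + int (length z)))
    \<in> measurable Past (count_space UNIV)"
  proof (cases "- int (length z) \<le> k")
    case False
    then show ?thesis by simp
  qed simp
qed

lemma past_of_measurable [measurable]:
  assumes "\<And>n. X n \<in> measurable M (count_space UNIV)"
  shows "past_of X n \<in> measurable M Past"
  unfolding past_of_def using assms by (intro measurable_restrict) auto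

lemma tv_dist_nonneg: "0 \<le> tv_dist p p'"
  by (simp add: tv_dist_def sum_nonneg)

lemma tv_dist_triangle: "tv_dist p r \<le> tv_dist s p + tv_dist s r"
proof -
  have "(\<Sum>a\<in>UNIV. \<bar>p a - r a\<bar>) \<le> (\<Sum>a\<in>UNIV. \<bar>s a - p a\<bar> + \<bar>s a - r a\<bar>)"
    by (intro sum_mono) linarith
  then show ?thesis by (simp add: tv_dist_def sum.distrib)
qed

lemma tv_dist_ge_component: "\<bar>p a - r a\<bar> \<le> 2 * tv_dist p r"
  unfolding tv_dist_def using member_le_sum[of a UNIV "\<lambda>a. \<bar>p a - r a\<bar>"] by simp

lemma tv_dist_le_1:
  assumes "prob_vec p" "prob_vec r" shows "tv_dist p r \<le> 1"
proof -
  have "(\<Sum>a\<in>UNIV. \<bar>p a - r a\<bar>) \<le> (\<Sum>a\<in>UNIV. p a + r a)"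
    using assms by (intro sum_mono) (auto simp: prob_vec_def abs_le_iff add_nonneg_nonneg)
  also have "\<dots> = 2" using assms by (simp add: sum.distrib prob_vec_sum)
  finally show ?thesis by (simp add: tv_dist_def)
qed

lemma sum_words_Suc_snoc:
  fixes f :: "'a::finite list \<Rightarrow> 'b::comm_monoid_add"
  shows "(\<Sum>z | length z = Suc n. f z) = (\<Sum>z | length z = n. \<Sum>a\<in>UNIV. f (z @ [a]))"
proof -
  have "(\<Sum>z | length z = n. \<Sum>a\<in>UNIV. f (z @ [a])) = (\<Sum>(z, a)\<in>{z. length z = n} \<times> UNIV. f (z @ [a]))"
    by (simp add: sum.cartesian_product)
  also have "\<dots> = (\<Sum>z | length z = Suc n. f z)"
    by (rule sum.reindex_bij_witness[where i="\<lambda>z. (butlast z, last z)" and j="\<lambda>(z, a). z @ [a]"])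
       (auto simp: length_Suc_conv_rev)
  finally show ?thesis by simp
qed

lemma sum_words_Suc_Cons:
  fixes f :: "'a::finite list \<Rightarrow> 'b::comm_monoid_add"
  shows "(\<Sum>z | length z = Suc n. f z) = (\<Sum>a\<in>UNIV. \<Sum>z | length z = n. f (a # z))"
proof -
  have "(\<Sum>a\<in>UNIV. \<Sum>z | length z = n. f (a # z)) = (\<Sum>(a, z)\<in>UNIV \<times> {z. length z = n}. f (a # z))"
    by (simp add: sum.cartesian_product)
  also have "\<dots> = (\<Sum>z | length z = Suc n. f z)"
    by (rule sum.reindex_bij_witness[where i="\<lambda>z. (hd z, tl z)" and j="\<lambda>(a, z). a # z"])
       (auto simp: length_Suc_conv)
  finally show ?thesis by simp
qed

section \<open>Stationarity and the conditional law given the past\<close>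

locale primed_process = prob_space M
  for M :: "'w measure" +
  fixes X :: "int \<Rightarrow> 'w \<Rightarrow> 'a::finite" and q :: "(int \<Rightarrow> 'a) \<Rightarrow> 'a \<Rightarrow> real"
  assumes X_measurable [measurable]: "\<And>n. X n \<in> measurable M (count_space UNIV)"
    and stat: "stationary M X"
    and cond_law: "regular_cond_law M X q"
    and primed: "\<And>a. AE \<omega> in M. q (past_of X (-1) \<omega>) a > 0"
    and eta_summable: "summable (eta M X q)"
    and prob_vec_q: "\<And>x. prob_vec (q x)"
begin

definition past_law :: "(int \<Rightarrow> 'a) measure" where
  "past_law = distr M Past (past_of X (-1))"

lemma sets_past_law [measurable_cong, simp]: "sets past_law = sets Past"
  by (simp add: past_law_def)

lemma space_past_law [simp]: "space past_law = space Past"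
  by (simp add: past_law_def)

lemma prob_space_past_law: "prob_space past_law"
  unfolding past_law_def by (intro prob_space_distr) measurable

lemma q_measurable [measurable]: "(\<lambda>x. q x a) \<in> borel_measurable Past"
  using cond_law unfolding regular_cond_law_def by auto

lemma stationary_distr:
  "distr M (PiM UNIV (\<lambda>_. count_space UNIV)) (\<lambda>\<omega> n. X (n + k) \<omega>) =
   distr M (PiM UNIV (\<lambda>_. count_space UNIV)) (\<lambda>\<omega> n. X n \<omega>)"
  using stat by (simp add: stationary_def)

lemma shift_measurable [measurable]:
  "(\<lambda>\<omega> n. X (n + k) \<omega>) \<in> measurable M (PiM UNIV (\<lambda>_. count_space UNIV))"
  by (rule measurable_PiM_single') auto

lemma path_measurable [measurable]:
  "(\<lambda>\<omega> n. X n \<omega>) \<in> measurable M (PiM UNIV (\<lambda>_. count_space UNIV))"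
  by (rule measurable_PiM_single') auto

lemma nn_integral_stationary:
  assumes "f \<in> borel_measurable (PiM UNIV (\<lambda>_. count_space UNIV))"
  shows "(\<integral>\<^sup>+\<omega>. f (\<lambda>n. X (n + k) \<omega>) \<partial>M) = (\<integral>\<^sup>+\<omega>. f (\<lambda>n. X n \<omega>) \<partial>M)"
proof -
  have "(\<integral>\<^sup>+\<omega>. f (\<lambda>n. X (n + k) \<omega>) \<partial>M) = integral\<^sup>N (distr M (PiM UNIV (\<lambda>_. count_space UNIV)) (\<lambda>\<omega> n. X (n + k) \<omega>)) f"
    using assms by (subst nn_integral_distr) auto
  also have "\<dots> = (\<integral>\<^sup>+\<omega>. f (\<lambda>n. X n \<omega>) \<partial>M)"
    using assms unfolding stationary_distr by (subst nn_integral_distr) auto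
  finally show ?thesis .
qed

lemma past_of_shift: "past_of X (n + k) \<omega> = past_of (\<lambda>m f. f m) n (\<lambda>m. X (m + k) \<omega>)"
  by (simp add: past_of_def algebra_simps)

lemma nn_integral_past_shift:
  assumes [measurable]: "\<And>a. (\<lambda>x. f x a) \<in> borel_measurable Past"
  shows "(\<integral>\<^sup>+\<omega>. f (past_of X (n - 1) \<omega>) (X n \<omega>) \<partial>M) = (\<integral>\<^sup>+\<omega>. f (past_of X (-1) \<omega>) (X 0 \<omega>) \<partial>M)"
proof -
  let ?P = "PiM UNIV (\<lambda>_::int. count_space (UNIV :: 'a set))"
  have co [measurable]: "(\<lambda>s. s m) \<in> measurable ?P (count_space UNIV)" for m :: int
    by (rule measurable_component_singleton) simp
  have [measurable]: "past_of (\<lambda>m f. f m) (-1) \<in> measurable ?P Past"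
    by (rule past_of_measurable) (rule co)
  have "(\<lambda>s. f (past_of (\<lambda>m f. f m) (-1) s) (s 0)) \<in> borel_measurable ?P"
    by (rule measurable_compose_countable[OF _ co]) measurable
  from nn_integral_stationary[OF this, of n] show ?thesis
    using past_of_shift[of "-1" n] past_of_shift[of "-1" 0] by simp
qed

lemma nn_integral_past:
  assumes [measurable]: "f \<in> borel_measurable Past"
  shows "(\<integral>\<^sup>+\<omega>. f (past_of X n \<omega>) \<partial>M) = (\<integral>\<^sup>+x. f x \<partial>past_law)"
  using nn_integral_past_shift[of "\<lambda>x _. f x" "n + 1"] unfolding past_law_def
  by (simp add: nn_integral_distr)

lemma distr_past: "distr M Past (past_of X n) = past_law"
proof (rule measure_eqI)
  fix B assume "B \<in> sets (distr M Past (past_of X n))"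
  then have B[measurable]: "B \<in> sets Past" by simp
  have "emeasure (distr M Past (past_of X n)) B = (\<integral>\<^sup>+\<omega>. indicator B (past_of X n \<omega>) \<partial>M)"
    by (simp add: nn_integral_indicator[symmetric] nn_integral_distr del: nn_integral_indicator)
  also have "\<dots> = emeasure past_law B" by (subst nn_integral_past) auto
  finally show "emeasure (distr M Past (past_of X n)) B = emeasure past_law B" .
qed simp

text \<open>Disintegration at any time n. \<open>regular_cond_law\<close> covers events at time 0;
  for each letter it identifies two measures on pasts, which passes to nonnegative functions, and
  stationarity moves the result to n.\<close>

lemma nn_integral_past_letter:
  assumes [measurable]: "\<And>a. (\<lambda>x. f x a) \<in> borel_measurable Past"
  shows "(\<integral>\<^sup>+\<omega>. f (past_of X (n - 1) \<omega>) (X n \<omega>) \<partial>M) =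
    (\<integral>\<^sup>+x. (\<Sum>a\<in>UNIV. ennreal (q x a) * f x a) \<partial>past_law)"
proof -
  have one: "(\<integral>\<^sup>+\<omega>. indicator {a} (X 0 \<omega>) * g (past_of X (-1) \<omega>) \<partial>M) =
    (\<integral>\<^sup>+x. ennreal (q x a) * g x \<partial>past_law)" if [measurable]: "g \<in> borel_measurable Past" for a g
  proof -
    have "distr (density M (\<lambda>\<omega>. indicator {a} (X 0 \<omega>))) Past (past_of X (-1)) = density past_law (\<lambda>x. ennreal (q x a))"
    proof (rule measure_eqI)
      fix B assume "B \<in> sets (distr (density M (\<lambda>\<omega>. indicator {a} (X 0 \<omega>))) Past (past_of X (-1)))"
      then have B[measurable]: "B \<in> sets Past" by simp
      have "emeasure (distr (density M (\<lambda>\<omega>. indicator {a} (X 0 \<omega>))) Past (past_of X (-1))) B =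
        emeasure M {\<omega> \<in> space M. X 0 \<omega> = a \<and> past_of X (-1) \<omega> \<in> B}"
      proof -
        have "emeasure (distr (density M (\<lambda>\<omega>. indicator {a} (X 0 \<omega>))) Past (past_of X (-1))) B =
          (\<integral>\<^sup>+\<omega>. indicator {a} (X 0 \<omega>) * indicator (past_of X (-1) -` B \<inter> space M) \<omega> \<partial>M)"
          by (subst emeasure_distr) (auto simp: emeasure_density)
        also have "\<dots> = (\<integral>\<^sup>+\<omega>. indicator {\<omega> \<in> space M. X 0 \<omega> = a \<and> past_of X (-1) \<omega> \<in> B} \<omega> \<partial>M)"
          by (intro nn_integral_cong) (auto simp: indicator_def)
        also have "\<dots> = emeasure M {\<omega> \<in> space M. X 0 \<omega> = a \<and> past_of X (-1) \<omega> \<in> B}"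
          by (rule nn_integral_indicator) measurable
        finally show ?thesis .
      qed
      also have "\<dots> = ennreal (\<integral>\<omega>. indicator B (past_of X (-1) \<omega>) * q (past_of X (-1) \<omega>) a \<partial>M)"
        using cond_law B unfolding regular_cond_law_def by (simp add: emeasure_eq_measure)
      also have "\<dots> = (\<integral>\<^sup>+\<omega>. ennreal (indicator B (past_of X (-1) \<omega>) * q (past_of X (-1) \<omega>) a) \<partial>M)"
      proof (rule nn_integral_eq_integral[symmetric])
        show "integrable M (\<lambda>\<omega>. indicator B (past_of X (-1) \<omega>) * q (past_of X (-1) \<omega>) a)"
          by (rule integrable_const_bound[where B=1], rule AE_I2)
             (auto simp: indicator_def prob_vec_q prob_vec_le_1 prob_vec_nonneg)
      qed (auto simp: prob_vec_q prob_vec_nonneg)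
      also have "\<dots> = emeasure (density past_law (\<lambda>x. ennreal (q x a))) B"
      proof -
        have "emeasure (density past_law (\<lambda>x. ennreal (q x a))) B = (\<integral>\<^sup>+x. ennreal (q x a) * indicator B x \<partial>past_law)"
          by (rule emeasure_density) measurable
        also have "\<dots> = (\<integral>\<^sup>+\<omega>. ennreal (q (past_of X (-1) \<omega>) a) * indicator B (past_of X (-1) \<omega>) \<partial>M)"
          unfolding past_law_def by (rule nn_integral_distr) measurable
        also have "\<dots> = (\<integral>\<^sup>+\<omega>. ennreal (indicator B (past_of X (-1) \<omega>) * q (past_of X (-1) \<omega>) a) \<partial>M)"
          by (intro nn_integral_cong) (auto simp: indicator_def)
        finally show ?thesis by simp
      qed
      finally show "emeasure (distr (density M (\<lambda>\<omega>. indicator {a} (X 0 \<omega>))) Past (past_of X (-1))) B =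
        emeasure (density past_law (\<lambda>x. ennreal (q x a))) B" .
    qed simp
    from arg_cong[OF this, of "\<lambda>N. integral\<^sup>N N g"] show ?thesis
      by (simp add: nn_integral_distr nn_integral_density)
  qed
  have "(\<integral>\<^sup>+\<omega>. f (past_of X (n - 1) \<omega>) (X n \<omega>) \<partial>M) =
    (\<integral>\<^sup>+\<omega>. (\<Sum>a\<in>UNIV. indicator {a} (X 0 \<omega>) * f (past_of X (-1) \<omega>) a) \<partial>M)"
  proof -
    have "(\<Sum>a\<in>UNIV. indicator {a} (X 0 \<omega>) * f (past_of X (-1) \<omega>) a) = f (past_of X (-1) \<omega>) (X 0 \<omega>)" for \<omega>
      by (simp add: indicator_def of_bool_def if_distrib[of "\<lambda>x. x * _"] cong: if_cong)
    then show ?thesis by (simp add: nn_integral_past_shift)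
  qed
  also have "\<dots> = (\<Sum>a\<in>UNIV. (\<integral>\<^sup>+\<omega>. indicator {a} (X 0 \<omega>) * f (past_of X (-1) \<omega>) a \<partial>M))"
    by (rule nn_integral_sum) measurable
  also have "\<dots> = (\<Sum>a\<in>UNIV. (\<integral>\<^sup>+x. ennreal (q x a) * f x a \<partial>past_law))"
    by (intro sum.cong refl one) measurable
  also have "\<dots> = (\<integral>\<^sup>+x. (\<Sum>a\<in>UNIV. ennreal (q x a) * f x a) \<partial>past_law)"
    by (simp add: nn_integral_sum)
  finally show ?thesis .
qed

text \<open>Invariance of \<open>past_law\<close> under the transition kernel of q: both sides are
  the mean of h at the past of time 0.\<close>

lemma nn_integral_past_law_step:
  assumes [measurable]: "h \<in> borel_measurable Past"
  shows "(\<integral>\<^sup>+x. (\<Sum>a\<in>UNIV. ennreal (q x a) * h (past_concat x [a])) \<partial>past_law) = (\<integral>\<^sup>+x. h x \<partial>past_law)"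
  using nn_integral_past_letter[of "\<lambda>x a. h (past_concat x [a])" 0] nn_integral_past[of h 0]
    past_of_concat[of X 0] by simp

text \<open>Priming concerns typical pasts, whereas the coupling visits pasts extended by arbitrary
  words. By invariance a null set of pasts can be entered by appending b only if
  \<open>q x b\<close> vanishes, which priming excludes for almost every x; then induct on the
  word.\<close>

lemma AE_past_concat_pos: "AE x in past_law. \<forall>z a. 0 < q (past_concat x z) a"
proof -
  have base: "AE x in past_law. 0 < q x a" for a
    unfolding past_law_def using primed[of a] by (subst AE_distr_iff) measurable
  have "AE x in past_law. 0 < q (past_concat x z) a" for z a
  proof (induction z)
    case Nil
    then show ?case using base[of a] AE_space[of past_law] by eventually_elim (simp add: past_concat_Nil)
  next
    case (Cons b z)
    define h :: "(int \<Rightarrow> 'a) \<Rightarrow> ennreal" where "h x = indicator {x. \<not> 0 < q (past_concat x z) a} x" for x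
    have [measurable]: "h \<in> borel_measurable Past" unfolding h_def by measurable
    have "(\<integral>\<^sup>+x. h x \<partial>past_law) = 0"
      using Cons.IH by (subst nn_integral_0_iff_AE) (auto simp: h_def elim: eventually_mono)
    then have "AE x in past_law. (\<Sum>a\<in>UNIV. ennreal (q x a) * h (past_concat x [a])) = 0"
      using nn_integral_past_law_step[of h] by (subst nn_integral_0_iff_AE[symmetric]) auto
    with base[of b] show ?case
    proof eventually_elim
      case (elim x)
      from elim(2) have "\<forall>a. ennreal (q x a) * h (past_concat x [a]) = 0" by simp
      then have "ennreal (q x b) * h (past_concat x [b]) = 0" ..
      with elim(1) have "h (past_concat x [b]) = 0" by (metis ennreal_eq_0_iff mult_eq_0_iff not_less)
      then show ?case by (subst past_concat_Cons) (auto simp: h_def indicator_def split: if_splits)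
    qed
  qed
  then show ?thesis by (simp add: AE_all_countable)
qed

section \<open>Word probabilities and the finite-memory laws\<close>

abbreviation word_prob :: "'a list \<Rightarrow> real" where
  "word_prob z \<equiv> prob (block_event M X z)"

lemma block_event_past:
  "block_event M X z = {\<omega> \<in> space M. past_of X (-1) \<omega> \<in> {x \<in> space Past. \<forall>i<length z. x (int i - int (length z)) = z ! i}}"
  by (auto simp: block_event_def past_of_def space_Past)

lemma cylinder_sets [measurable]: "{x \<in> space Past. \<forall>i<length z. x (int i - int (length z)) = z ! i} \<in> sets Past"
proof -
  have [measurable]: "(\<lambda>x. x k) \<in> measurable Past (count_space UNIV)" if "k \<le> -1" for k :: int
    using that by (intro measurable_component_singleton) simp
  have "(\<lambda>x. x (int i - int (length z)) = z ! i) \<in> measurable Past (count_space UNIV)" if "i < length z" for i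
  proof -
    have "int i - int (length z) \<le> -1" using that by simp
    then show ?thesis by measurable
  qed
  then have "{x \<in> space Past. \<forall>i\<in>{..<length z}. x (int i - int (length z)) = z ! i} \<in> sets Past"
    by (intro sets.sets_Collect_finite_All) (auto simp: pred_def)
  then show ?thesis by (simp add: Ball_def)
qed

lemma block_event_sets [measurable]: "block_event M X z \<in> events"
  unfolding block_event_past by measurable

text \<open>A shift by one: \<open>block_event\<close> puts the last letter at time -1, while
  \<open>cprob\<close> wants it at time 0.\<close>

lemma word_prob_snoc: "word_prob (z @ [a]) = prob ({\<omega> \<in> space M. X 0 \<omega> = a} \<inter> block_event M X z)"
proof -
  let ?P = "PiM UNIV (\<lambda>_::int. count_space (UNIV :: 'a set))"
  define w where "w = z @ [a]"
  define S :: "(int \<Rightarrow> 'a) set" where "S = {s \<in> space ?P. \<forall>i\<in>{..<length w}. s (int i - int (length w)) = w ! i}"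
  have co [measurable]: "(\<lambda>s. s m) \<in> measurable ?P (count_space UNIV)" for m :: int
    by (rule measurable_component_singleton) simp
  have [measurable]: "S \<in> sets ?P" unfolding S_def by measurable
  have "emeasure M (block_event M X w) = (\<integral>\<^sup>+\<omega>. indicator S (\<lambda>n. X n \<omega>) \<partial>M)"
  proof -
    have "(\<integral>\<^sup>+\<omega>. indicator S (\<lambda>n. X n \<omega>) \<partial>M) = (\<integral>\<^sup>+\<omega>. indicator (block_event M X w) \<omega> \<partial>M)"
      by (intro nn_integral_cong) (auto simp: indicator_def S_def space_PiM block_event_def)
    then show ?thesis by simp
  qed
  also have "\<dots> = (\<integral>\<^sup>+\<omega>. indicator S (\<lambda>n. X (n + 1) \<omega>) \<partial>M)"
    by (subst nn_integral_stationary) auto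
  also have "\<dots> = emeasure M ({\<omega> \<in> space M. X 0 \<omega> = a} \<inter> block_event M X z)"
  proof -
    have "(\<forall>i\<in>{..<length w}. X (int i - int (length w) + 1) \<omega> = w ! i) \<longleftrightarrow>
      X 0 \<omega> = a \<and> (\<forall>i<length z. X (int i - int (length z)) \<omega> = z ! i)" for \<omega>
      unfolding w_def by (auto simp: lessThan_Suc nth_append)
    then have "(\<integral>\<^sup>+\<omega>. indicator S (\<lambda>n. X (n + 1) \<omega>) \<partial>M) =
      (\<integral>\<^sup>+\<omega>. indicator ({\<omega> \<in> space M. X 0 \<omega> = a} \<inter> block_event M X z) \<omega> \<partial>M)"
      by (intro nn_integral_cong) (auto simp: indicator_def S_def space_PiM block_event_def)
    then show ?thesis by simp
  qed
  finally show ?thesis by (simp add: w_def measure_def)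
qed

lemma word_prob_Nil: "word_prob [] = 1"
  by (simp add: block_event_def prob_space)

text \<open>If appending a produced a null event, q would vanish almost surely on the cylinder of z,
  against priming unless that cylinder is null. Consequently \<open>cprob\<close> is always a
  genuine conditional probability.\<close>

lemma word_prob_pos: "0 < word_prob z"
proof (induction z rule: rev_induct)
  case (snoc a z)
  let ?B = "{x \<in> space Past. \<forall>i<length z. x (int i - int (length z)) = z ! i}"
  have eq: "word_prob (z @ [a]) = (\<integral>\<omega>. indicator ?B (past_of X (-1) \<omega>) * q (past_of X (-1) \<omega>) a \<partial>M)"
  proof -
    have "{\<omega> \<in> space M. X 0 \<omega> = a} \<inter> block_event M X z = {\<omega> \<in> space M. X 0 \<omega> = a \<and> past_of X (-1) \<omega> \<in> ?B}"
      unfolding block_event_past by auto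
    moreover have "prob {\<omega> \<in> space M. X 0 \<omega> = a \<and> past_of X (-1) \<omega> \<in> ?B} =
      (\<integral>\<omega>. indicator ?B (past_of X (-1) \<omega>) * q (past_of X (-1) \<omega>) a \<partial>M)"
      using cond_law[unfolded regular_cond_law_def, THEN conjunct2, THEN conjunct2] cylinder_sets[of z] by blast
    ultimately show ?thesis unfolding word_prob_snoc by (simp only:)
  qed
  have int: "integrable M (\<lambda>\<omega>. indicator ?B (past_of X (-1) \<omega>) * q (past_of X (-1) \<omega>) a)"
    by (rule integrable_const_bound[where B=1], rule AE_I2)
       (auto simp: indicator_def prob_vec_q prob_vec_le_1 prob_vec_nonneg)
  have "word_prob (z @ [a]) \<noteq> 0"
  proof
    assume "word_prob (z @ [a]) = 0"
    then have "AE \<omega> in M. indicator ?B (past_of X (-1) \<omega>) * q (past_of X (-1) \<omega>) a = 0"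
      using int unfolding eq
      by (subst (asm) integral_nonneg_eq_0_iff_AE) (auto simp: prob_vec_q prob_vec_nonneg)
    then have "AE \<omega> in M. \<omega> \<notin> block_event M X z"
      using primed[of a] unfolding block_event_past by eventually_elim (auto simp: indicator_def)
    then have "word_prob z = 0" by (subst prob_eq_0) auto
    with snoc show False by simp
  qed
  then show ?case using zero_less_measure_iff by blast
qed (simp add: word_prob_Nil)

lemma word_prob_snoc_cprob: "word_prob (z @ [a]) = word_prob z * cprob M X z a"
  using word_prob_pos[of z] by (simp add: word_prob_snoc cprob_def)

lemma prob_vec_cprob: "prob_vec (cprob M X z)"
proof -
  have "(\<Sum>a\<in>UNIV. word_prob (z @ [a])) = prob (\<Union>a. {\<omega> \<in> space M. X 0 \<omega> = a} \<inter> block_event M X z)"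
    unfolding word_prob_snoc
    by (intro finite_measure_finite_Union[symmetric]) (auto simp: disjoint_family_on_def)
  also have "(\<Union>a. {\<omega> \<in> space M. X 0 \<omega> = a} \<inter> block_event M X z) = block_event M X z"
    by (auto simp: block_event_def)
  finally have "word_prob z * (\<Sum>a\<in>UNIV. cprob M X z a) = word_prob z * 1"
    by (simp add: word_prob_snoc_cprob sum_distrib_left)
  then show ?thesis
    using word_prob_pos[of z] by (auto simp: prob_vec_def cprob_def)
qed

lemma sum_word_prob: "(\<Sum>z | length z = n. word_prob z) = 1"
proof (induction n)
  case (Suc n)
  then show ?case
    using prob_vec_sum[OF prob_vec_cprob]
    by (simp add: sum_words_Suc_snoc word_prob_snoc_cprob flip: sum_distrib_left)
qed (simp add: word_prob_Nil)

text \<open>The mean distance between the finite-memory law and the law of the chain started at x,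
  after n letters drawn from the finite-memory chain. Drawing the word independently of x lets one
  family of words serve two pasts at once.\<close>

definition psi :: "nat \<Rightarrow> (int \<Rightarrow> 'a) \<Rightarrow> real" where
  "psi n x = (\<Sum>z | length z = n. word_prob z * tv_dist (cprob M X z) (q (past_concat x z)))"

lemma psi_measurable [measurable]: "psi n \<in> borel_measurable Past"
  unfolding psi_def tv_dist_def by measurable

lemma psi_nonneg: "0 \<le> psi n x"
  unfolding psi_def by (intro sum_nonneg mult_nonneg_nonneg tv_dist_nonneg) simp

lemma psi_le_1: "psi n x \<le> 1"
proof -
  have "psi n x \<le> (\<Sum>z | length z = n. word_prob z * 1)"
    unfolding psi_def
    by (intro sum_mono mult_left_mono tv_dist_le_1 prob_vec_cprob prob_vec_q) simp_all
  then show ?thesis by (simp add: sum_word_prob)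
qed

text \<open>The past at time -n-1 enters \<open>eta\<close> only through its law, which is
  \<open>past_law\<close> at every time.\<close>

lemma nn_integral_psi: "(\<integral>\<^sup>+x. ennreal (psi n x) \<partial>past_law) = ennreal (eta M X q n)"
proof -
  interpret P: prob_space past_law by (rule prob_space_past_law)
  have int: "integrable past_law (\<lambda>x. tv_dist (cprob M X z) (q (past_concat x z)))" for z
    by (rule P.integrable_const_bound[where B=1], rule AE_I2)
       (auto simp: tv_dist_nonneg intro!: tv_dist_le_1 prob_vec_cprob prob_vec_q, unfold tv_dist_def, measurable)
  have "(\<integral>x. psi n x \<partial>past_law) = (\<Sum>z | length z = n. word_prob z * (\<integral>x. tv_dist (cprob M X z) (q (past_concat x z)) \<partial>past_law))"
    unfolding psi_def using int by (subst Bochner_Integration.integral_sum) auto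
  also have "\<dots> = eta M X q n"
  proof -
    have "(\<integral>x. tv_dist (cprob M X z) (q (past_concat x z)) \<partial>past_law) =
      (\<integral>\<omega>. tv_dist (cprob M X z) (q (past_concat (past_of X (- int n - 1) \<omega>) z)) \<partial>M)" for z
      unfolding distr_past[of "- int n - 1", symmetric] tv_dist_def
      by (subst integral_distr) auto
    then show ?thesis by (simp add: eta_def mult.commute)
  qed
  finally have "(\<integral>x. psi n x \<partial>past_law) = eta M X q n" .
  moreover have "integrable past_law (psi n)"
    by (rule P.integrable_const_bound[where B=1], rule AE_I2) (auto simp: psi_nonneg psi_le_1)
  ultimately show ?thesis
    by (subst nn_integral_eq_integral) (auto simp: psi_nonneg)
qed

section \<open>Coupled chains\<close>

definition overlap :: "(int \<Rightarrow> 'a) \<Rightarrow> (int \<Rightarrow> 'a) \<Rightarrow> 'a \<Rightarrow> 'a \<Rightarrow> real" where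
  "overlap x x' a b = measure (noise TYPE('a)) (region (q x) a \<inter> region (q x') b)"

text \<open>Transition operator of two chains fed with the same noise; \<open>agree\<close> is its part on the event that
  both chains receive the same letter.\<close>

definition couple :: "((int \<Rightarrow> 'a) \<Rightarrow> (int \<Rightarrow> 'a) \<Rightarrow> real) \<Rightarrow> (int \<Rightarrow> 'a) \<Rightarrow> (int \<Rightarrow> 'a) \<Rightarrow> real" where
  "couple F x x' = (\<Sum>a\<in>UNIV. \<Sum>b\<in>UNIV. overlap x x' a b * F (past_concat x [a]) (past_concat x' [b]))"

definition agree :: "((int \<Rightarrow> 'a) \<Rightarrow> (int \<Rightarrow> 'a) \<Rightarrow> real) \<Rightarrow> (int \<Rightarrow> 'a) \<Rightarrow> (int \<Rightarrow> 'a) \<Rightarrow> real" where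
  "agree F x x' = (\<Sum>a\<in>UNIV. overlap x x' a a * F (past_concat x [a]) (past_concat x' [a]))"

lemma overlap_nonneg [simp]: "0 \<le> overlap x x' a b"
  by (simp add: overlap_def)

lemma overlap_commute: "overlap x x' a b = overlap x' x b a"
  by (simp add: overlap_def Int_commute)

text \<open>\<open>overlap\<close> is a coupling of the two one-step laws because the regions of
  \<open>q x'\<close> exhaust the noise up to a null set; the other marginal follows from
  \<open>overlap_commute\<close>.\<close>

lemma sum_overlap: "(\<Sum>b\<in>UNIV. overlap x x' a b) = q x a"
proof -
  interpret N: prob_space "noise TYPE('a)" by (rule prob_space_noise)
  have "(\<Sum>b\<in>UNIV. overlap x x' a b) = N.prob (\<Union>b. region (q x) a \<inter> region (q x') b)"
    unfolding overlap_def using region_unique[OF prob_vec_q[of x']]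
    by (intro N.finite_measure_finite_Union[symmetric]) (auto simp: disjoint_family_on_def)
  also have "\<dots> = N.prob (region (q x) a)"
    using AE_noise_region[OF prob_vec_q[of x']]
    by (intro N.finite_measure_eq_AE) (auto elim: eventually_mono)
  finally show ?thesis by (simp add: measure_noise_region prob_vec_q)
qed

lemma overlap_measurable [measurable]:
  assumes [measurable]: "f \<in> measurable N Past" "g \<in> measurable N Past"
  shows "(\<lambda>y. overlap (f y) (g y) a b) \<in> borel_measurable N"
proof -
  interpret N: prob_space "noise TYPE('a)" by (rule prob_space_noise)
  have "overlap (f y) (g y) a b = (\<integral>u. indicator {u. u \<in> region (q (f y)) a \<and> u \<in> region (q (g y)) b} u \<partial>noise TYPE('a))" for y
    unfolding overlap_def by (simp add: Int_def)
  then show ?thesis by simp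
qed

lemma couple_mono: "(\<And>x x'. F x x' \<le> G x x') \<Longrightarrow> couple F x x' \<le> couple G x x'"
  unfolding couple_def by (intro sum_mono mult_left_mono) simp_all

lemma agree_mono: "(\<And>x x'. F x x' \<le> G x x') \<Longrightarrow> agree F x x' \<le> agree G x x'"
  unfolding agree_def by (intro sum_mono mult_left_mono) simp_all

lemma couple_diff: "couple (\<lambda>x x'. F x x' - G x x') x x' = couple F x x' - couple G x x'"
  by (simp add: couple_def right_diff_distrib sum_subtractf)

lemma couple_add: "couple (\<lambda>x x'. F x x' + G x x') x x' = couple F x x' + couple G x x'"
  by (simp add: couple_def distrib_left sum.distrib)

lemma couple_cmult: "couple (\<lambda>x x'. c * F x x') x x' = c * couple F x x'"
  by (simp add: couple_def sum_distrib_left mult.left_commute)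

lemma agree_diff: "agree (\<lambda>x x'. F x x' - G x x') x x' = agree F x x' - agree G x x'"
  by (simp add: agree_def right_diff_distrib sum_subtractf)

lemma agree_cmult: "agree (\<lambda>x x'. c * F x x') x x' = c * agree F x x'"
  by (simp add: agree_def sum_distrib_left mult.left_commute)

lemma couple_const: "couple (\<lambda>_ _. c) x x' = c"
  by (simp add: couple_def sum_overlap prob_vec_sum[OF prob_vec_q] flip: sum_distrib_right)

lemma agree_le_couple:
  assumes "\<And>x x'. 0 \<le> F x x'"
  shows "agree F x x' \<le> couple F x x'"
  unfolding agree_def couple_def
proof (rule sum_mono)
  fix a
  show "overlap x x' a a * F (past_concat x [a]) (past_concat x' [a]) \<le>
    (\<Sum>b\<in>UNIV. overlap x x' a b * F (past_concat x [a]) (past_concat x' [b]))"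
    using assms by (intro member_le_sum[of a UNIV "\<lambda>b. overlap x x' a b * F (past_concat x [a]) (past_concat x' [b])"]) auto
qed

lemma couple_pow_mono:
  "(\<And>x x'. F x x' \<le> G x x') \<Longrightarrow> (couple ^^ n) F x x' \<le> (couple ^^ n) G x x'"
  by (induction n arbitrary: x x') (simp_all add: couple_mono)

lemma agree_pow_mono:
  "(\<And>x x'. F x x' \<le> G x x') \<Longrightarrow> (agree ^^ n) F x x' \<le> (agree ^^ n) G x x'"
  by (induction n arbitrary: x x') (simp_all add: agree_mono)

lemma couple_pow_const: "(couple ^^ n) (\<lambda>_ _. c) x x' = c"
proof (induction n arbitrary: x x')
  case (Suc n)
  then have "(couple ^^ n) (\<lambda>_ _. c) = (\<lambda>_ _. c)" by (intro ext)
  then show ?case by (simp add: couple_const)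
qed simp

lemma couple_pow_diff: "(couple ^^ n) (\<lambda>x x'. F x x' - G x x') x x' = (couple ^^ n) F x x' - (couple ^^ n) G x x'"
proof (induction n arbitrary: x x')
  case (Suc n)
  then have "(couple ^^ n) (\<lambda>x x'. F x x' - G x x') = (\<lambda>x x'. (couple ^^ n) F x x' - (couple ^^ n) G x x')" by (intro ext)
  then show ?case by (simp add: couple_diff)
qed simp

lemma couple_pow_add: "(couple ^^ n) (\<lambda>x x'. F x x' + G x x') x x' = (couple ^^ n) F x x' + (couple ^^ n) G x x'"
proof (induction n arbitrary: x x')
  case (Suc n)
  then have "(couple ^^ n) (\<lambda>x x'. F x x' + G x x') = (\<lambda>x x'. (couple ^^ n) F x x' + (couple ^^ n) G x x')" by (intro ext)
  then show ?case by (simp add: couple_add)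
qed simp

lemma couple_pow_cmult: "(couple ^^ n) (\<lambda>x x'. c * F x x') x x' = c * (couple ^^ n) F x x'"
proof (induction n arbitrary: x x')
  case (Suc n)
  then have "(couple ^^ n) (\<lambda>x x'. c * F x x') = (\<lambda>x x'. c * (couple ^^ n) F x x')" by (intro ext)
  then show ?case by (simp add: couple_cmult)
qed simp

lemma agree_pow_diff: "(agree ^^ n) (\<lambda>x x'. F x x' - G x x') x x' = (agree ^^ n) F x x' - (agree ^^ n) G x x'"
proof (induction n arbitrary: x x')
  case (Suc n)
  then have "(agree ^^ n) (\<lambda>x x'. F x x' - G x x') = (\<lambda>x x'. (agree ^^ n) F x x' - (agree ^^ n) G x x')" by (intro ext)
  then show ?case by (simp add: agree_diff)
qed simp

lemma agree_pow_cmult: "(agree ^^ n) (\<lambda>x x'. c * F x x') x x' = c * (agree ^^ n) F x x'"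
proof (induction n arbitrary: x x')
  case (Suc n)
  then have "(agree ^^ n) (\<lambda>x x'. c * F x x') = (\<lambda>x x'. c * (agree ^^ n) F x x')" by (intro ext)
  then show ?case by (simp add: agree_cmult)
qed simp

lemma agree_pow_nonneg: "(\<And>x x'. 0 \<le> F x x') \<Longrightarrow> 0 \<le> (agree ^^ n) F x x'"
  by (induction n arbitrary: x x') (auto simp: agree_def intro!: sum_nonneg)

lemma couple_pow_nonneg: "(\<And>x x'. 0 \<le> F x x') \<Longrightarrow> 0 \<le> (couple ^^ n) F x x'"
  using couple_pow_mono[of "\<lambda>_ _. 0" F n x x'] by (simp add: couple_pow_const)

lemma couple_pow_le_1: "(\<And>x x'. F x x' \<le> 1) \<Longrightarrow> (couple ^^ n) F x x' \<le> 1"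
  using couple_pow_mono[of F "\<lambda>_ _. 1" n x x'] by (simp add: couple_pow_const)

lemma agree_pow_le_couple_pow:
  assumes "\<And>x x'. 0 \<le> F x x'"
  shows "(agree ^^ n) F x x' \<le> (couple ^^ n) F x x'"
proof (induction n arbitrary: x x')
  case (Suc n)
  have "agree ((agree ^^ n) F) x x' \<le> couple ((agree ^^ n) F) x x'"
    by (intro agree_le_couple agree_pow_nonneg assms)
  also have "\<dots> \<le> couple ((couple ^^ n) F) x x'" by (intro couple_mono Suc)
  finally show ?case by simp
qed simp

text \<open>The probability that two chains started at x and x' and fed with the same noise receive
  n equal letters in a row. Its limit \<open>surv_lim\<close> is the probability that they never
  disagree.\<close>

definition surv :: "nat \<Rightarrow> (int \<Rightarrow> 'a) \<Rightarrow> (int \<Rightarrow> 'a) \<Rightarrow> real" where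
  "surv n = (agree ^^ n) (\<lambda>_ _. 1)"

definition surv_lim :: "(int \<Rightarrow> 'a) \<Rightarrow> (int \<Rightarrow> 'a) \<Rightarrow> real" where
  "surv_lim x x' = lim (\<lambda>n. surv n x x')"

lemma surv_nonneg: "0 \<le> surv n x x'"
  unfolding surv_def by (rule agree_pow_nonneg) simp

lemma surv_Suc_le: "surv (Suc n) x x' \<le> surv n x x'"
proof -
  have "agree (\<lambda>_ _. 1) x x' \<le> 1" for x x'
    using agree_le_couple[of "\<lambda>_ _. 1" x x'] by (simp add: couple_const)
  then have "(agree ^^ n) (agree (\<lambda>_ _. 1)) x x' \<le> (agree ^^ n) (\<lambda>_ _. 1) x x'"
    by (rule agree_pow_mono)
  then show ?thesis by (simp add: surv_def funpow_swap1)
qed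

lemma decseq_surv: "decseq (\<lambda>n. surv n x x')"
  by (rule decseq_SucI) (rule surv_Suc_le)

lemma surv_le_1: "surv n x x' \<le> 1"
  using decseqD[OF decseq_surv, of 0 n x x'] by (simp add: surv_def)

lemma surv_tendsto: "(\<lambda>n. surv n x x') \<longlonglongrightarrow> surv_lim x x'"
proof -
  obtain l where "(\<lambda>n. surv n x x') \<longlonglongrightarrow> l"
    by (rule decseq_convergent[OF decseq_surv, of 0 x x']) (auto simp: surv_nonneg)
  then show ?thesis unfolding surv_lim_def by (simp add: limI)
qed

lemma surv_lim_le: "surv_lim x x' \<le> surv n x x'"
  using decseq_ge[OF decseq_surv surv_tendsto] .

lemma surv_lim_nonneg: "0 \<le> surv_lim x x'"
  using LIMSEQ_le_const[OF surv_tendsto] surv_nonneg by blast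

lemma surv_lim_le_1: "surv_lim x x' \<le> 1"
  using surv_lim_le[of x x' 0] by (simp add: surv_def)

text \<open>\<open>agree\<close> is a finite sum, so it commutes with the limit. Together with
  \<open>agree_le_couple\<close> this makes \<open>surv_lim\<close> increase in mean along the
  coupled chains.\<close>

lemma agree_surv_lim: "agree surv_lim x x' = surv_lim x x'"
proof (rule LIMSEQ_unique)
  have "(\<lambda>n. agree (surv n) x x') \<longlonglongrightarrow> agree surv_lim x x'"
    unfolding agree_def by (intro tendsto_sum tendsto_mult tendsto_const surv_tendsto)
  then show "(\<lambda>n. surv (Suc n) x x') \<longlonglongrightarrow> agree surv_lim x x'"
    by (simp add: surv_def)
  show "(\<lambda>n. surv (Suc n) x x') \<longlonglongrightarrow> surv_lim x x'"
    using surv_tendsto by (rule LIMSEQ_Suc)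
qed

lemma agree_pow_surv_lim: "(agree ^^ n) surv_lim = surv_lim"
proof (induction n)
  case (Suc n)
  then show ?case using agree_surv_lim by (auto intro: ext)
qed simp

lemma couple_measurable:
  assumes [measurable]: "case_prod F \<in> borel_measurable (Past \<Otimes>\<^sub>M Past)"
  shows "case_prod (couple F) \<in> borel_measurable (Past \<Otimes>\<^sub>M Past)"
proof -
  have "(\<lambda>y. F (past_concat (fst y) [a]) (past_concat (snd y) [b])) \<in> borel_measurable (Past \<Otimes>\<^sub>M Past)" for a b
    using measurable_compose[OF measurable_Pair[of "\<lambda>y. past_concat (fst y) [a]" "Past \<Otimes>\<^sub>M Past" Past "\<lambda>y. past_concat (snd y) [b]" Past] assms]
    by simp
  then show ?thesis
    unfolding couple_def case_prod_beta by measurable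
qed

lemma agree_measurable:
  assumes [measurable]: "case_prod F \<in> borel_measurable (Past \<Otimes>\<^sub>M Past)"
  shows "case_prod (agree F) \<in> borel_measurable (Past \<Otimes>\<^sub>M Past)"
proof -
  have "(\<lambda>y. F (past_concat (fst y) [a]) (past_concat (snd y) [b])) \<in> borel_measurable (Past \<Otimes>\<^sub>M Past)" for a b
    using measurable_compose[OF measurable_Pair[of "\<lambda>y. past_concat (fst y) [a]" "Past \<Otimes>\<^sub>M Past" Past "\<lambda>y. past_concat (snd y) [b]" Past] assms]
    by simp
  then show ?thesis
    unfolding agree_def case_prod_beta by measurable
qed

lemma couple_pow_measurable:
  "case_prod F \<in> borel_measurable (Past \<Otimes>\<^sub>M Past) \<Longrightarrow> case_prod ((couple ^^ n) F) \<in> borel_measurable (Past \<Otimes>\<^sub>M Past)"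
  by (induction n) (simp_all add: couple_measurable)

lemma surv_measurable: "case_prod (surv n) \<in> borel_measurable (Past \<Otimes>\<^sub>M Past)"
  unfolding surv_def by (induction n) (simp_all add: agree_measurable)

lemma surv_lim_measurable: "case_prod surv_lim \<in> borel_measurable (Past \<Otimes>\<^sub>M Past)"
  by (rule borel_measurable_LIMSEQ_real[OF _ surv_measurable]) (auto intro: surv_tendsto)

text \<open>The probability that both chains receive exactly the word z. The operator
  \<open>agree\<close> peels off the first letter of z, whereas the estimates below append a last
  one; this product can be split at either end.\<close>

definition path_weight :: "(int \<Rightarrow> 'a) \<Rightarrow> (int \<Rightarrow> 'a) \<Rightarrow> 'a list \<Rightarrow> real" where
  "path_weight x x' z = (\<Prod>k<length z. overlap (past_concat x (take k z)) (past_concat x' (take k z)) (z ! k) (z ! k))"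

lemma path_weight_snoc:
  "path_weight x x' (z @ [a]) = path_weight x x' z * overlap (past_concat x z) (past_concat x' z) a a"
  by (simp add: path_weight_def nth_append)

lemma path_weight_Cons:
  assumes "x \<in> space Past" "x' \<in> space Past"
  shows "path_weight x x' (a # z) = overlap x x' a a * path_weight (past_concat x [a]) (past_concat x' [a]) z"
proof -
  have "past_concat y (a # take k z) = past_concat (past_concat y [a]) (take k z)" for y k
    by (rule past_concat_Cons)
  with assms show ?thesis
    by (simp add: path_weight_def prod.lessThan_Suc_shift past_concat_Nil del: prod.lessThan_Suc)
qed

lemma surv_eq_sum_path_weight:
  assumes "x \<in> space Past" "x' \<in> space Past"
  shows "surv n x x' = (\<Sum>z | length z = n. path_weight x x' z)"
  using assms
proof (induction n arbitrary: x x')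
  case (Suc n)
  have "surv (Suc n) x x' = (\<Sum>a\<in>UNIV. overlap x x' a a * surv n (past_concat x [a]) (past_concat x' [a]))"
    by (simp add: surv_def agree_def)
  also have "\<dots> = (\<Sum>z | length z = Suc n. path_weight x x' z)"
    using Suc.prems by (simp add: Suc.IH sum_words_Suc_Cons path_weight_Cons sum_distrib_left)
  finally show ?case .
qed (simp add: surv_def path_weight_def)

text \<open>The first j letters are paid for multiplicatively, by a factor
  \<open>\<delta> / real CARD('a)\<close> each, and all later ones additively, by
  \<open>psi\<close>. The final 1/2 is 1 - 1/4 - 1/4, one quarter per past. The bound does not
  depend on n, so it survives the limit.\<close>

lemma surv_ge:
  assumes x: "x \<in> space Past" "x' \<in> space Past" and "0 < \<delta>"
    and \<delta>: "\<And>z a. length z < j \<Longrightarrow> \<delta> \<le> q (past_concat x z) a"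
           "\<And>z a. length z < j \<Longrightarrow> \<delta> \<le> q (past_concat x' z) a"
    and tail: "\<And>n. (\<Sum>k=j..<n. 4 * real CARD('a) * psi k x) \<le> 1/4"
              "\<And>n. (\<Sum>k=j..<n. 4 * real CARD('a) * psi k x') \<le> 1/4"
  shows "(\<delta> / real CARD('a)) ^ j / 2 \<le> surv n x x'"
proof -
  define c where "c = cprob M X"
  \<comment> \<open>Capping by \<open>c\<close> keeps \<open>v \<le> word_prob\<close>, so that each letter beyond the \<open>j\<close>-th costs at most a
    multiple of \<open>psi\<close>.\<close>
  define h where "h z a = min (overlap (past_concat x z) (past_concat x' z) a a) (c z a)" for z a
  define D where "D y z = tv_dist (c z) (q (past_concat y z))" for y z
  define v where "v z = (\<Prod>k<length z. if k < j then c (take k z) (z ! k) else h (take k z) (z ! k))" for z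
  have c: "prob_vec (c z)" for z by (simp add: c_def prob_vec_cprob)
  have h_nonneg: "0 \<le> h z a" for z a by (simp add: h_def prob_vec_nonneg c)
  \<comment> \<open>The constant 4 is 2 + 2: passing from c to the smaller of the two q-values costs
    at most twice the larger D, and the shift of the slots costs twice the distance of the two
    q-laws, which is at most the sum of both D.\<close>
  have h_ge: "c z a - 4 * (D x z + D x' z) \<le> h z a" for z a
  proof -
    have "min (q (past_concat x z) a) (q (past_concat x' z) a) - 2 * tv_dist (q (past_concat x z)) (q (past_concat x' z))
      \<le> overlap (past_concat x z) (past_concat x' z) a a"
      unfolding overlap_def by (intro measure_noise_Int_region_ge_diff prob_vec_q)
    moreover have "tv_dist (q (past_concat x z)) (q (past_concat x' z)) \<le> D x z + D x' z"
      unfolding D_def by (rule tv_dist_triangle)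
    moreover have "\<bar>c z a - q (past_concat x z) a\<bar> \<le> 2 * D x z" "\<bar>c z a - q (past_concat x' z) a\<bar> \<le> 2 * D x' z"
      unfolding D_def by (rule tv_dist_ge_component)+
    moreover have "0 \<le> D x z" "0 \<le> D x' z" unfolding D_def by (rule tv_dist_nonneg)+
    ultimately show ?thesis unfolding h_def by (smt (verit))
  qed
  have v_snoc: "v (z @ [a]) = v z * (if length z < j then c z a else h z a)" for z a
  proof -
    have "(\<Prod>k<length z. if k < j then c (take k (z @ [a])) ((z @ [a]) ! k) else h (take k (z @ [a])) ((z @ [a]) ! k)) = v z"
      unfolding v_def by (intro prod.cong) (auto simp: nth_append)
    then show ?thesis by (simp add: v_def)
  qed
  have v_nonneg: "0 \<le> v z" for z
    unfolding v_def by (intro prod_nonneg) (auto simp: h_nonneg prob_vec_nonneg c)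
  have v_le: "v z \<le> word_prob z" for z
  proof (induction z rule: rev_induct)
    case (snoc a z)
    have "(if length z < j then c z a else h z a) \<le> c z a" by (simp add: h_def)
    then show ?case
      using snoc v_nonneg unfolding v_snoc word_prob_snoc_cprob c_def[symmetric]
      by (intro mult_mono) (auto simp: h_nonneg prob_vec_nonneg c)
  qed (simp add: v_def word_prob_Nil)
  have v_eq: "length z \<le> j \<Longrightarrow> v z = word_prob z" for z
    by (induction z rule: rev_induct) (auto simp: v_snoc word_prob_snoc_cprob c_def, auto simp: v_def word_prob_Nil)
  \<comment> \<open>The total mass of v is one at length j. Beyond j, replacing c by h loses at most
    \<open>4 * (D x z + D x' z)\<close> for each of the \<open>CARD('a)\<close> letters; since
    \<open>v z\<close> is at most \<open>word_prob z\<close>, the weighted loss at length n is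
    bounded by the \<open>psi n\<close> terms of both pasts.\<close>
  have E: "1 - (\<Sum>k=j..<n. 4 * real CARD('a) * psi k x) - (\<Sum>k=j..<n. 4 * real CARD('a) * psi k x')
      \<le> (\<Sum>z | length z = n. v z)" if "j \<le> n" for n
    using that
  proof (induction n rule: dec_induct)
    case base
    have "(\<Sum>z | length z = j. v z) = (\<Sum>z::'a list | length z = j. word_prob z)"
      by (intro sum.cong) (auto simp: v_eq)
    then show ?case by (simp add: sum_word_prob)
  next
    case (step n)
    have "(\<Sum>z | length z = n. v z) - 4 * real CARD('a) * psi n x - 4 * real CARD('a) * psi n x' =
      (\<Sum>z | length z = n. v z - word_prob z * (\<Sum>a\<in>(UNIV::'a set). 4 * (D x z + D x' z)))"
      by (simp add: psi_def sum_subtractf sum.distrib sum_distrib_left D_def c_def algebra_simps)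
    also have "\<dots> \<le> (\<Sum>z | length z = n. \<Sum>a\<in>UNIV. v (z @ [a]))"
    proof (rule sum_mono)
      fix z :: "'a list" assume "z \<in> {z. length z = n}"
      then have z: "\<not> length z < j" using step by simp
      have "0 \<le> (\<Sum>a\<in>(UNIV::'a set). 4 * (D x z + D x' z))"
        by (intro sum_nonneg) (simp add: D_def tv_dist_nonneg)
      then have "v z - word_prob z * (\<Sum>a\<in>(UNIV::'a set). 4 * (D x z + D x' z))
        \<le> v z - v z * (\<Sum>a\<in>(UNIV::'a set). 4 * (D x z + D x' z))"
        using v_le[of z] by (intro diff_left_mono mult_right_mono) auto
      also have "\<dots> = v z * (\<Sum>a\<in>UNIV. c z a - 4 * (D x z + D x' z))"
        using prob_vec_sum[OF c] by (simp only: sum_subtractf right_diff_distrib)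
      also have "\<dots> \<le> v z * (\<Sum>a\<in>UNIV. h z a)"
        by (intro mult_left_mono sum_mono h_ge v_nonneg)
      finally show "v z - word_prob z * (\<Sum>a\<in>(UNIV::'a set). 4 * (D x z + D x' z)) \<le> (\<Sum>a\<in>UNIV. v (z @ [a]))"
        using z by (simp add: v_snoc sum_distrib_left)
    qed
    finally show ?case using step by (simp add: sum_words_Suc_snoc)
  qed
  have G: "(\<delta> / real CARD('a)) ^ min j (length z) * v z \<le> path_weight x x' z" for z
  proof (induction z rule: rev_induct)
    case (snoc a z)
    have pw: "0 \<le> path_weight x x' z" unfolding path_weight_def by (intro prod_nonneg) auto
    show ?case
    proof (cases "length z < j")
      case True
      \<comment> \<open>Among the first j letters no closeness of the laws is available; c is at
        most 1, and the overlap of the slots starting their cell is used instead.\<close>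
      have "\<delta> / real CARD('a) * c z a \<le> \<delta> / real CARD('a) * 1"
        using \<open>0 < \<delta>\<close> by (intro mult_left_mono prob_vec_le_1 c) auto
      also have "\<dots> \<le> min (q (past_concat x z) a) (q (past_concat x' z) a) / real CARD('a)"
        using \<delta>[OF True] by (simp add: divide_right_mono)
      also have "\<dots> \<le> overlap (past_concat x z) (past_concat x' z) a a"
        unfolding overlap_def by (intro measure_noise_Int_region_ge_min prob_vec_q)
      finally have "\<delta> / real CARD('a) * c z a \<le> overlap (past_concat x z) (past_concat x' z) a a" .
      then have "((\<delta> / real CARD('a)) ^ min j (length z) * v z) * (\<delta> / real CARD('a) * c z a) \<le> path_weight x x' (z @ [a])"
        using snoc \<open>0 < \<delta>\<close> c pw unfolding path_weight_snoc by (intro mult_mono) (auto simp: prob_vec_nonneg)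
      with True show ?thesis by (simp add: v_snoc mult_ac)
    next
      case False
      have "h z a \<le> overlap (past_concat x z) (past_concat x' z) a a" by (simp add: h_def)
      then have "((\<delta> / real CARD('a)) ^ min j (length z) * v z) * h z a \<le> path_weight x x' (z @ [a])"
        using snoc c pw h_nonneg unfolding path_weight_snoc by (intro mult_mono) auto
      with False show ?thesis by (simp add: v_snoc mult_ac)
    qed
  qed (simp add: v_def path_weight_def)
  have ge: "(\<delta> / real CARD('a)) ^ j / 2 \<le> surv n x x'" if "j \<le> n" for n
  proof -
    have "(\<delta> / real CARD('a)) ^ j / 2 \<le> (\<delta> / real CARD('a)) ^ j * (\<Sum>z | length z = n. v z)"
    proof -
      have "1 / 2 \<le> (\<Sum>z | length z = n. v z)" using E[OF that] tail[of n] by linarith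
      then show ?thesis using \<open>0 < \<delta>\<close> by (simp add: divide_simps)
    qed
    also have "\<dots> \<le> (\<Sum>z | length z = n. path_weight x x' z)"
      unfolding sum_distrib_left
    proof (rule sum_mono)
      fix z :: "'a list" assume "z \<in> {z. length z = n}"
      then show "(\<delta> / real CARD('a)) ^ j * v z \<le> path_weight x x' z"
        using G[of z] that by (simp add: min_absorb1)
    qed
    finally show ?thesis using x by (simp add: surv_eq_sum_path_weight)
  qed
  \<comment> \<open>For n below j the claim is inherited from length j, as \<open>surv\<close>
    decreases in n.\<close>
  have "(\<delta> / real CARD('a)) ^ j / 2 \<le> surv (max j n) x x'" by (rule ge) simp
  also have "\<dots> \<le> surv n x x'" by (rule decseqD[OF decseq_surv]) simp
  finally show ?thesis .
qed

section \<open>Coalescence\<close>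

text \<open>Markov's inequality for the tail sum of \<open>psi\<close>, whose mean is a multiple of
  the tail of \<open>eta\<close>. The level 1/4 is what \<open>surv_ge\<close> can afford for each
  of its two pasts.\<close>

lemma ex_tail_set:
  assumes "0 < \<epsilon>"
  obtains j A where "A \<in> sets Past" "1 - \<epsilon> \<le> measure past_law A"
    "\<And>x n. x \<in> A \<Longrightarrow> (\<Sum>k=j..<n. 4 * real CARD('a) * psi k x) \<le> 1/4"
proof -
  interpret P: prob_space past_law by (rule prob_space_past_law)
  define C where "C = 4 * real CARD('a)"
  have C: "0 < C" by (simp add: C_def)
  have eta_nonneg: "0 \<le> eta M X q n" for n
    unfolding eta_def
    by (intro sum_nonneg mult_nonneg_nonneg Bochner_Integration.integral_nonneg tv_dist_nonneg measure_nonneg)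
  have "(\<lambda>j. \<Sum>k. eta M X q (k + j)) \<longlonglongrightarrow> 0" by (rule suminf_exist_split2[OF eta_summable])
  \<comment> \<open>With this choice the tail sum u has mean at most \<open>\<epsilon> / 4\<close>;
    Markov at level 1/4 gives back the factor 4. The function u is kept in \<open>ennreal\<close>
    because it may be infinite at exceptional pasts.\<close>
  then have "eventually (\<lambda>j. (\<Sum>k. eta M X q (k + j)) < \<epsilon> / (4 * C)) sequentially"
    using assms C by (intro order_tendstoD) auto
  then obtain j where j: "(\<Sum>k. eta M X q (k + j)) < \<epsilon> / (4 * C)"
    by (auto simp: eventually_sequentially)
  define u where "u x = (\<Sum>k. ennreal (C * psi (k + j) x))" for x
  have [measurable]: "u \<in> borel_measurable Past" unfolding u_def by measurable
  have "(\<integral>\<^sup>+x. u x \<partial>past_law) = (\<Sum>k. \<integral>\<^sup>+x. ennreal (C * psi (k + j) x) \<partial>past_law)"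
    unfolding u_def by (rule nn_integral_suminf) measurable
  also have "\<dots> = (\<Sum>k. ennreal C * ennreal (eta M X q (k + j)))"
    using C by (simp add: ennreal_mult psi_nonneg nn_integral_cmult nn_integral_psi)
  also have "\<dots> = ennreal C * ennreal (\<Sum>k. eta M X q (k + j))"
    using eta_summable by (subst ennreal_suminf_cmult, subst suminf_ennreal2) (auto simp: eta_nonneg summable_iff_shift)
  also have "\<dots> = ennreal (C * (\<Sum>k. eta M X q (k + j)))"
    using C eta_nonneg eta_summable by (simp add: ennreal_mult suminf_nonneg summable_iff_shift)
  also have "\<dots> \<le> ennreal (\<epsilon> / 4)"
    using j C by (intro ennreal_leI) (simp add: field_simps)
  finally have u_int: "(\<integral>\<^sup>+x. u x \<partial>past_law) \<le> ennreal (\<epsilon> / 4)" .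
  define A where "A = {x \<in> space Past. u x \<le> ennreal (1/4)}"
  have [measurable]: "A \<in> sets Past" unfolding A_def by measurable
  have "emeasure past_law {x \<in> space past_law. 1 \<le> ennreal 4 * u x} \<le> ennreal 4 * (\<integral>\<^sup>+x. u x * indicator (space past_law) x \<partial>past_law)"
    by (rule nn_integral_Markov_inequality) auto
  also have "(\<integral>\<^sup>+x. u x * indicator (space past_law) x \<partial>past_law) = (\<integral>\<^sup>+x. u x \<partial>past_law)"
    by (intro nn_integral_cong) auto
  also have "ennreal 4 * (\<integral>\<^sup>+x. u x \<partial>past_law) \<le> ennreal 4 * ennreal (\<epsilon> / 4)"
    by (intro mult_left_mono u_int) simp
  also have "\<dots> = ennreal \<epsilon>" using assms by (subst ennreal_mult[symmetric]) auto
  finally have "emeasure past_law {x \<in> space past_law. 1 \<le> ennreal 4 * u x} \<le> ennreal \<epsilon>" .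
  moreover have "space past_law - A \<subseteq> {x \<in> space past_law. 1 \<le> ennreal 4 * u x}"
  proof
    fix x assume "x \<in> space past_law - A"
    then have "ennreal (1/4) \<le> u x" "x \<in> space past_law" by (auto simp: A_def)
    moreover have "ennreal 4 * ennreal (1/4) = 1" by (subst ennreal_mult[symmetric]) auto
    ultimately show "x \<in> {x \<in> space past_law. 1 \<le> ennreal 4 * u x}"
      using mult_left_mono[of "ennreal (1/4)" "u x" "ennreal 4"] by simp
  qed
  ultimately have "emeasure past_law (space past_law - A) \<le> ennreal \<epsilon>"
    by (elim order_trans[rotated], intro emeasure_mono) measurable
  then have "P.prob (space past_law - A) \<le> \<epsilon>"
    using assms by (simp add: P.emeasure_eq_measure)
  then have "1 - \<epsilon> \<le> P.prob A" using P.prob_compl[of A] by simp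
  moreover have "(\<Sum>k=j..<n. 4 * real CARD('a) * psi k x) \<le> 1/4" if "x \<in> A" for x n
  proof -
    have "ennreal (\<Sum>k=j..<n. C * psi k x) \<le> ennreal (1/4)"
    proof (cases "j \<le> n")
      case True
      have "(\<Sum>k=j..<n. C * psi k x) = (\<Sum>k<n-j. C * psi (k + j) x)"
        using True by (intro sum.reindex_bij_witness[where i="\<lambda>k. k + j" and j="\<lambda>k. k - j"]) auto
      then have "ennreal (\<Sum>k=j..<n. C * psi k x) = (\<Sum>k<n-j. ennreal (C * psi (k + j) x))"
        using C by (simp add: sum_ennreal psi_nonneg)
      also have "\<dots> \<le> u x" unfolding u_def by (intro sum_le_suminf) auto
      also have "\<dots> \<le> ennreal (1/4)" using that by (simp add: A_def)
      finally show ?thesis .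
    qed simp
    then show ?thesis by (simp add: C_def ennreal_le_iff)
  qed
  ultimately show thesis using that[of A j] by auto
qed

text \<open>Only finitely many words of length below j and finitely many letters matter, so for
  almost every past the least of these probabilities is positive. Continuity from below then gives
  one \<delta> for most pasts.\<close>

lemma ex_positive_set:
  assumes "0 < \<epsilon>"
  obtains \<delta> A where "0 < \<delta>" "A \<in> sets Past" "1 - \<epsilon> \<le> measure past_law A"
    "\<And>x z a. x \<in> A \<Longrightarrow> length z < j \<Longrightarrow> \<delta> \<le> q (past_concat x z) a"
proof -
  interpret P: prob_space past_law by (rule prob_space_past_law)
  have fin: "finite {z :: 'a list. length z < j}"
    using finite_lists_length_le[of "UNIV :: 'a set" j] by (rule finite_subset[rotated]) auto
  define A where "A N = {x \<in> space Past. \<forall>z\<in>{z. length z < j}. \<forall>a. 1 / real (Suc N) \<le> q (past_concat x z) a}" for N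
  have A_sets: "A N \<in> sets Past" for N
    unfolding A_def using fin by (intro sets.sets_Collect_finite_All) measurable
  have "incseq A"
  proof (rule incseq_SucI)
    fix N
    have "1 / real (Suc (Suc N)) \<le> 1 / real (Suc N)" by (simp add: field_simps)
    then show "A N \<subseteq> A (Suc N)" unfolding A_def by (blast intro: order_trans)
  qed
  then have lim: "(\<lambda>N. P.prob (A N)) \<longlonglongrightarrow> P.prob (\<Union>N. A N)"
    using A_sets by (intro P.finite_Lim_measure_incseq) auto
  have "AE x in past_law. x \<in> (\<Union>N. A N)"
    using AE_past_concat_pos AE_space
  proof eventually_elim
    case (elim x)
    \<comment> \<open>Inserting 1 keeps the set nonempty when j = 0.\<close>
    define m where "m = Min (insert 1 ((\<lambda>(z, a). q (past_concat x z) a) ` ({z. length z < j} \<times> UNIV)))"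
    have "0 < m" unfolding m_def using elim(1) fin by (subst Min_gr_iff) auto
    then obtain N where N: "1 / real (Suc N) < m" using reals_Archimedean by (auto simp: inverse_eq_divide)
    have "m \<le> q (past_concat x z) a" if "length z < j" for z a
      unfolding m_def using that fin by (intro Min_le) auto
    then have "1 / real (Suc N) \<le> q (past_concat x z) a" if "length z < j" for z a
      using that N by (blast intro: order_trans less_imp_le)
    with elim(2) have "x \<in> A N" by (simp add: A_def)
    then show ?case by blast
  qed
  then have "P.prob (\<Union>N. A N) = 1" using A_sets by (subst P.prob_eq_1) auto
  with lim have "eventually (\<lambda>N. 1 - \<epsilon> < P.prob (A N)) sequentially"
    using assms by (intro order_tendstoD) auto
  then obtain N where "1 - \<epsilon> < P.prob (A N)" by (auto simp: eventually_sequentially)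
  then show thesis using A_sets by (intro that[of "1 / real (Suc N)" "A N"]) (auto simp: A_def)
qed

text \<open>The order of choice matters: the tail fixes j, and only then can \<delta>, which depends
  on j, be chosen. Each of the two sets costs half of \<epsilon>.\<close>

lemma ex_surv_lim_set:
  assumes "0 < \<epsilon>"
  obtains \<kappa> A where "0 < \<kappa>" "A \<in> sets Past" "1 - \<epsilon> \<le> measure past_law A"
    "\<And>x x'. x \<in> A \<Longrightarrow> x' \<in> A \<Longrightarrow> \<kappa> \<le> surv_lim x x'"
proof -
  interpret P: prob_space past_law by (rule prob_space_past_law)
  have \<epsilon>2: "0 < \<epsilon> / 2" using assms by simp
  obtain j A1 where A1: "A1 \<in> sets Past" "1 - \<epsilon> / 2 \<le> P.prob A1"
    "\<And>x n. x \<in> A1 \<Longrightarrow> (\<Sum>k=j..<n. 4 * real CARD('a) * psi k x) \<le> 1/4"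
    by (rule ex_tail_set[OF \<epsilon>2]) blast
  obtain \<delta> A2 where A2: "0 < \<delta>" "A2 \<in> sets Past" "1 - \<epsilon> / 2 \<le> P.prob A2"
    "\<And>x z a. x \<in> A2 \<Longrightarrow> length z < j \<Longrightarrow> \<delta> \<le> q (past_concat x z) a"
    by (rule ex_positive_set[OF \<epsilon>2, of j]) blast
  show thesis
  proof (rule that)
    show "0 < (\<delta> / real CARD('a)) ^ j / 2" using A2(1) by simp
    show "A1 \<inter> A2 \<in> sets Past" using A1(1) A2(2) by blast
    have "P.prob (space past_law - A1 \<inter> A2) \<le> P.prob (space past_law - A1) + P.prob (space past_law - A2)"
      using A1(1) A2(2) by (subst Diff_Int) (intro measure_Un_le; simp)
    then show "1 - \<epsilon> \<le> P.prob (A1 \<inter> A2)"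
      using A1(1,2) A2(2,3) P.prob_compl[of A1] P.prob_compl[of A2] P.prob_compl[of "A1 \<inter> A2"] by simp
    fix x x' assume "x \<in> A1 \<inter> A2" "x' \<in> A1 \<inter> A2"
    moreover from this have "x \<in> space Past" "x' \<in> space Past"
      using sets.sets_into_space[OF A1(1)] by blast+
    ultimately have "(\<delta> / real CARD('a)) ^ j / 2 \<le> surv n x x'" for n
      using A1(3) A2(1,4) by (intro surv_ge) auto
    then show "(\<delta> / real CARD('a)) ^ j / 2 \<le> surv_lim x x'"
      using LIMSEQ_le_const[OF surv_tendsto] by blast
  qed
qed

section \<open>Averages over two independent stationary pasts\<close>

definition pair_mean :: "((int \<Rightarrow> 'a) \<Rightarrow> (int \<Rightarrow> 'a) \<Rightarrow> real) \<Rightarrow> real" where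
  "pair_mean F = (\<integral>y. case_prod F y \<partial>(past_law \<Otimes>\<^sub>M past_law))"

lemma prob_space_pair_past: "prob_space (past_law \<Otimes>\<^sub>M past_law)"
  using prob_space_past_law by (intro prob_space_pair)

lemma borel_measurable_pair_past: "borel_measurable (past_law \<Otimes>\<^sub>M past_law) = borel_measurable (Past \<Otimes>\<^sub>M Past)"
  by (intro measurable_cong_sets sets_pair_measure_cong) auto

lemma integrable_pair_past:
  fixes F :: "(int \<Rightarrow> 'a) \<Rightarrow> (int \<Rightarrow> 'a) \<Rightarrow> real"
  assumes "case_prod F \<in> borel_measurable (Past \<Otimes>\<^sub>M Past)" "\<And>x x'. \<bar>F x x'\<bar> \<le> C"
  shows "integrable (past_law \<Otimes>\<^sub>M past_law) (case_prod F)"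
proof -
  interpret PP: prob_space "past_law \<Otimes>\<^sub>M past_law" by (rule prob_space_pair_past)
  show ?thesis
    using assms by (intro PP.integrable_const_bound[where B=C]) (auto simp: borel_measurable_pair_past)
qed

lemma pair_mean_mono:
  assumes "case_prod F \<in> borel_measurable (Past \<Otimes>\<^sub>M Past)" "\<And>x x'. \<bar>F x x'\<bar> \<le> C"
    "case_prod G \<in> borel_measurable (Past \<Otimes>\<^sub>M Past)" "\<And>x x'. \<bar>G x x'\<bar> \<le> D"
    "\<And>x x'. F x x' \<le> G x x'"
  shows "pair_mean F \<le> pair_mean G"
  unfolding pair_mean_def using assms by (intro integral_mono integrable_pair_past) auto

lemma past_law_step_mean:
  assumes [measurable]: "h \<in> borel_measurable Past" and h: "\<And>x. 0 \<le> h x" "\<And>x. h x \<le> 1"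
  shows "(\<integral>x. (\<Sum>a\<in>UNIV. q x a * h (past_concat x [a])) \<partial>past_law) = (\<integral>x. h x \<partial>past_law)"
proof -
  have "(\<integral>\<^sup>+x. ennreal (\<Sum>a\<in>UNIV. q x a * h (past_concat x [a])) \<partial>past_law) = (\<integral>\<^sup>+x. ennreal (h x) \<partial>past_law)"
    using nn_integral_past_law_step[of "\<lambda>x. ennreal (h x)"] h prob_vec_nonneg[OF prob_vec_q]
    by (simp add: ennreal_mult flip: sum_ennreal)
  then show ?thesis
    using h prob_vec_nonneg[OF prob_vec_q] by (subst (1 2) integral_eq_nn_integral) (auto intro!: sum_nonneg)
qed

lemma step_mean_bounds:
  assumes "\<And>x. 0 \<le> h x" "\<And>x. h x \<le> 1"
  shows "0 \<le> (\<Sum>a\<in>UNIV. q x a * h (past_concat x [a]))" "(\<Sum>a\<in>UNIV. q x a * h (past_concat x [a])) \<le> 1"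
proof -
  show "0 \<le> (\<Sum>a\<in>UNIV. q x a * h (past_concat x [a]))"
    using assms prob_vec_nonneg[OF prob_vec_q] by (intro sum_nonneg) auto
  have "(\<Sum>a\<in>UNIV. q x a * h (past_concat x [a])) \<le> (\<Sum>a\<in>UNIV. q x a * 1)"
    using assms prob_vec_nonneg[OF prob_vec_q] by (intro sum_mono mult_left_mono) auto
  then show "(\<Sum>a\<in>UNIV. q x a * h (past_concat x [a])) \<le> 1" using prob_vec_sum[OF prob_vec_q] by simp
qed

lemma couple_fst: "couple (\<lambda>x _. h x) = (\<lambda>x _. \<Sum>a\<in>UNIV. q x a * h (past_concat x [a]))"
  by (intro ext) (simp add: couple_def sum_overlap flip: sum_distrib_right)

lemma couple_snd: "couple (\<lambda>_ x'. h x') = (\<lambda>_ x'. \<Sum>a\<in>UNIV. q x' a * h (past_concat x' [a]))"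
proof (intro ext)
  fix x x'
  have "couple (\<lambda>_ x'. h x') x x' = (\<Sum>b\<in>UNIV. \<Sum>a\<in>UNIV. overlap x' x b a * h (past_concat x' [b]))"
    unfolding couple_def by (subst sum.swap) (simp add: overlap_commute[of x x'])
  then show "couple (\<lambda>_ x'. h x') x x' = (\<Sum>a\<in>UNIV. q x' a * h (past_concat x' [a]))"
    by (simp add: sum_overlap flip: sum_distrib_right)
qed

text \<open>A function of one coordinate sees only its marginal chain, for which
  \<open>past_law\<close> is invariant. So its mean is constant in time although the chains become
  dependent.\<close>

lemma pair_mean_couple_pow_fst:
  assumes "h \<in> borel_measurable Past" "\<And>x. 0 \<le> h x" "\<And>x. h x \<le> 1"
  shows "pair_mean ((couple ^^ t) (\<lambda>x _. h x)) = (\<integral>x. h x \<partial>past_law)"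
  using assms
proof (induction t arbitrary: h)
  case 0
  interpret P: prob_space past_law by (rule prob_space_past_law)
  interpret PP: pair_prob_space past_law past_law ..
  have "integrable (past_law \<Otimes>\<^sub>M past_law) (\<lambda>(x, y). h x)"
    using 0 by (intro integrable_pair_past[of "\<lambda>x _. h x" 1]) (auto simp: measurable_split_conv)
  from PP.integral_fst'[OF this] P.prob_space show ?case
    by (simp add: pair_mean_def split_def)
next
  case (Suc t)
  have "pair_mean ((couple ^^ t) (\<lambda>x _. \<Sum>a\<in>UNIV. q x a * h (past_concat x [a]))) =
    (\<integral>x. (\<Sum>a\<in>UNIV. q x a * h (past_concat x [a])) \<partial>past_law)"
    using Suc.prems by (intro Suc.IH step_mean_bounds) auto
  then show ?case
    using Suc.prems by (simp add: funpow_swap1 couple_fst past_law_step_mean)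
qed

lemma pair_mean_couple_pow_snd:
  assumes "h \<in> borel_measurable Past" "\<And>x. 0 \<le> h x" "\<And>x. h x \<le> 1"
  shows "pair_mean ((couple ^^ t) (\<lambda>_ x'. h x')) = (\<integral>x. h x \<partial>past_law)"
  using assms
proof (induction t arbitrary: h)
  case 0
  interpret P: prob_space past_law by (rule prob_space_past_law)
  interpret PP: pair_prob_space past_law past_law ..
  have "integrable (past_law \<Otimes>\<^sub>M past_law) (\<lambda>(x, y). h y)"
    using 0 by (intro integrable_pair_past[of "\<lambda>_ x. h x" 1]) (auto simp: measurable_split_conv)
  from PP.integral_fst'[OF this] P.prob_space show ?case
    by (simp add: pair_mean_def split_def)
next
  case (Suc t)
  have "pair_mean ((couple ^^ t) (\<lambda>_ x. \<Sum>a\<in>UNIV. q x a * h (past_concat x [a]))) =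
    (\<integral>x. (\<Sum>a\<in>UNIV. q x a * h (past_concat x [a])) \<partial>past_law)"
    using Suc.prems by (intro Suc.IH step_mean_bounds) auto
  then show ?case
    using Suc.prems by (simp add: funpow_swap1 couple_snd past_law_step_mean)
qed

text \<open>Each \<open>couple\<close> is a finite sum, which gives pointwise convergence, and
  everything is bounded by 1. This allows n to go to infinity while t is fixed.\<close>

lemma pair_mean_couple_pow_surv_tendsto:
  "(\<lambda>n. pair_mean ((couple ^^ t) (surv n))) \<longlonglongrightarrow> pair_mean ((couple ^^ t) surv_lim)"
proof -
  have ptw: "(\<lambda>n. (couple ^^ t) (surv n) x x') \<longlonglongrightarrow> (couple ^^ t) surv_lim x x'" for x x'
  proof (induction t arbitrary: x x')
    case (Suc t)
    then show ?case by (auto simp: couple_def intro!: tendsto_intros)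
  qed (simp add: surv_tendsto)
  interpret PP: prob_space "past_law \<Otimes>\<^sub>M past_law" by (rule prob_space_pair_past)
  show ?thesis
    unfolding pair_mean_def
  proof (rule integral_dominated_convergence[where w="\<lambda>_. 1"])
    show "AE y in past_law \<Otimes>\<^sub>M past_law. norm (case_prod ((couple ^^ t) (surv n)) y) \<le> 1" for n
      by (auto simp: couple_pow_nonneg surv_nonneg couple_pow_le_1 surv_le_1)
    show "AE y in past_law \<Otimes>\<^sub>M past_law. (\<lambda>n. case_prod ((couple ^^ t) (surv n)) y) \<longlonglongrightarrow> case_prod ((couple ^^ t) surv_lim) y"
      by (auto simp: ptw)
  qed (auto simp: borel_measurable_pair_past intro!: couple_pow_measurable surv_measurable surv_lim_measurable)
qed

text \<open>The paths that agree during all n steps contribute exactly \<open>surv_lim x x'\<close>,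
  its fixed-point property. The gain comes from those that disagreed at some step but have both
  pasts in A at time n, since they still have a chance \<kappa> of agreeing from then on. Comparing
  \<open>agree\<close> and \<open>couple\<close> on the nonnegative function
  \<open>surv_lim - L\<close> makes this precise.\<close>

lemma couple_pow_surv_lim_gain:
  assumes \<kappa>: "0 < \<kappa>" "\<And>x x'. x \<in> A \<Longrightarrow> x' \<in> A \<Longrightarrow> \<kappa> \<le> surv_lim x x'"
  shows "surv_lim x x' + \<kappa> * (1 - surv n x x' - (couple ^^ n) (\<lambda>x x'. indicator (- A) x + indicator (- A) x') x x')
    \<le> (couple ^^ n) surv_lim x x'"
proof -
  define B :: "(int \<Rightarrow> 'a) \<Rightarrow> (int \<Rightarrow> 'a) \<Rightarrow> real" where "B x x' = indicator (- A) x + indicator (- A) x'" for x x'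
  define L where "L x x' = \<kappa> * (1 - B x x')" for x x'
  have B: "0 \<le> B x x'" for x x' by (simp add: B_def)
  \<comment> \<open>If one of the pasts lies outside A, then B is at least 1, so L is nonpositive
    there.\<close>
  have L: "L x x' \<le> surv_lim x x'" for x x'
    using \<kappa> surv_lim_nonneg[of x x'] by (auto simp: L_def B_def indicator_def mult_nonneg_nonpos)
  have "(agree ^^ n) (\<lambda>x x'. surv_lim x x' - L x x') x x' \<le> (couple ^^ n) (\<lambda>x x'. surv_lim x x' - L x x') x x'"
    using L by (intro agree_pow_le_couple_pow) simp
  then have "surv_lim x x' - (agree ^^ n) L x x' \<le> (couple ^^ n) surv_lim x x' - (couple ^^ n) L x x'"
    by (simp add: agree_pow_diff couple_pow_diff agree_pow_surv_lim)
  moreover have "(agree ^^ n) L x x' = \<kappa> * (surv n x x' - (agree ^^ n) B x x')"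
    unfolding L_def by (simp add: agree_pow_cmult agree_pow_diff surv_def)
  moreover have "(couple ^^ n) L x x' = \<kappa> * (1 - (couple ^^ n) B x x')"
    unfolding L_def by (simp add: couple_pow_cmult couple_pow_diff couple_pow_const)
  moreover have "0 \<le> \<kappa> * (agree ^^ n) B x x'" using \<kappa>(1) B by (simp add: agree_pow_nonneg)
  ultimately show ?thesis unfolding B_def[symmetric] by (simp add: algebra_simps)
qed

text \<open>A zero-one law: once the two trajectories sit in the good set they merge for ever with
  probability at least \<open>\<kappa>\<close>, so the probability of having merged for ever by time \<open>t\<close> keeps growing
  until it reaches one.\<close>

lemma pair_mean_couple_pow_surv_lim_tendsto:
  "(\<lambda>t. pair_mean ((couple ^^ t) surv_lim)) \<longlonglongrightarrow> 1"
proof -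
  interpret P: prob_space past_law by (rule prob_space_past_law)
  interpret PP: prob_space "past_law \<Otimes>\<^sub>M past_law" by (rule prob_space_pair_past)
  define e where "e t = pair_mean ((couple ^^ t) surv_lim)" for t
  note meas = couple_pow_measurable[OF surv_lim_measurable] couple_pow_measurable[OF surv_measurable]
  have bd: "\<bar>(couple ^^ t) surv_lim x x'\<bar> \<le> 1" "\<bar>(couple ^^ t) (surv n) x x'\<bar> \<le> 1" for t n x x'
    by (simp_all add: couple_pow_nonneg surv_nonneg couple_pow_le_1 surv_le_1 surv_lim_nonneg surv_lim_le_1)
  have "incseq e"
  proof (rule incseq_SucI)
    fix t
    \<comment> \<open>The first letters need no longer agree, so the merging may start one step
      later.\<close>
    have "surv_lim x x' \<le> couple surv_lim x x'" for x x'
      using agree_le_couple[of surv_lim x x'] by (simp add: surv_lim_nonneg agree_surv_lim)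
    then have "(couple ^^ t) surv_lim x x' \<le> (couple ^^ t) (couple surv_lim) x x'" for x x'
      by (rule couple_pow_mono)
    then have "(couple ^^ t) surv_lim x x' \<le> (couple ^^ Suc t) surv_lim x x'" for x x'
      by (simp add: funpow_swap1)
    then show "e t \<le> e (Suc t)"
      unfolding e_def by (intro pair_mean_mono[where C=1 and D=1] meas bd)
  qed
  moreover have e_le: "e t \<le> 1" for t
    using pair_mean_mono[OF meas(1) bd(1), of "\<lambda>_ _. 1" 1 t] couple_pow_le_1[OF surv_lim_le_1]
    by (simp add: e_def pair_mean_def PP.prob_space)
  ultimately obtain L where L: "e \<longlonglongrightarrow> L" "\<And>t. e t \<le> L"
    using incseq_convergent[of e 1] by blast
  have "L \<le> 1" using LIMSEQ_le_const2[OF L(1)] e_le by blast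
  have gain: "1 - 2 * \<epsilon> \<le> L" if "0 < \<epsilon>" for \<epsilon>
  proof -
    obtain \<kappa> A where \<kappa>: "0 < \<kappa>" and A: "A \<in> sets Past" "1 - \<epsilon> \<le> P.prob A"
      "\<And>x x'. x \<in> A \<Longrightarrow> x' \<in> A \<Longrightarrow> \<kappa> \<le> surv_lim x x'"
      by (rule ex_surv_lim_set[OF \<open>0 < \<epsilon>\<close>]) blast
    define B1 B2 :: "(int \<Rightarrow> 'a) \<Rightarrow> (int \<Rightarrow> 'a) \<Rightarrow> real"
      where "B1 = (\<lambda>x _. indicator (- A) x)" and "B2 = (\<lambda>_ x'. indicator (- A) x')"
    have [measurable]: "(indicator (- A) :: _ \<Rightarrow> real) \<in> borel_measurable Past"
      using A(1) by (subst borel_measurable_indicator_iff) (auto simp: Int_commute Diff_eq[symmetric])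
    have Bm: "case_prod ((couple ^^ n) B1) \<in> borel_measurable (Past \<Otimes>\<^sub>M Past)"
      "case_prod ((couple ^^ n) B2) \<in> borel_measurable (Past \<Otimes>\<^sub>M Past)" for n
      unfolding B1_def B2_def by (intro couple_pow_measurable; measurable)+
    have Bb: "\<bar>(couple ^^ n) B1 x x'\<bar> \<le> 1" "\<bar>(couple ^^ n) B2 x x'\<bar> \<le> 1" for n x x'
      by (simp_all add: B1_def B2_def couple_pow_nonneg couple_pow_le_1 indicator_def)
    have "(\<integral>x. indicator (- A) x \<partial>past_law) = P.prob (space past_law - A)"
      by (simp add: Diff_eq Int_commute)
    also have "\<dots> \<le> \<epsilon>" using A P.prob_compl[of A] by simp
    finally have B: "pair_mean ((couple ^^ n) B1) \<le> \<epsilon>" "pair_mean ((couple ^^ n) B2) \<le> \<epsilon>" for n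
      unfolding B1_def B2_def
      using pair_mean_couple_pow_fst[of "indicator (- A)" n] pair_mean_couple_pow_snd[of "indicator (- A)" n]
      by (simp_all add: indicator_le_1)
    \<comment> \<open>The term \<open>2 * \<epsilon>\<close> bounds the probability that one of the
      chains is outside A at time t + n, one \<epsilon> per chain; it is uniform in time because
      each marginal is stationary.\<close>
    have step: "e t + \<kappa> * (1 - pair_mean ((couple ^^ t) (surv n)) - 2 * \<epsilon>) \<le> e (t + n)" for t n
    proof -
      have "(couple ^^ t) (\<lambda>x x'. surv_lim x x' + \<kappa> * (1 - surv n x x' - (couple ^^ n) (\<lambda>x x'. B1 x x' + B2 x x') x x')) x x'
         \<le> (couple ^^ t) ((couple ^^ n) surv_lim) x x'" for x x'
        unfolding B1_def B2_def by (intro couple_pow_mono couple_pow_surv_lim_gain \<kappa> A(3))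
      moreover have "(couple ^^ t) (\<lambda>x x'. surv_lim x x' + \<kappa> * (1 - surv n x x' - (couple ^^ n) (\<lambda>x x'. B1 x x' + B2 x x') x x')) x x' =
        (couple ^^ t) surv_lim x x' + \<kappa> * (1 - (couple ^^ t) (surv n) x x' - ((couple ^^ (t + n)) B1 x x' + (couple ^^ (t + n)) B2 x x'))" for x x'
        by (simp add: couple_pow_add couple_pow_cmult couple_pow_diff couple_pow_const funpow_add)
      ultimately have pt: "(couple ^^ t) surv_lim x x' + \<kappa> * (1 - (couple ^^ t) (surv n) x x' - ((couple ^^ (t + n)) B1 x x' + (couple ^^ (t + n)) B2 x x'))
         \<le> (couple ^^ (t + n)) surv_lim x x'" for x x' by (simp add: funpow_add)
      have int: "integrable (past_law \<Otimes>\<^sub>M past_law) (case_prod ((couple ^^ t) surv_lim))"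
        "integrable (past_law \<Otimes>\<^sub>M past_law) (case_prod ((couple ^^ (t + n)) surv_lim))"
        "integrable (past_law \<Otimes>\<^sub>M past_law) (case_prod ((couple ^^ t) (surv n)))"
        "integrable (past_law \<Otimes>\<^sub>M past_law) (case_prod ((couple ^^ (t + n)) B1))"
        "integrable (past_law \<Otimes>\<^sub>M past_law) (case_prod ((couple ^^ (t + n)) B2))"
        by (rule integrable_pair_past[OF meas(1) bd(1)] integrable_pair_past[OF meas(2) bd(2)]
              integrable_pair_past[OF Bm(1) Bb(1)] integrable_pair_past[OF Bm(2) Bb(2)])+
      have "e t + \<kappa> * (1 - pair_mean ((couple ^^ t) (surv n)) - (pair_mean ((couple ^^ (t + n)) B1) + pair_mean ((couple ^^ (t + n)) B2))) =
        (\<integral>y. case_prod ((couple ^^ t) surv_lim) y + \<kappa> * (1 - case_prod ((couple ^^ t) (surv n)) y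
           - (case_prod ((couple ^^ (t + n)) B1) y + case_prod ((couple ^^ (t + n)) B2) y)) \<partial>(past_law \<Otimes>\<^sub>M past_law))"
        using int by (simp add: e_def pair_mean_def PP.prob_space)
      also have "\<dots> \<le> e (t + n)"
        unfolding e_def pair_mean_def
        by (intro integral_mono int Bochner_Integration.integrable_add Bochner_Integration.integrable_diff
              integrable_mult_right PP.integrable_const) (auto simp: pt split: prod.split)
      finally have "e t + \<kappa> * (1 - pair_mean ((couple ^^ t) (surv n)) - (pair_mean ((couple ^^ (t + n)) B1) + pair_mean ((couple ^^ (t + n)) B2))) \<le> e (t + n)" .
      moreover have "\<kappa> * (1 - pair_mean ((couple ^^ t) (surv n)) - 2 * \<epsilon>) \<le>
        \<kappa> * (1 - pair_mean ((couple ^^ t) (surv n)) - (pair_mean ((couple ^^ (t + n)) B1) + pair_mean ((couple ^^ (t + n)) B2)))"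
        using \<kappa> B[of "t + n"] by (intro mult_left_mono) auto
      ultimately show ?thesis by linarith
    qed
    \<comment> \<open>Letting n tend to infinity with t fixed turns the mean of
      \<open>surv n\<close> into \<open>e t\<close>: a pair that does not agree for ever from time t
      on has disagreed by a late time.\<close>
    have "e t + \<kappa> * (1 - e t - 2 * \<epsilon>) \<le> L" for t
    proof (rule LIMSEQ_le_const2)
      show "(\<lambda>n. e t + \<kappa> * (1 - pair_mean ((couple ^^ t) (surv n)) - 2 * \<epsilon>)) \<longlonglongrightarrow> e t + \<kappa> * (1 - e t - 2 * \<epsilon>)"
        unfolding e_def by (intro tendsto_intros pair_mean_couple_pow_surv_tendsto)
      show "\<exists>N. \<forall>n\<ge>N. e t + \<kappa> * (1 - pair_mean ((couple ^^ t) (surv n)) - 2 * \<epsilon>) \<le> L"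
        using step L(2) by (blast intro: order_trans)
    qed
    \<comment> \<open>Now t tends to infinity. The gain must vanish in the limit L, whatever the
      size of \<kappa>, which leaves \<open>1 - L\<close> at most
      \<open>2 * \<epsilon>\<close>.\<close>
    then have "L + \<kappa> * (1 - L - 2 * \<epsilon>) \<le> L"
      by (intro LIMSEQ_le_const2[where X="\<lambda>t. e t + \<kappa> * (1 - e t - 2 * \<epsilon>)"] tendsto_intros L(1)) auto
    then have "\<kappa> * (1 - L - 2 * \<epsilon>) \<le> 0" by simp
    with \<kappa> show ?thesis by (simp add: mult_le_0_iff)
  qed
  have "1 \<le> L"
  proof (rule field_le_epsilon)
    fix \<epsilon> :: real assume "0 < \<epsilon>"
    with gain[of "\<epsilon> / 2"] show "1 \<le> L + \<epsilon>" by simp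
  qed
  with \<open>L \<le> 1\<close> L(1) show ?thesis unfolding e_def by simp
qed

definition same_last :: "(int \<Rightarrow> 'a) \<Rightarrow> (int \<Rightarrow> 'a) \<Rightarrow> real" where
  "same_last x x' = of_bool (x (-1) = x' (-1))"

lemma couple_same_last: "couple same_last = surv 1"
  by (intro ext) (simp add: couple_def surv_def agree_def same_last_def past_concat_def)

text \<open>Agreement for ever implies agreement at the next letter: the sequence lies between the
  mean of \<open>surv_lim\<close> at time t and 1. The last of the \<open>Suc t\<close> steps
  converts \<open>same_last\<close> into \<open>surv 1\<close>.\<close>

lemma pair_mean_couple_pow_same_last_tendsto:
  "(\<lambda>t. pair_mean ((couple ^^ Suc t) same_last)) \<longlonglongrightarrow> 1"
proof (rule tendsto_sandwich[OF _ _ pair_mean_couple_pow_surv_lim_tendsto tendsto_const])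
  interpret PP: prob_space "past_law \<Otimes>\<^sub>M past_law" by (rule prob_space_pair_past)
  have eq: "(couple ^^ Suc t) same_last = (couple ^^ t) (surv 1)" for t
    by (simp only: funpow_Suc_right comp_def couple_same_last)
  note meas = couple_pow_measurable[OF surv_lim_measurable] couple_pow_measurable[OF surv_measurable]
  have bd: "\<bar>(couple ^^ t) surv_lim x x'\<bar> \<le> 1" "\<bar>(couple ^^ t) (surv n) x x'\<bar> \<le> 1" for t n x x'
    by (simp_all add: couple_pow_nonneg surv_nonneg couple_pow_le_1 surv_le_1 surv_lim_nonneg surv_lim_le_1)
  show "\<forall>\<^sub>F t in sequentially. pair_mean ((couple ^^ t) surv_lim) \<le> pair_mean ((couple ^^ Suc t) same_last)"
    unfolding eq by (intro always_eventually allI pair_mean_mono[where C=1 and D=1] meas bd couple_pow_mono surv_lim_le)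
  have "pair_mean ((couple ^^ t) (surv 1)) \<le> pair_mean (\<lambda>_ _. 1)" for t
    by (intro pair_mean_mono[where C=1 and D=1] meas bd couple_pow_le_1 surv_le_1) auto
  then show "\<forall>\<^sub>F t in sequentially. pair_mean ((couple ^^ Suc t) same_last) \<le> 1"
    unfolding eq by (simp add: pair_mean_def PP.prob_space)
qed

end

section \<open>Driving noise\<close>

lemma nat_filt_gen_subset:
  "(\<Union>k\<in>{..n}. {Y k -` B \<inter> space M | B. B \<in> sets N}) \<union> null_sets M \<subseteq> Pow (space M)"
  using sets.sets_into_space by (auto simp: null_sets_def)

lemma space_nat_filt [simp]: "space (nat_filt M N Y n) = space M"
  unfolding nat_filt_def using nat_filt_gen_subset by (rule space_measure_of)

lemma sets_nat_filt:
  "sets (nat_filt M N Y n) =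
    sigma_sets (space M) ((\<Union>k\<in>{..n}. {Y k -` B \<inter> space M | B. B \<in> sets N}) \<union> null_sets M)"
  unfolding nat_filt_def using nat_filt_gen_subset by (rule sets_measure_of)

lemma nat_filt_measurable:
  assumes "Y k \<in> measurable M N" "k \<le> n"
  shows "Y k \<in> measurable (nat_filt M N Y n) N"
  using assms by (auto intro!: measurableI sigma_sets.Basic simp: sets_nat_filt dest: measurable_space) blast

lemma sets_nat_filt_subset:
  assumes "\<And>k. Y k \<in> measurable M N"
  shows "sets (nat_filt M N Y n) \<subseteq> sets M"
  unfolding sets_nat_filt using assms by (intro sets.sigma_sets_subset) (auto simp: measurable_sets)

lemma null_sets_nat_filt: "B \<in> null_sets M \<Longrightarrow> B \<in> sets (nat_filt M N Y n)"
  unfolding sets_nat_filt by (intro sigma_sets.Basic) simp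

lemma sets_nat_filt_mono: "m \<le> n \<Longrightarrow> sets (nat_filt M N Y m) \<subseteq> sets (nat_filt M N Y n)"
  unfolding sets_nat_filt by (intro sigma_sets_mono' Un_mono UN_mono) auto

text \<open>The filtration contains all null sets, so a measurable event that almost surely equals
  one of its events belongs to it.\<close>

lemma sets_nat_filt_AE:
  assumes Y: "\<And>k. Y k \<in> measurable M N"
    and A: "A \<in> sets M" and B: "B \<in> sets (nat_filt M N Y n)"
    and AE: "AE x in M. x \<in> A \<longleftrightarrow> x \<in> B"
  shows "A \<in> sets (nat_filt M N Y n)"
proof -
  have BM: "B \<in> sets M" by (rule subsetD[OF sets_nat_filt_subset[OF Y] B])
  have "AE x in M. x \<notin> A - B" "AE x in M. x \<notin> B - A"
    using AE by (auto elim!: eventually_mono)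
  then have "A - B \<in> null_sets M" "B - A \<in> null_sets M"
    using A BM by (simp_all add: AE_iff_null_sets)
  then have "(B - (B - A)) \<union> (A - B) \<in> sets (nat_filt M N Y n)"
    using B null_sets_nat_filt[of "A - B" M N Y n] null_sets_nat_filt[of "B - A" M N Y n] by blast
  moreover have "(B - (B - A)) \<union> (A - B) = A" by blast
  ultimately show ?thesis by simp
qed

context primed_process
begin

definition driven :: "('w \<times> (int \<Rightarrow> real)) measure" where
  "driven = M \<Otimes>\<^sub>M PiM UNIV (\<lambda>_::int. noise TYPE('a))"

text \<open>Given the past and the letter, the independent randomiser \<open>snd \<omega> n\<close>
  is spread uniformly over the region of that letter. Averaging over the letter yields
  \<open>noise\<close> for every past, hence independence of \<open>Y n\<close> from the
  past.\<close>

definition Y :: "int \<Rightarrow> 'w \<times> (int \<Rightarrow> real) \<Rightarrow> real" where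
  "Y n \<omega> = sample (q (past_of X (n - 1) (fst \<omega>))) (X n (fst \<omega>)) (snd \<omega> n)"

definition rect :: "int \<Rightarrow> (int \<Rightarrow> 'a) set \<Rightarrow> int set \<Rightarrow> (int \<Rightarrow> real set) \<Rightarrow> ('w \<times> (int \<Rightarrow> real)) set" where
  "rect n B J C = {\<omega> \<in> space driven. past_of X n (fst \<omega>) \<in> B \<and> (\<forall>j\<in>J. snd \<omega> j \<in> C j)}"

definition rects :: "int \<Rightarrow> ('w \<times> (int \<Rightarrow> real)) set set" where
  "rects n = {rect n B J C | B J C. B \<in> sets Past \<and> finite J \<and> J \<subseteq> {..n} \<and> (\<forall>j. C j \<in> sets borel)}"

text \<open>Everything known at time n, both the letters and the randomisers. Independence from this
  large history is easier to check than independence from the earlier \<open>Y\<close>, and implies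
  it.\<close>

definition hist :: "int \<Rightarrow> ('w \<times> (int \<Rightarrow> real)) measure" where
  "hist n = sigma (space driven) (rects n)"

lemma noise_product: "product_prob_space (\<lambda>_::int. noise TYPE('a))"
  by (intro product_prob_spaceI prob_space_noise)

lemma prob_space_noises: "prob_space (PiM UNIV (\<lambda>_::int. noise TYPE('a)))"
  by (intro prob_space_PiM prob_space_noise)

lemma prob_space_driven: "prob_space driven"
  unfolding driven_def by (intro prob_space_pair prob_space_axioms prob_space_noises)

lemma fst_driven [measurable]: "fst \<in> measurable driven M"
  by (simp add: driven_def)

lemma snd_driven [measurable]: "(\<lambda>\<omega>. snd \<omega> k) \<in> borel_measurable driven"
proof -
  have "(\<lambda>v. v k) \<in> measurable (PiM UNIV (\<lambda>_::int. noise TYPE('a))) (noise TYPE('a))"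
    by (rule measurable_component_singleton) simp
  then have "(\<lambda>v. v k) \<in> borel_measurable (PiM UNIV (\<lambda>_::int. noise TYPE('a)))"
    by (simp cong: measurable_cong_sets)
  then show ?thesis unfolding driven_def by (rule measurable_compose[OF measurable_snd])
qed

lemma distr_driven_fst: "distr driven M fst = M"
  unfolding driven_def by (rule prob_space.distr_pair_fst[OF prob_space_noises])

lemma distr_driven_snd: "distr driven borel (\<lambda>\<omega>. snd \<omega> k) = noise TYPE('a)"
proof -
  interpret N: product_prob_space "\<lambda>_::int. noise TYPE('a)" UNIV by (rule noise_product)
  interpret P: pair_sigma_finite M "PiM UNIV (\<lambda>_::int. noise TYPE('a))" ..
  have m: "(\<lambda>v. v k) \<in> borel_measurable (PiM UNIV (\<lambda>_::int. noise TYPE('a)))"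
    using measurable_component_singleton[of k UNIV "\<lambda>_::int. noise TYPE('a)"] by (simp cong: measurable_cong_sets)
  show ?thesis
  proof (rule measure_eqI)
    fix C assume "C \<in> sets (distr driven borel (\<lambda>\<omega>. snd \<omega> k))"
    then have C: "C \<in> sets borel" by simp
    have eq: "(\<lambda>\<omega>. snd \<omega> k) -` C \<inter> space driven = space M \<times> {v \<in> space (PiM UNIV (\<lambda>_::int. noise TYPE('a))). v k \<in> C}"
      by (auto simp: driven_def space_pair_measure)
    have "{v \<in> space (PiM UNIV (\<lambda>_::int. noise TYPE('a))). v k \<in> C} \<in> sets (PiM UNIV (\<lambda>_::int. noise TYPE('a)))"
      using measurable_sets[OF m C] by (simp add: vimage_def Int_def conj_commute)
    then show "emeasure (distr driven borel (\<lambda>\<omega>. snd \<omega> k)) C = emeasure (noise TYPE('a)) C"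
      using C N.emeasure_PiM_Collect_single[of k C]
      by (subst emeasure_distr) (auto simp: eq, simp add: driven_def N.emeasure_pair_measure_Times emeasure_space_1)
  qed simp
qed

lemma AE_driven_fst:
  assumes "AE \<omega> in M. P \<omega>" shows "AE \<omega> in driven. P (fst \<omega>)"
proof (rule AE_distrD[OF fst_driven])
  show "AE \<omega> in distr driven M fst. P \<omega>" using assms by (simp only: distr_driven_fst)
qed

lemma past_driven [measurable]: "(\<lambda>\<omega>. past_of X n (fst \<omega>)) \<in> measurable driven Past"
  by measurable

lemma Y_measurable [measurable]: "Y n \<in> borel_measurable driven"
proof -
  have "(\<lambda>\<omega>. sample (q (past_of X (n - 1) (fst \<omega>))) a (snd \<omega> n)) \<in> borel_measurable driven" for a
    by measurable
  moreover have "(\<lambda>\<omega>. X n (fst \<omega>)) \<in> measurable driven (count_space UNIV)" by measurable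
  ultimately show ?thesis
    unfolding Y_def by (rule measurable_compose_countable)
qed

lemma rect_sets [measurable]:
  assumes [measurable]: "B \<in> sets Past" "\<And>j. C j \<in> sets borel" and "finite J"
  shows "rect n B J C \<in> sets driven"
proof -
  have "{\<omega> \<in> space driven. \<forall>j\<in>J. snd \<omega> j \<in> C j} \<in> sets driven"
    using \<open>finite J\<close> by (intro sets.sets_Collect_finite_All) measurable
  moreover have "{\<omega> \<in> space driven. past_of X n (fst \<omega>) \<in> B} \<in> sets driven" by measurable
  ultimately have "{\<omega> \<in> space driven. past_of X n (fst \<omega>) \<in> B} \<inter> {\<omega> \<in> space driven. \<forall>j\<in>J. snd \<omega> j \<in> C j} \<in> sets driven"
    by blast
  then show ?thesis unfolding rect_def by (simp add: Int_def conj_ac cong: conj_cong)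
qed

text \<open>Fubini integrates the randomisers out at fixed \<omega>, and the letter at time n is
  then averaged under \<open>q x\<close>. The result no longer depends on x, so the history and
  \<open>Y n\<close> separate.\<close>

lemma emeasure_rect_Y:
  assumes [measurable]: "B \<in> sets Past" "\<And>j. C j \<in> sets borel" "D \<in> sets borel"
    and J: "finite J" "J \<subseteq> {..n - 1}"
  shows "emeasure driven (rect (n - 1) B J C \<inter> (Y n -` D \<inter> space driven)) =
    (\<Prod>j\<in>J. emeasure (noise TYPE('a)) (C j)) * emeasure past_law B * emeasure (noise TYPE('a)) D"
proof -
  let ?N = "noise TYPE('a)"
  interpret N: product_prob_space "\<lambda>_::int. ?N" UNIV by (rule noise_product)
  define c where "c = (\<Prod>j\<in>J. emeasure ?N (C j))"
  define \<kappa> where "\<kappa> x a = emeasure ?N {v. sample (q x) a v \<in> D}" for x a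
  have [measurable]: "(\<lambda>x. \<kappa> x a) \<in> borel_measurable Past" for a
  proof -
    have "{y \<in> space (Past \<Otimes>\<^sub>M ?N). sample (q (fst y)) a (snd y) \<in> D} \<in> sets (Past \<Otimes>\<^sub>M ?N)"
      by measurable
    from sigma_finite_measure.measurable_emeasure_Pair[OF prob_space_imp_sigma_finite[OF prob_space_noise] this]
    show ?thesis
      by (rule measurable_cong[THEN iffD1, rotated]) (auto simp: \<kappa>_def space_pair_measure vimage_def)
  qed
  have nJ: "n \<notin> J" using J(2) by auto
  have [measurable]: "rect (n - 1) B J C \<inter> (Y n -` D \<inter> space driven) \<in> sets driven"
    using J(1) by measurable
  have "emeasure driven (rect (n - 1) B J C \<inter> (Y n -` D \<inter> space driven)) =
    (\<integral>\<^sup>+\<omega>. emeasure (PiM UNIV (\<lambda>_::int. ?N)) (Pair \<omega> -` (rect (n - 1) B J C \<inter> (Y n -` D \<inter> space driven))) \<partial>M)"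
    using \<open>_ \<in> sets driven\<close> unfolding driven_def by (rule N.emeasure_pair_measure_alt)
  also have "\<dots> = (\<integral>\<^sup>+\<omega>. indicator B (past_of X (n - 1) \<omega>) * c * \<kappa> (past_of X (n - 1) \<omega>) (X n \<omega>) \<partial>M)"
  proof (rule nn_integral_cong)
    fix \<omega> assume \<omega>: "\<omega> \<in> space M"
    \<comment> \<open>The condition on \<open>Y n\<close> is, for fixed \<omega>, a condition on
      coordinate n of the randomisers; since n lies outside J it contributes a separate
      factor.\<close>
    define S where "S = {v. sample (q (past_of X (n - 1) \<omega>)) (X n \<omega>) v \<in> D}"
    have [measurable]: "S \<in> sets borel"
      using measurable_sets_borel[OF sample_measurable[of "\<lambda>_. q (past_of X (n - 1) \<omega>)" borel "\<lambda>v. v" "X n \<omega>"] \<open>D \<in> sets borel\<close>]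
      unfolding S_def vimage_def by measurable
    show "emeasure (PiM UNIV (\<lambda>_::int. ?N)) (Pair \<omega> -` (rect (n - 1) B J C \<inter> (Y n -` D \<inter> space driven))) =
      indicator B (past_of X (n - 1) \<omega>) * c * \<kappa> (past_of X (n - 1) \<omega>) (X n \<omega>)"
    proof (cases "past_of X (n - 1) \<omega> \<in> B")
      case True
      have "Pair \<omega> -` (rect (n - 1) B J C \<inter> (Y n -` D \<inter> space driven)) =
        {v \<in> space (PiM UNIV (\<lambda>_::int. ?N)). \<forall>j\<in>insert n J. v j \<in> (C(n := S)) j}"
        using True \<omega> nJ by (auto simp: rect_def Y_def S_def driven_def space_pair_measure)
      also have "emeasure (PiM UNIV (\<lambda>_::int. ?N)) \<dots> = (\<Prod>j\<in>insert n J. emeasure ?N ((C(n := S)) j))"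
        using J(1) by (intro N.emeasure_PiM_Collect) auto
      also have "\<dots> = emeasure ?N S * (\<Prod>j\<in>J. emeasure ?N ((C(n := S)) j))"
        using J(1) nJ by simp
      also have "(\<Prod>j\<in>J. emeasure ?N ((C(n := S)) j)) = c"
        unfolding c_def using nJ by (intro prod.cong) auto
      finally show ?thesis using True by (simp add: \<kappa>_def S_def mult.commute)
    next
      case False
      then have "Pair \<omega> -` (rect (n - 1) B J C \<inter> (Y n -` D \<inter> space driven)) = {}"
        by (auto simp: rect_def)
      with False show ?thesis by simp
    qed
  qed
  also have "\<dots> = (\<integral>\<^sup>+x. (\<Sum>a\<in>UNIV. ennreal (q x a) * (indicator B x * c * \<kappa> x a)) \<partial>past_law)"
    by (rule nn_integral_past_letter) measurable
  also have "\<dots> = (\<integral>\<^sup>+x. c * emeasure ?N D * indicator B x \<partial>past_law)"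
  proof (rule nn_integral_cong)
    fix x
    \<comment> \<open>The Jacobian identity turns each term into the part of D inside one region,
      and the regions fill the noise up to a null set.\<close>
    have "(\<Sum>a\<in>UNIV. ennreal (q x a) * \<kappa> x a) = (\<Sum>a\<in>UNIV. emeasure ?N (D \<inter> region (q x) a))"
      by (simp add: \<kappa>_def emeasure_noise_sample prob_vec_q)
    also have "\<dots> = emeasure ?N (\<Union>a. D \<inter> region (q x) a)"
      using region_unique[OF prob_vec_q[of x]] by (intro sum_emeasure) (auto simp: disjoint_family_on_def)
    also have "\<dots> = emeasure ?N D"
      using AE_noise_region[OF prob_vec_q[of x]] by (intro emeasure_eq_AE) (auto elim: eventually_mono)
    finally have "(\<Sum>a\<in>UNIV. ennreal (q x a) * \<kappa> x a) = emeasure ?N D" .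
    moreover have "(\<Sum>a\<in>UNIV. ennreal (q x a) * (indicator B x * c * \<kappa> x a)) =
      indicator B x * c * (\<Sum>a\<in>UNIV. ennreal (q x a) * \<kappa> x a)"
      by (simp add: sum_distrib_left mult_ac)
    ultimately show "(\<Sum>a\<in>UNIV. ennreal (q x a) * (indicator B x * c * \<kappa> x a)) = c * emeasure ?N D * indicator B x"
      by (simp add: mult_ac)
  qed
  also have "\<dots> = c * emeasure ?N D * emeasure past_law B"
    by (simp add: nn_integral_cmult)
  finally show ?thesis by (simp add: c_def mult_ac)
qed

text \<open>Both marginals are instances of the same product formula: D = UNIV for the history, the
  full space of pasts and an empty J for \<open>Y n\<close>.\<close>

lemma rect_Y_indep:
  assumes "B \<in> sets Past" "\<And>j. C j \<in> sets borel" "D \<in> sets borel" "finite J" "J \<subseteq> {..n - 1}"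
  shows "measure driven (rect (n - 1) B J C \<inter> (Y n -` D \<inter> space driven)) =
    measure driven (rect (n - 1) B J C) * measure driven (Y n -` D \<inter> space driven)"
proof -
  interpret E: prob_space driven by (rule prob_space_driven)
  interpret P: prob_space past_law by (rule prob_space_past_law)
  interpret N: prob_space "noise TYPE('a)" by (rule prob_space_noise)
  have "rect (n - 1) B J C \<inter> (Y n -` UNIV \<inter> space driven) = rect (n - 1) B J C"
    by (auto simp: rect_def)
  moreover have "rect (n - 1) (space Past) {} C \<inter> (Y n -` D \<inter> space driven) = Y n -` D \<inter> space driven"
    by (auto simp: rect_def)
  ultimately have "emeasure driven (rect (n - 1) B J C \<inter> (Y n -` D \<inter> space driven)) =
    emeasure driven (rect (n - 1) B J C) * emeasure driven (Y n -` D \<inter> space driven)"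
    using emeasure_rect_Y[of B C D J n] emeasure_rect_Y[of B C UNIV J n] emeasure_rect_Y[of "space Past" C D "{}" n] assms
      N.emeasure_space_1 P.emeasure_space_1 by simp
  then show ?thesis by (simp add: measure_def enn2real_mult)
qed

lemma distr_Y: "distr driven borel (Y n) = noise TYPE('a)"
proof (rule measure_eqI)
  interpret P: prob_space past_law by (rule prob_space_past_law)
  fix D assume "D \<in> sets (distr driven borel (Y n))"
  then have D: "D \<in> sets borel" by simp
  have "rect (n - 1) (space Past) {} (\<lambda>_. UNIV) \<inter> (Y n -` D \<inter> space driven) = Y n -` D \<inter> space driven"
    by (auto simp: rect_def)
  then show "emeasure (distr driven borel (Y n)) D = emeasure (noise TYPE('a)) D"
    using emeasure_rect_Y[of "space Past" "\<lambda>_. UNIV" D "{}" n] D P.emeasure_space_1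
    by (simp add: emeasure_distr)
qed simp

lemma rects_subset: "rects n \<subseteq> Pow (space driven)"
  by (auto simp: rects_def rect_def)

lemma space_hist [simp]: "space (hist n) = space driven"
  unfolding hist_def using rects_subset by (rule space_measure_of)

lemma sets_hist: "sets (hist n) = sigma_sets (space driven) (rects n)"
  unfolding hist_def using rects_subset by (rule sets_measure_of)

lemma rects_sets: "rects n \<subseteq> sets driven"
  by (auto simp: rects_def)

lemma sets_hist_subset: "sets (hist n) \<subseteq> sets driven"
  unfolding sets_hist by (intro sets.sigma_sets_subset rects_sets)

lemma Int_stable_rects: "Int_stable (rects n)"
proof (rule Int_stableI)
  fix R R' assume "R \<in> rects n" "R' \<in> rects n"
  then obtain B J C B' J' C' where R: "R = rect n B J C" "R' = rect n B' J' C'"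
    "B \<in> sets Past" "finite J" "J \<subseteq> {..n}" "\<And>j. C j \<in> sets borel"
    "B' \<in> sets Past" "finite J'" "J' \<subseteq> {..n}" "\<And>j. C' j \<in> sets borel"
    unfolding rects_def by blast
  have "R \<inter> R' = rect n (B \<inter> B') (J \<union> J') (\<lambda>j. (if j \<in> J then C j else UNIV) \<inter> (if j \<in> J' then C' j else UNIV))"
    unfolding R(1,2) rect_def by auto
  then show "R \<inter> R' \<in> rects n"
    unfolding rects_def mem_Collect_eq
    by (intro exI[of _ "B \<inter> B'"] exI[of _ "J \<union> J'"]
          exI[of _ "\<lambda>j. (if j \<in> J then C j else UNIV) \<inter> (if j \<in> J' then C' j else UNIV)"])
       (use R in auto)
qed

lemma hist_indep_set:
  "prob_space.indep_set driven (sets (hist (n - 1))) {Y n -` D \<inter> space driven | D. D \<in> sets borel}"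
proof -
  interpret E: prob_space driven by (rule prob_space_driven)
  let ?F = "{Y n -` D \<inter> space driven | D. D \<in> sets borel}"
  have "E.indep_set (rects (n - 1)) ?F"
    unfolding E.indep_sets2_eq using rects_sets rect_Y_indep by (auto simp: rects_def)
  moreover have "Int_stable ?F"
  proof (rule Int_stableI)
    fix a b assume "a \<in> ?F" "b \<in> ?F"
    then obtain D D' where "a = Y n -` D \<inter> space driven" "b = Y n -` D' \<inter> space driven" "D \<in> sets borel" "D' \<in> sets borel"
      by blast
    then show "a \<inter> b \<in> ?F" by (intro CollectI exI[of _ "D \<inter> D'"]) auto
  qed
  ultimately have "E.indep_set (sigma_sets (space driven) (rects (n - 1))) (sigma_sets (space driven) ?F)"
    using Int_stable_rects by (intro E.indep_set_sigma_sets)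
  then show ?thesis
    unfolding E.indep_sets2_eq sets_hist by (blast intro: sigma_sets.Basic)
qed

lemma hist_prob_mult:
  assumes "A \<in> sets (hist (n - 1))" "D \<in> sets borel"
  shows "measure driven (A \<inter> (Y n -` D \<inter> space driven)) = measure driven A * measure driven (Y n -` D \<inter> space driven)"
proof -
  interpret E: prob_space driven by (rule prob_space_driven)
  show ?thesis using hist_indep_set[of n] assms unfolding E.indep_sets2_eq by blast
qed

lemma hist_measurable_driven: "S \<in> measurable (hist n) N \<Longrightarrow> S \<in> measurable driven N"
  using measurable_mono[of N N "hist n" driven] sets_hist_subset by auto

text \<open>Freezing: a quantity determined by the history may be held fixed while the fresh noise
  is integrated, because their joint law is a product.\<close>

lemma nn_integral_hist_Y:
  assumes S: "S \<in> measurable (hist (n - 1)) N" and f: "f \<in> borel_measurable (N \<Otimes>\<^sub>M borel)"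
  shows "(\<integral>\<^sup>+\<omega>. f (S \<omega>, Y n \<omega>) \<partial>driven) = (\<integral>\<^sup>+\<omega>. \<integral>\<^sup>+u. f (S \<omega>, u) \<partial>noise TYPE('a) \<partial>driven)"
proof -
  interpret E: prob_space driven by (rule prob_space_driven)
  interpret N: prob_space "noise TYPE('a)" by (rule prob_space_noise)
  note [measurable] = hist_measurable_driven[OF S] f
  have eq: "distr driven N S \<Otimes>\<^sub>M noise TYPE('a) = distr driven (N \<Otimes>\<^sub>M borel) (\<lambda>\<omega>. (S \<omega>, Y n \<omega>))"
  proof (rule pair_measure_eqI)
    interpret S: prob_space "distr driven N S" by (rule E.prob_space_distr) measurable
    show "sigma_finite_measure (distr driven N S)" "sigma_finite_measure (noise TYPE('a))" ..
    show "sets (distr driven N S \<Otimes>\<^sub>M noise TYPE('a)) = sets (distr driven (N \<Otimes>\<^sub>M borel) (\<lambda>\<omega>. (S \<omega>, Y n \<omega>)))"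
      by (simp cong: sets_pair_measure_cong)
    fix A D assume "A \<in> sets (distr driven N S)" "D \<in> sets (noise TYPE('a))"
    then have AD[measurable]: "A \<in> sets N" "D \<in> sets borel" by simp_all
    have "S -` A \<inter> space driven \<in> sets (hist (n - 1))" using measurable_sets[OF S AD(1)] by simp
    from hist_prob_mult[OF this AD(2)]
    have "emeasure driven (S -` A \<inter> space driven) * emeasure driven (Y n -` D \<inter> space driven) =
      emeasure driven ((S -` A \<inter> space driven) \<inter> (Y n -` D \<inter> space driven))"
      by (simp add: E.emeasure_eq_measure ennreal_mult)
    also have "(S -` A \<inter> space driven) \<inter> (Y n -` D \<inter> space driven) = (\<lambda>\<omega>. (S \<omega>, Y n \<omega>)) -` (A \<times> D) \<inter> space driven"
      by auto
    finally show "emeasure (distr driven N S) A * emeasure (noise TYPE('a)) D =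
      emeasure (distr driven (N \<Otimes>\<^sub>M borel) (\<lambda>\<omega>. (S \<omega>, Y n \<omega>))) (A \<times> D)"
      unfolding distr_Y[of n, symmetric] by (simp add: emeasure_distr)
  qed
  have f': "f \<in> borel_measurable (N \<Otimes>\<^sub>M noise TYPE('a))"
    using f measurable_cong_sets[OF sets_pair_measure_cong[OF refl sets_noise] refl] by blast
  have "(\<integral>\<^sup>+\<omega>. f (S \<omega>, Y n \<omega>) \<partial>driven) = integral\<^sup>N (distr driven N S \<Otimes>\<^sub>M noise TYPE('a)) f"
    unfolding eq by (rule nn_integral_distr[symmetric]) measurable
  also have "\<dots> = (\<integral>\<^sup>+s. \<integral>\<^sup>+u. f (s, u) \<partial>noise TYPE('a) \<partial>distr driven N S)"
    using f' by (subst N.nn_integral_fst) (auto cong: measurable_cong_sets)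
  also have "\<dots> = (\<integral>\<^sup>+\<omega>. \<integral>\<^sup>+u. f (S \<omega>, u) \<partial>noise TYPE('a) \<partial>driven)"
    using N.borel_measurable_nn_integral_fst[OF f'] by (intro nn_integral_distr) auto
  finally show ?thesis .
qed

section \<open>Measurability with respect to the noise\<close>

lemma past_letter_hist:
  assumes k: "k \<le> n"
  shows "(\<lambda>\<omega>. X k (fst \<omega>)) \<in> measurable (hist n) (count_space UNIV)"
proof (rule measurableI)
  have co: "(\<lambda>x. x (k - n - 1)) \<in> measurable Past (count_space (UNIV :: 'a set))"
    using k by (intro measurable_component_singleton) simp
  fix A :: "'a set"
  have "(\<lambda>x. x (k - n - 1)) -` A \<inter> space Past \<in> sets Past" using measurable_sets[OF co] by simp
  then have "rect n ((\<lambda>x. x (k - n - 1)) -` A \<inter> space Past) {} (\<lambda>_. UNIV) \<in> rects n"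
    unfolding rects_def
    by (intro CollectI exI[of _ "(\<lambda>x. x (k - n - 1)) -` A \<inter> space Past"] exI[of _ "{}"] exI[of _ "\<lambda>_. UNIV"]) auto
  moreover have "past_of X n \<omega> (k - n - 1) = X k \<omega>" for \<omega>
    using k by (simp add: past_of_def)
  then have "(\<lambda>\<omega>. X k (fst \<omega>)) -` A \<inter> space (hist n) =
    rect n ((\<lambda>x. x (k - n - 1)) -` A \<inter> space Past) {} (\<lambda>_. UNIV)"
    by (auto simp: rect_def)
  ultimately show "(\<lambda>\<omega>. X k (fst \<omega>)) -` A \<inter> space (hist n) \<in> sets (hist n)"
    unfolding sets_hist by (simp add: sigma_sets.Basic)
qed simp

lemma noise_hist:
  assumes k: "k \<le> n"
  shows "(\<lambda>\<omega>. snd \<omega> k) \<in> borel_measurable (hist n)"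
proof (rule measurableI)
  fix A :: "real set" assume "A \<in> sets borel"
  with k have "rect n (space Past) {k} (\<lambda>_. A) \<in> rects n"
    unfolding rects_def
    by (intro CollectI exI[of _ "space Past"] exI[of _ "{k}"] exI[of _ "\<lambda>_. A"]) auto
  moreover have "(\<lambda>\<omega>. snd \<omega> k) -` A \<inter> space (hist n) = rect n (space Past) {k} (\<lambda>_. A)"
    by (auto simp: rect_def)
  ultimately show "(\<lambda>\<omega>. snd \<omega> k) -` A \<inter> space (hist n) \<in> sets (hist n)"
    unfolding sets_hist by (simp add: sigma_sets.Basic)
qed simp

lemma past_measurable_of_letters:
  assumes "\<And>i. i \<le> k \<Longrightarrow> (\<lambda>\<omega>. X i (fst \<omega>)) \<in> measurable N (count_space UNIV)"
  shows "(\<lambda>\<omega>. past_of X k (fst \<omega>)) \<in> measurable N Past"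
  unfolding past_of_def using assms by (intro measurable_restrict) auto

lemma past_hist: "k \<le> n \<Longrightarrow> (\<lambda>\<omega>. past_of X k (fst \<omega>)) \<in> measurable (hist n) Past"
  by (intro past_measurable_of_letters past_letter_hist) simp

lemma Y_hist: "k \<le> n \<Longrightarrow> Y k \<in> borel_measurable (hist n)"
proof -
  assume k: "k \<le> n"
  have "(\<lambda>\<omega>. sample (q (past_of X (k - 1) (fst \<omega>))) a (snd \<omega> k)) \<in> borel_measurable (hist n)" for a
    by (intro sample_measurable measurable_compose[OF past_hist q_measurable] noise_hist) (use k in auto)
  then show ?thesis
    unfolding Y_def using past_letter_hist[OF k] by (rule measurable_compose_countable)
qed

section \<open>Evolution driven by the noise\<close>

definition advance :: "real \<Rightarrow> (int \<Rightarrow> 'a) \<Rightarrow> int \<Rightarrow> 'a" where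
  "advance u x = past_concat x [letter (q x) u]"

lemma advance_space [simp]: "advance u x \<in> space Past"
  by (simp add: advance_def)

lemma advance_measurable [measurable]:
  assumes [measurable]: "f \<in> borel_measurable N" "g \<in> measurable N Past"
  shows "(\<lambda>y. advance (f y) (g y)) \<in> measurable N Past"
proof -
  have "(\<lambda>y. letter (q (g y)) (f y)) \<in> measurable N (count_space UNIV)" by measurable
  from measurable_compose_countable[OF _ this, of "\<lambda>a y. past_concat (g y) [a]" Past]
  show ?thesis unfolding advance_def by measurable
qed

text \<open>\<open>letter\<close> undoes \<open>sample\<close> as soon as the letter has positive
  conditional probability, which priming ensures for all letters, and the randomiser lies in its
  range.\<close>

lemma AE_past_advance: "AE \<omega> in driven. past_of X n (fst \<omega>) = advance (Y n \<omega>) (past_of X (n - 1) (fst \<omega>))"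
proof -
  have "AE x in past_law. \<forall>z a. 0 < q (past_concat x z) a" by (rule AE_past_concat_pos)
  then have "AE x in past_law. \<forall>a. 0 < q x a"
    using AE_space[of past_law] by eventually_elim (metis past_concat_Nil space_past_law)
  then have "AE x in distr M Past (past_of X (n - 1)). \<forall>a. 0 < q x a" by (simp only: distr_past)
  then have "AE \<omega> in M. \<forall>a. 0 < q (past_of X (n - 1) \<omega>) a" by (rule AE_distrD[rotated]) measurable
  from AE_driven_fst[OF this] have "AE \<omega> in driven. \<forall>a. 0 < q (past_of X (n - 1) (fst \<omega>)) a" .
  moreover have "AE \<omega> in driven. snd \<omega> n \<in> {0..<real CARD('a)}"
  proof (rule AE_distrD[of "\<lambda>\<omega>. snd \<omega> n" driven borel "\<lambda>v. v \<in> {0..<real CARD('a)}"])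
    show "AE v in distr driven borel (\<lambda>\<omega>. snd \<omega> n). v \<in> {0..<real CARD('a)}"
      unfolding distr_driven_snd by (rule AE_noise_range)
  qed measurable
  ultimately show ?thesis
  proof eventually_elim
    case (elim \<omega>)
    then have "Y n \<omega> \<in> region (q (past_of X (n - 1) (fst \<omega>))) (X n (fst \<omega>))"
      unfolding Y_def by (intro sample_in_region) auto
    then have "letter (q (past_of X (n - 1) (fst \<omega>))) (Y n \<omega>) = X n (fst \<omega>)"
      by (intro letter_eq prob_vec_q)
    then show ?case unfolding advance_def by (simp only: past_of_concat[of X n])
  qed
qed

text \<open>Almost every u lies in exactly one region of \<open>q x\<close> and one of
  \<open>q x'\<close>, so the integrand is a finite sum of indicators whose weights are the
  overlaps. This connects actual trajectories with the operator \<open>couple\<close>.\<close>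

lemma nn_integral_advance:
  assumes F: "\<And>x x'. 0 \<le> F x x'"
  shows "(\<integral>\<^sup>+u. ennreal (F (advance u x) (advance u x')) \<partial>noise TYPE('a)) = ennreal (couple F x x')"
proof -
  interpret N: prob_space "noise TYPE('a)" by (rule prob_space_noise)
  have "(\<integral>\<^sup>+u. ennreal (F (advance u x) (advance u x')) \<partial>noise TYPE('a)) =
    (\<integral>\<^sup>+u. (\<Sum>a\<in>UNIV. \<Sum>b\<in>UNIV. ennreal (F (past_concat x [a]) (past_concat x' [b])) *
        indicator (region (q x) a \<inter> region (q x') b) u) \<partial>noise TYPE('a))"
    using AE_noise_region[OF prob_vec_q[of x]] AE_noise_region[OF prob_vec_q[of x']]
  proof (intro nn_integral_cong_AE, eventually_elim)
    case (elim u)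
    then obtain a0 b0 where ab: "u \<in> region (q x) a0" "u \<in> region (q x') b0" by blast
    have "u \<in> region (q x) a \<inter> region (q x') b \<longleftrightarrow> a = a0 \<and> b = b0" for a b
      using region_unique[OF prob_vec_q[of x] ab(1)] region_unique[OF prob_vec_q[of x'] ab(2)] ab by blast
    then have ind: "c * indicator (region (q x) a \<inter> region (q x') b) u = (if a = a0 then if b = b0 then c else 0 else 0)"
      for a b and c :: ennreal
      by (simp add: indicator_def)
    have "letter (q x) u = a0" "letter (q x') u = b0"
      using ab by (auto intro: letter_eq prob_vec_q)
    moreover have "(\<Sum>a\<in>UNIV. \<Sum>b\<in>UNIV. if a = a0 then if b = b0 then g a b else 0 else 0) = g a0 b0"
      for g :: "'a \<Rightarrow> 'a \<Rightarrow> ennreal"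
    proof -
      have "(\<Sum>b\<in>UNIV. if a = a0 then if b = b0 then g a b else 0 else 0) = (if a = a0 then g a b0 else 0)" for a
        by simp
      then show ?thesis by simp
    qed
    ultimately show ?case unfolding ind advance_def by simp
  qed
  also have "\<dots> = (\<Sum>a\<in>UNIV. \<integral>\<^sup>+u. (\<Sum>b\<in>UNIV. ennreal (F (past_concat x [a]) (past_concat x' [b])) *
        indicator (region (q x) a \<inter> region (q x') b) u) \<partial>noise TYPE('a))"
    by (rule nn_integral_sum) measurable
  also have "\<dots> = (\<Sum>a\<in>UNIV. \<Sum>b\<in>UNIV. \<integral>\<^sup>+u. ennreal (F (past_concat x [a]) (past_concat x' [b])) *
        indicator (region (q x) a \<inter> region (q x') b) u \<partial>noise TYPE('a))"
    by (intro sum.cong refl nn_integral_sum) measurable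
  also have "\<dots> = (\<Sum>a\<in>UNIV. \<Sum>b\<in>UNIV. ennreal (F (past_concat x [a]) (past_concat x' [b])) *
      emeasure (noise TYPE('a)) (region (q x) a \<inter> region (q x') b))"
    by (intro sum.cong refl nn_integral_cmult_indicator) measurable
  also have "\<dots> = ennreal (couple F x x')"
    using F by (simp add: couple_def overlap_def N.emeasure_eq_measure mult.commute sum_nonneg
        flip: ennreal_mult sum_ennreal)
  finally show ?thesis .
qed

lemma nn_integral_advance_single:
  assumes "\<And>x. 0 \<le> h x"
  shows "(\<integral>\<^sup>+u. ennreal (h (advance u x)) \<partial>noise TYPE('a)) = ennreal (\<Sum>a\<in>UNIV. q x a * h (past_concat x [a]))"
  using nn_integral_advance[of "\<lambda>x _. h x" x x] assms by (simp add: couple_fst)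

text \<open>The past at time m + j of a chain whose past at time m is \<open>x0\<close>. As
  \<open>x0\<close> is deterministic, it is a function of the noise at times m + 1 to m + j.\<close>

primrec pseudo :: "(int \<Rightarrow> 'a) \<Rightarrow> int \<Rightarrow> nat \<Rightarrow> 'w \<times> (int \<Rightarrow> real) \<Rightarrow> int \<Rightarrow> 'a" where
  "pseudo x0 m 0 \<omega> = x0"
| "pseudo x0 m (Suc j) \<omega> = advance (Y (m + int j + 1) \<omega>) (pseudo x0 m j \<omega>)"

lemma pseudo_measurable:
  assumes "x0 \<in> space Past" "\<And>k. k \<le> m + int j \<Longrightarrow> Y k \<in> borel_measurable N"
  shows "pseudo x0 m j \<in> measurable N Past"
  using assms(2)
proof (induction j)
  case (Suc j)
  have [measurable]: "pseudo x0 m j \<in> measurable N Past" by (rule Suc.IH) (use Suc.prems in simp)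
  have [measurable]: "Y (m + int j + 1) \<in> borel_measurable N" by (rule Suc.prems) simp
  have "pseudo x0 m (Suc j) = (\<lambda>\<omega>. advance (Y (m + int j + 1) \<omega>) (pseudo x0 m j \<omega>))" by (rule ext) simp
  then show ?case by simp
next
  case 0
  have "pseudo x0 m 0 = (\<lambda>_. x0)" by (rule ext) simp
  then show ?case by (simp add: assms(1))
qed

text \<open>Freeze both pasts at time m + j and integrate the last noise: F becomes
  \<open>couple F\<close>, which is why F varies in the induction. On the right x follows
  \<open>past_law\<close> by stationarity, while \<open>x0\<close> stays fixed.\<close>

lemma nn_integral_pseudo:
  assumes x0: "x0 \<in> space Past"
    and F: "case_prod F \<in> borel_measurable (Past \<Otimes>\<^sub>M Past)" "\<And>x x'. 0 \<le> F x x'"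
  shows "(\<integral>\<^sup>+\<omega>. ennreal (F (past_of X (m + int j) (fst \<omega>)) (pseudo x0 m j \<omega>)) \<partial>driven) =
    (\<integral>\<^sup>+x. ennreal ((couple ^^ j) F x x0) \<partial>past_law)"
  using F
proof (induction j arbitrary: F)
  case 0
  note [measurable] = 0(1)
  have m: "(\<lambda>x. F x x0) \<in> borel_measurable Past"
    using measurable_compose[OF measurable_Pair1'[OF x0, of Past] 0(1)] measurable_compose[OF measurable_Pair2'[OF x0, of Past] 0(1)] by simp
  have "(\<integral>\<^sup>+\<omega>. ennreal (F (past_of X m (fst \<omega>)) x0) \<partial>driven) = (\<integral>\<^sup>+\<omega>. ennreal (F (past_of X m \<omega>) x0) \<partial>distr driven M fst)"
    using measurable_compose[OF past_of_measurable[OF X_measurable, where n=m] m]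
    by (intro nn_integral_distr[symmetric]) auto
  also have "\<dots> = (\<integral>\<^sup>+x. ennreal (F x x0) \<partial>past_law)"
    unfolding distr_driven_fst using nn_integral_past[of "\<lambda>x. ennreal (F x x0)" m] m by simp
  finally show ?case by simp
next
  case (Suc j)
  define n where "n = m + int j + 1"
  define S where "S \<omega> = (past_of X (n - 1) (fst \<omega>), pseudo x0 m j \<omega>)" for \<omega>
  have pm: "pseudo x0 m j \<in> measurable (hist (n - 1)) Past"
    by (intro pseudo_measurable x0 Y_hist) (simp add: n_def)
  have S: "S \<in> measurable (hist (n - 1)) (Past \<Otimes>\<^sub>M Past)"
    unfolding S_def by (intro measurable_Pair past_hist pm) simp
  have f: "(\<lambda>(s, u). ennreal (F (advance u (fst s)) (advance u (snd s)))) \<in> borel_measurable ((Past \<Otimes>\<^sub>M Past) \<Otimes>\<^sub>M borel)"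
    (is "?f \<in> _")
  proof -
    have "(\<lambda>y. (advance (snd y) (fst (fst y)), advance (snd y) (snd (fst y)))) \<in>
      measurable ((Past \<Otimes>\<^sub>M Past) \<Otimes>\<^sub>M borel) (Past \<Otimes>\<^sub>M Past)" by measurable
    from measurable_compose[OF this Suc.prems(1)] show ?thesis by (simp add: split_def)
  qed
  have "(\<integral>\<^sup>+\<omega>. ennreal (F (past_of X (m + int (Suc j)) (fst \<omega>)) (pseudo x0 m (Suc j) \<omega>)) \<partial>driven) =
    (\<integral>\<^sup>+\<omega>. ?f (S \<omega>, Y n \<omega>) \<partial>driven)"
  proof (intro nn_integral_cong_AE)
    have n: "m + int (Suc j) = n" "m + int j + 1 = n" by (simp_all add: n_def)
    show "AE \<omega> in driven. ennreal (F (past_of X (m + int (Suc j)) (fst \<omega>)) (pseudo x0 m (Suc j) \<omega>)) = ?f (S \<omega>, Y n \<omega>)"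
      using AE_past_advance[of n] unfolding n pseudo.simps S_def by eventually_elim simp
  qed
  also have "\<dots> = (\<integral>\<^sup>+\<omega>. \<integral>\<^sup>+u. ?f (S \<omega>, u) \<partial>noise TYPE('a) \<partial>driven)"
    by (rule nn_integral_hist_Y[OF S f])
  also have "\<dots> = (\<integral>\<^sup>+\<omega>. ennreal (couple F (past_of X (m + int j) (fst \<omega>)) (pseudo x0 m j \<omega>)) \<partial>driven)"
    using Suc.prems(2) by (simp add: S_def nn_integral_advance n_def)
  also have "\<dots> = (\<integral>\<^sup>+x. ennreal ((couple ^^ j) (couple F) x x0) \<partial>past_law)"
    using Suc.prems couple_pow_nonneg[of F 1] by (intro Suc.IH couple_measurable) auto
  finally show ?case by (simp add: funpow_swap1)
qed

lemma same_last_measurable: "case_prod same_last \<in> borel_measurable (Past \<Otimes>\<^sub>M Past)"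
proof -
  have co: "(\<lambda>x. x (-1)) \<in> measurable Past (count_space (UNIV :: 'a set))"
    by (rule measurable_component_singleton) simp
  note [measurable] = measurable_compose[OF measurable_fst co, of "Past :: (int \<Rightarrow> 'a) measure"]
    measurable_compose[OF measurable_snd co, of "Past :: (int \<Rightarrow> 'a) measure"]
  have "(\<lambda>y. \<Sum>a\<in>(UNIV :: 'a set). indicator {a} (fst y (-1)) * indicator {a} (snd y (-1)) :: real) \<in> borel_measurable (Past \<Otimes>\<^sub>M Past)"
    by measurable
  moreover have "(\<Sum>a\<in>UNIV. indicator {a} (x (-1)) * indicator {a} (x' (-1))) = same_last x x'" for x x'
    by (cases "x (-1) = x' (-1)") (auto simp: same_last_def indicator_def of_bool_def if_distrib[of "\<lambda>y. _ * y"] cong: if_cong)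
  ultimately show ?thesis by (simp add: split_def)
qed

text \<open>The average over two independent pasts exceeds \<open>1 - \<epsilon>\<close>; by Fubini
  some second past must do as well with the first still averaged.\<close>

lemma ex_start:
  assumes "0 < \<epsilon>"
  obtains t x0 where "x0 \<in> space Past" "1 - \<epsilon> \<le> (\<integral>x. (couple ^^ t) same_last x x0 \<partial>past_law)"
proof -
  interpret P: prob_space past_law by (rule prob_space_past_law)
  interpret PP: pair_prob_space past_law past_law ..
  have "eventually (\<lambda>t. 1 - \<epsilon> < pair_mean ((couple ^^ Suc t) same_last)) sequentially"
    using pair_mean_couple_pow_same_last_tendsto assms by (intro order_tendstoD) auto
  then obtain t where t: "1 - \<epsilon> < pair_mean ((couple ^^ Suc t) same_last)" by (auto simp: eventually_sequentially)
  define F where "F = (couple ^^ Suc t) same_last"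
  have bd: "0 \<le> F x x'" "F x x' \<le> 1" for x x'
    unfolding F_def by (intro couple_pow_nonneg couple_pow_le_1; simp add: same_last_def)+
  have Fm: "case_prod F \<in> borel_measurable (Past \<Otimes>\<^sub>M Past)"
    unfolding F_def by (rule couple_pow_measurable[OF same_last_measurable])
  have int: "integrable (past_law \<Otimes>\<^sub>M past_law) (case_prod F)"
    using bd by (intro integrable_pair_past[where C=1] Fm) (simp add: abs_le_iff)
  have eq: "pair_mean F = (\<integral>x0. (\<integral>x. F x x0 \<partial>past_law) \<partial>past_law)"
    unfolding pair_mean_def using PP.integral_snd[OF int] by (simp add: split_def)
  have "\<exists>x0\<in>space Past. 1 - \<epsilon> \<le> (\<integral>x. F x x0 \<partial>past_law)"
  proof (rule ccontr)
    assume "\<not> ?thesis"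
    then have "(\<integral>x. F x x0 \<partial>past_law) \<le> 1 - \<epsilon>" if "x0 \<in> space Past" for x0 using that by force
    moreover have "integrable past_law (\<lambda>x0. \<integral>x. F x x0 \<partial>past_law)"
      using PP.integrable_snd[OF int] by simp
    ultimately have "pair_mean F \<le> (\<integral>x0. 1 - \<epsilon> \<partial>past_law)"
      unfolding eq by (intro integral_mono) auto
    with t show False unfolding F_def using P.prob_space by simp
  qed
  then show thesis using that unfolding F_def by blast
qed

section \<open>The letters as functions of the noise\<close>

abbreviation XF :: "int \<Rightarrow> ('w \<times> (int \<Rightarrow> real)) measure" where
  "XF \<equiv> nat_filt driven (count_space UNIV) (\<lambda>n. X n \<circ> fst)"

abbreviation YF :: "int \<Rightarrow> ('w \<times> (int \<Rightarrow> real)) measure" where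
  "YF \<equiv> nat_filt driven borel Y"

lemma Y_YF: "k \<le> n \<Longrightarrow> Y k \<in> borel_measurable (YF n)"
  by (intro nat_filt_measurable Y_measurable)

lemma X_driven [measurable]: "X k \<circ> fst \<in> measurable driven (count_space UNIV)"
  by (intro measurable_comp[OF fst_driven] X_measurable)

lemma X_XF: "k \<le> n \<Longrightarrow> X k \<circ> fst \<in> measurable (XF n) (count_space UNIV)"
  using nat_filt_measurable[of "\<lambda>n. X n \<circ> fst" k driven "count_space UNIV" n] by simp

lemma ex_approx:
  assumes "0 < \<epsilon>"
  obtains h where "h \<in> measurable (YF n) (count_space UNIV)"
    "measure driven {\<omega> \<in> space driven. X n (fst \<omega>) \<noteq> h \<omega>} \<le> \<epsilon>"
proof -
  interpret P: prob_space past_law by (rule prob_space_past_law)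
  interpret E: prob_space driven by (rule prob_space_driven)
  obtain t x0 where x0: "x0 \<in> space Past" and t: "1 - \<epsilon> \<le> (\<integral>x. (couple ^^ t) same_last x x0 \<partial>past_law)"
    using assms by (rule ex_start)
  \<comment> \<open>Started at time \<open>n - int t\<close>, the second chain has its newest
    letter, stored at index -1, at time n after t steps.\<close>
  define h where "h \<omega> = pseudo x0 (n - int t) t \<omega> (-1)" for \<omega>
  have co: "(\<lambda>x. x (-1)) \<in> measurable Past (count_space (UNIV :: 'a set))"
    by (rule measurable_component_singleton) simp
  have h: "h \<in> measurable N (count_space UNIV)" if "\<And>k. k \<le> n \<Longrightarrow> Y k \<in> borel_measurable N" for N
    unfolding h_def using x0 that by (intro measurable_compose[OF pseudo_measurable co]) auto
  have hd [measurable]: "h \<in> measurable driven (count_space UNIV)" by (rule h) simp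
  have "{\<omega> \<in> space driven. (X n \<circ> fst) \<omega> = h \<omega>} \<in> E.events" by measurable
  then have ev: "{\<omega> \<in> space driven. X n (fst \<omega>) = h \<omega>} \<in> E.events" by simp
  have m: "(\<lambda>x. (couple ^^ t) same_last x x0) \<in> borel_measurable Past"
    using measurable_compose[OF measurable_Pair2'[OF x0, of Past] couple_pow_measurable[OF same_last_measurable]] by simp
  have bd: "0 \<le> (couple ^^ t) same_last x x0" "(couple ^^ t) same_last x x0 \<le> 1" for x
    by (intro couple_pow_nonneg couple_pow_le_1; simp add: same_last_def)+
  have "ennreal (1 - \<epsilon>) \<le> ennreal (\<integral>x. (couple ^^ t) same_last x x0 \<partial>past_law)"
    using t by (rule ennreal_leI)
  also have "\<dots> = (\<integral>\<^sup>+x. ennreal ((couple ^^ t) same_last x x0) \<partial>past_law)"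
    using m bd by (intro nn_integral_eq_integral[symmetric] P.integrable_const_bound[where B=1]) auto
  also have "\<dots> = (\<integral>\<^sup>+\<omega>. ennreal (same_last (past_of X (n - int t + int t) (fst \<omega>)) (pseudo x0 (n - int t) t \<omega>)) \<partial>driven)"
    by (rule nn_integral_pseudo[symmetric, OF x0 same_last_measurable]) (simp add: same_last_def)
  also have "\<dots> = (\<integral>\<^sup>+\<omega>. indicator {\<omega> \<in> space driven. X n (fst \<omega>) = h \<omega>} \<omega> \<partial>driven)"
    by (intro nn_integral_cong) (auto simp: same_last_def h_def past_of_def indicator_def)
  also have "\<dots> = ennreal (E.prob {\<omega> \<in> space driven. X n (fst \<omega>) = h \<omega>})"
    using ev by (simp add: E.emeasure_eq_measure)
  finally have "1 - \<epsilon> \<le> E.prob {\<omega> \<in> space driven. X n (fst \<omega>) = h \<omega>}"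
    by (simp add: ennreal_le_iff)
  moreover have "{\<omega> \<in> space driven. X n (fst \<omega>) \<noteq> h \<omega>} = space driven - {\<omega> \<in> space driven. X n (fst \<omega>) = h \<omega>}"
    by blast
  ultimately have "E.prob {\<omega> \<in> space driven. X n (fst \<omega>) \<noteq> h \<omega>} \<le> \<epsilon>"
    using E.prob_compl[OF ev] by simp
  then show thesis using that[of h] h[OF Y_YF] by blast
qed

text \<open>With errors \<open>(1/2) ^ i\<close> Borel-Cantelli makes the approximations eventually
  equal to \<open>X n\<close> almost surely. The event that they are eventually a is measurable in
  the noise, and null sets belong to the filtration.\<close>

lemma X_YF: "X n \<circ> fst \<in> measurable (YF n) (count_space UNIV)"
proof -
  interpret E: prob_space driven by (rule prob_space_driven)
  have "\<exists>h. h \<in> measurable (YF n) (count_space UNIV) \<and> E.prob {\<omega> \<in> space driven. X n (fst \<omega>) \<noteq> h \<omega>} \<le> (1/2) ^ i"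
    for i :: nat
    by (rule ex_approx[of "(1/2) ^ i" n]) auto
  then have "\<exists>h. \<forall>i::nat. h i \<in> measurable (YF n) (count_space UNIV) \<and>
      E.prob {\<omega> \<in> space driven. X n (fst \<omega>) \<noteq> h i \<omega>} \<le> (1/2) ^ i"
    by (intro choice allI)
  then obtain h where h: "\<And>i::nat. h i \<in> measurable (YF n) (count_space UNIV)"
    and hp: "\<And>i::nat. E.prob {\<omega> \<in> space driven. X n (fst \<omega>) \<noteq> h i \<omega>} \<le> (1/2) ^ i"
    by auto
  have hd: "h i \<in> measurable driven (count_space UNIV)" for i
    using h[of i] sets_nat_filt_subset[of Y driven borel n] Y_measurable
    by (auto simp: measurable_def)
  have ev: "{\<omega> \<in> space driven. X n (fst \<omega>) \<noteq> h i \<omega>} \<in> E.events" for i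
  proof -
    note [measurable] = hd[of i]
    have "{\<omega> \<in> space driven. (X n \<circ> fst) \<omega> \<noteq> h i \<omega>} \<in> E.events" by measurable
    then show ?thesis by simp
  qed
  have "AE \<omega> in driven. eventually (\<lambda>i. \<omega> \<in> space driven - {\<omega> \<in> space driven. X n (fst \<omega>) \<noteq> h i \<omega>}) sequentially"
  proof (rule borel_cantelli_AE1[OF ev])
    show "summable (\<lambda>i. E.prob {\<omega> \<in> space driven. X n (fst \<omega>) \<noteq> h i \<omega>})"
      using hp by (intro summable_comparison_test'[OF summable_geometric[of "1/2 :: real"]]) auto
  qed (simp add: E.emeasure_eq_measure)
  then have conv: "AE \<omega> in driven. eventually (\<lambda>i. h i \<omega> = X n (fst \<omega>)) sequentially"
    by eventually_elim (auto elim!: eventually_mono)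
  show ?thesis
  proof (rule measurable_count_space_eq2[THEN iffD2], simp, safe)
    fix a
    define B where "B = {\<omega> \<in> space (YF n). eventually (\<lambda>i. h i \<omega> = a) sequentially}"
    have "B \<in> sets (YF n)"
    proof -
      note [measurable] = h
      show ?thesis unfolding B_def by measurable
    qed
    moreover have "(X n \<circ> fst) -` {a} \<inter> space driven \<in> sets driven"
      using X_driven by (rule measurable_sets) simp
    moreover have "AE \<omega> in driven. \<omega> \<in> (X n \<circ> fst) -` {a} \<inter> space driven \<longleftrightarrow> \<omega> \<in> B"
      using conv AE_space
    proof eventually_elim
      case (elim \<omega>)
      have "X n (fst \<omega>) = a" if "eventually (\<lambda>i. h i \<omega> = a) sequentially"
        using eventually_happens'[OF sequentially_bot eventually_conj[OF that elim(1)]] by auto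
      with elim show ?case by (auto simp: B_def)
    qed
    ultimately show "(X n \<circ> fst) -` {a} \<inter> space (YF n) \<in> sets (YF n)"
      by (simp only: space_nat_filt) (rule sets_nat_filt_AE[OF Y_measurable])
  qed simp
qed

lemma XF_subset_YF: "sets (XF n) \<subseteq> sets (YF n)"
proof -
  have "(X k \<circ> fst) -` B \<inter> space driven \<in> sets (YF n)" if "k \<le> n" for k B
    using measurable_sets[OF X_YF[of k], of B] sets_nat_filt_mono[OF that, of driven borel Y] by auto
  moreover have "null_sets driven \<subseteq> sets (YF n)" using null_sets_nat_filt by blast
  ultimately have "(\<Union>k\<in>{..n}. {(X k \<circ> fst) -` B \<inter> space driven | B. B \<in> sets (count_space UNIV)}) \<union> null_sets driven \<subseteq> sets (YF n)"
    by blast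
  then show ?thesis
    unfolding sets_nat_filt[of driven "count_space UNIV"]
    using sets.sigma_sets_subset[of _ "YF n"] unfolding space_nat_filt by blast
qed

section \<open>Immersion\<close>

text \<open>Split off the largest index b of a finite set: the events at smaller times lie in
  \<open>hist (b - 1)\<close>, from which \<open>Y b\<close> is independent.\<close>

lemma indep_vars_Y: "prob_space.indep_vars driven (\<lambda>_. borel) Y UNIV"
proof -
  interpret E: prob_space driven by (rule prob_space_driven)
  \<comment> \<open>The explicit \<open>space driven\<close> makes the empty intersection the sure
    event, as the base case requires.\<close>
  have mult: "E.prob (space driven \<inter> (\<Inter>j\<in>J. Y j -` D j \<inter> space driven)) = (\<Prod>j\<in>J. E.prob (Y j -` D j \<inter> space driven))"
    if "finite J" "\<And>j. D j \<in> sets borel" for J D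
    using that(1)
  proof (induction J rule: finite_linorder_max_induct)
    case (insert b J)
    have "Y j -` D j \<inter> space driven \<in> sets (hist (b - 1))" if "j \<in> J" for j
      using measurable_sets[OF Y_hist \<open>D j \<in> sets borel\<close>, of j "b - 1"] insert(2) that by simp
    then have A: "space driven \<inter> (\<Inter>j\<in>J. Y j -` D j \<inter> space driven) \<in> sets (hist (b - 1))"
    proof (cases "J = {}")
      case True
      then show ?thesis using sets.top[of "hist (b - 1)"] by simp
    next
      case False
      then have "(\<Inter>j\<in>J. Y j -` D j \<inter> space driven) \<in> sets (hist (b - 1))"
        using insert(1) \<open>\<And>j. j \<in> J \<Longrightarrow> _ \<in> sets (hist (b - 1))\<close> by (intro sets.finite_INT)
      from sets.Int[OF sets.top this] show ?thesis by (simp only: space_hist)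
    qed
    have eq: "space driven \<inter> (\<Inter>j\<in>insert b J. Y j -` D j \<inter> space driven) =
      (space driven \<inter> (\<Inter>j\<in>J. Y j -` D j \<inter> space driven)) \<inter> (Y b -` D b \<inter> space driven)" by blast
    have "b \<notin> J" using insert(2) by blast
    then show ?case
      unfolding eq using hist_prob_mult[OF A that(2)[of b]] insert by simp
  qed (simp add: E.prob_space)
  show ?thesis
    unfolding E.indep_vars_def2
  proof (intro conjI ballI E.indep_setsI)
    fix A J assume J: "J \<noteq> {}" "finite J" "\<forall>j\<in>J. A j \<in> {Y j -` D \<inter> space driven | D. D \<in> sets borel}"
    then have "\<forall>j\<in>J. \<exists>D. A j = Y j -` D \<inter> space driven \<and> D \<in> sets borel" by blast
    then obtain D where D: "\<And>j. j \<in> J \<Longrightarrow> A j = Y j -` D j \<inter> space driven \<and> D j \<in> sets borel"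
      by metis
    define D' where "D' j = (if j \<in> J then D j else UNIV)" for j
    have "A j = Y j -` D' j \<inter> space driven" if "j \<in> J" for j using D that by (simp add: D'_def)
    moreover have "(\<Inter>j\<in>J. A j) = space driven \<inter> (\<Inter>j\<in>J. A j)" using J(1) D by blast
    moreover have "D' j \<in> sets borel" for j using D by (simp add: D'_def)
    ultimately show "E.prob (\<Inter>j\<in>J. A j) = (\<Prod>j\<in>J. E.prob (A j))"
      using mult[OF J(2), of D'] by simp
  qed auto
qed

text \<open>The null sets among the generators prevent an exact description, hence the almost sure
  equivalence. The same holds in \<open>YF_event_hist\<close>, where \<open>hist\<close> contains no
  added null sets.\<close>

lemma XF_event_past:
  assumes "A \<in> sets (XF n)"
  shows "\<exists>B\<in>sets Past. AE \<omega> in driven. \<omega> \<in> A \<longleftrightarrow> past_of X n (fst \<omega>) \<in> B"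
  using assms unfolding sets_nat_filt
proof (induction rule: sigma_sets.induct)
  case (Basic A)
  then consider k S where "k \<le> n" "A = (X k \<circ> fst) -` S \<inter> space driven" | "A \<in> null_sets driven"
    by auto
  then show ?case
  proof cases
    case 1
    have co: "(\<lambda>x. x (k - n - 1)) \<in> measurable Past (count_space (UNIV :: 'a set))"
      using 1 by (intro measurable_component_singleton) simp
    have "past_of X n \<omega> (k - n - 1) = X k \<omega>" for \<omega> using 1 by (simp add: past_of_def)
    then show ?thesis
      using 1 measurable_sets[OF co, of S]
      by (intro bexI[of _ "(\<lambda>x. x (k - n - 1)) -` S \<inter> space Past"] AE_I2) auto
  next
    case 2
    then show ?thesis by (intro bexI[of _ "{}"]) (auto dest: AE_not_in)
  qed
next
  case Empty
  show ?case by (intro bexI[of _ "{}"]) auto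
next
  case (Compl A)
  then obtain B where "B \<in> sets Past" "AE \<omega> in driven. \<omega> \<in> A \<longleftrightarrow> past_of X n (fst \<omega>) \<in> B" by blast
  then show ?case
    using AE_space[of driven] by (intro bexI[of _ "space Past - B"]) (auto elim: eventually_elim2)
next
  case (Union A)
  then have "\<forall>i. \<exists>B. B \<in> sets Past \<and> (AE \<omega> in driven. \<omega> \<in> A i \<longleftrightarrow> past_of X n (fst \<omega>) \<in> B)" by blast
  from choice[OF this] obtain B
    where B: "\<And>i. B i \<in> sets Past" "\<And>i. AE \<omega> in driven. \<omega> \<in> A i \<longleftrightarrow> past_of X n (fst \<omega>) \<in> B i"
    by auto
  have "AE \<omega> in driven. \<forall>i. \<omega> \<in> A i \<longleftrightarrow> past_of X n (fst \<omega>) \<in> B i"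
    using B(2) by (simp add: AE_all_countable)
  then have "AE \<omega> in driven. \<omega> \<in> (\<Union>i. A i) \<longleftrightarrow> past_of X n (fst \<omega>) \<in> (\<Union>i. B i)"
    by eventually_elim auto
  then show ?case using B(1) by (intro bexI[of _ "\<Union>i. B i"]) auto
qed

lemma YF_event_hist:
  assumes "D \<in> sets (YF n)"
  shows "\<exists>H\<in>sets (hist n). AE \<omega> in driven. \<omega> \<in> D \<longleftrightarrow> \<omega> \<in> H"
  using assms unfolding sets_nat_filt
proof (induction rule: sigma_sets.induct)
  case (Basic D)
  then consider k S where "k \<le> n" "D = Y k -` S \<inter> space driven" "S \<in> sets borel" | "D \<in> null_sets driven"
    by auto
  then show ?case
  proof cases
    case 1
    then have "D \<in> sets (hist n)" using measurable_sets[OF Y_hist, of k n S] by simp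
    then show ?thesis by (intro bexI[of _ D]) auto
  next
    case 2
    then show ?thesis by (intro bexI[of _ "{}"]) (auto dest: AE_not_in)
  qed
next
  case Empty
  show ?case by (intro bexI[of _ "{}"]) auto
next
  case (Compl D)
  then obtain H where H: "H \<in> sets (hist n)" "AE \<omega> in driven. \<omega> \<in> D \<longleftrightarrow> \<omega> \<in> H" by blast
  from H(1) have "space driven - H \<in> sets (hist n)" using sets.compl_sets[of H "hist n"] by simp
  moreover have "AE \<omega> in driven. \<omega> \<in> space driven - D \<longleftrightarrow> \<omega> \<in> space driven - H"
    using H(2) by eventually_elim auto
  ultimately show ?case by blast
next
  case (Union D)
  then have "\<forall>i. \<exists>H. H \<in> sets (hist n) \<and> (AE \<omega> in driven. \<omega> \<in> D i \<longleftrightarrow> \<omega> \<in> H)" by blast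
  from choice[OF this] obtain H
    where H: "\<And>i. H i \<in> sets (hist n)" "\<And>i. AE \<omega> in driven. \<omega> \<in> D i \<longleftrightarrow> \<omega> \<in> H i"
    by auto
  have "AE \<omega> in driven. \<forall>i. \<omega> \<in> D i \<longleftrightarrow> \<omega> \<in> H i"
    using H(2) by (simp add: AE_all_countable)
  then have "AE \<omega> in driven. \<omega> \<in> (\<Union>i. D i) \<longleftrightarrow> \<omega> \<in> (\<Union>i. H i)"
    by eventually_elim auto
  then show ?case using H(1) by (intro bexI[of _ "\<Union>i. H i"]) auto
qed

text \<open>The transition kernel of the chain of pasts, evaluated at B.\<close>

definition next_prob :: "(int \<Rightarrow> 'a) set \<Rightarrow> (int \<Rightarrow> 'a) \<Rightarrow> real" where
  "next_prob B x = (\<Sum>a\<in>UNIV. q x a * indicator B (past_concat x [a]))"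

lemma next_prob_bounds: "0 \<le> next_prob B x" "next_prob B x \<le> 1"
  unfolding next_prob_def by (intro step_mean_bounds; simp add: indicator_def)+

lemma next_prob_measurable [measurable]:
  assumes [measurable]: "B \<in> sets Past"
  shows "next_prob B \<in> borel_measurable Past"
  unfolding next_prob_def by measurable

text \<open>The next past is a function of the present one and of the fresh noise
  \<open>Y (n + 1)\<close>, which is independent of all that D may depend on. Testing against events
  of \<open>YF n\<close>, a larger class than those of \<open>XF n\<close>, is exactly what
  immersion requires.\<close>

lemma integral_next_prob:
  assumes A: "A \<in> sets driven" and [measurable]: "B \<in> sets Past"
    and AB: "AE \<omega> in driven. \<omega> \<in> A \<longleftrightarrow> past_of X (n + 1) (fst \<omega>) \<in> B"
    and D: "D \<in> sets (YF n)"
  shows "(\<integral>\<omega>. indicator D \<omega> * indicator A \<omega> \<partial>driven) =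
    (\<integral>\<omega>. indicator D \<omega> * next_prob B (past_of X n (fst \<omega>)) \<partial>driven)"
proof -
  interpret E: prob_space driven by (rule prob_space_driven)
  have DM [measurable]: "D \<in> sets driven" using sets_nat_filt_subset[of Y driven borel n] D Y_measurable by blast
  note [measurable] = A
  obtain H where H: "H \<in> sets (hist n)" "AE \<omega> in driven. \<omega> \<in> D \<longleftrightarrow> \<omega> \<in> H"
    using YF_event_hist[OF D] by blast
  define S where "S \<omega> = (indicator H \<omega> :: real, past_of X n (fst \<omega>))" for \<omega>
  have S: "S \<in> measurable (hist (n + 1 - 1)) (borel \<Otimes>\<^sub>M Past)"
    unfolding S_def using H(1) by (intro measurable_Pair past_hist borel_measurable_indicator) auto
  have "(\<integral>\<^sup>+\<omega>. ennreal (indicator D \<omega> * indicator A \<omega>) \<partial>driven) =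
    (\<integral>\<^sup>+\<omega>. (\<lambda>(s, u). ennreal (fst s * indicator B (advance u (snd s)))) (S \<omega>, Y (n + 1) \<omega>) \<partial>driven)"
    using H(2) AB AE_past_advance[of "n + 1"]
    by (intro nn_integral_cong_AE, eventually_elim) (auto simp: S_def indicator_def)
  also have "\<dots> = (\<integral>\<^sup>+\<omega>. \<integral>\<^sup>+u. (\<lambda>(s, u). ennreal (fst s * indicator B (advance u (snd s)))) (S \<omega>, u) \<partial>noise TYPE('a) \<partial>driven)"
    by (rule nn_integral_hist_Y[OF S]) measurable
  also have "\<dots> = (\<integral>\<^sup>+\<omega>. ennreal (indicator D \<omega> * next_prob B (past_of X n (fst \<omega>))) \<partial>driven)"
    using H(2)
  proof (intro nn_integral_cong_AE, eventually_elim)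
    case (elim \<omega>)
    have "(\<integral>\<^sup>+u. ennreal (indicator B (advance u (past_of X n (fst \<omega>)))) \<partial>noise TYPE('a)) = ennreal (next_prob B (past_of X n (fst \<omega>)))"
      unfolding next_prob_def by (rule nn_integral_advance_single) simp
    with elim show ?case by (cases "\<omega> \<in> H") (auto simp: S_def)
  qed
  finally have "(\<integral>\<^sup>+\<omega>. ennreal (indicator D \<omega> * indicator A \<omega>) \<partial>driven) =
    (\<integral>\<^sup>+\<omega>. ennreal (indicator D \<omega> * next_prob B (past_of X n (fst \<omega>))) \<partial>driven)" .
  then show ?thesis
    by (subst (1 2) integral_eq_nn_integral) (auto simp: next_prob_bounds)
qed

text \<open>The prediction \<alpha> of A from the larger history is already measurable for the
  smaller one. So it is the conditional expectation of A, and it factors out of that of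
  \<open>A \<inter> D\<close>.\<close>

lemma cond_indep_XF_YF: "cond_indep driven (XF n) (sets (XF (n + 1))) (sets (YF n))"
  unfolding cond_indep_def
proof (intro ballI)
  fix A D assume AX: "A \<in> sets (XF (n + 1))" and D: "D \<in> sets (YF n)"
  interpret E: prob_space driven by (rule prob_space_driven)
  have XF_sub: "sets (XF m) \<subseteq> sets driven" for m by (rule sets_nat_filt_subset) (rule X_driven)
  have YF_sub: "sets (YF m) \<subseteq> sets driven" for m by (rule sets_nat_filt_subset) (rule Y_measurable)
  have "finite_measure_subalgebra driven (XF n)"
    using XF_sub by unfold_locales (simp add: subalgebra_def)
  then interpret S: sigma_finite_subalgebra driven "XF n"
    by (rule finite_measure_subalgebra_is_sigma_finite)
  have A [measurable]: "A \<in> sets driven" using AX XF_sub by blast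
  have [measurable]: "D \<in> sets driven" using D YF_sub by blast
  obtain B where B [measurable]: "B \<in> sets Past" and AB: "AE \<omega> in driven. \<omega> \<in> A \<longleftrightarrow> past_of X (n + 1) (fst \<omega>) \<in> B"
    using XF_event_past[OF AX] by blast
  define \<alpha> where "\<alpha> \<omega> = next_prob B (past_of X n (fst \<omega>))" for \<omega> :: "'w \<times> (int \<Rightarrow> real)"
  have key: "(\<integral>\<omega>. indicator D' \<omega> * indicator A \<omega> \<partial>driven) = (\<integral>\<omega>. indicator D' \<omega> * \<alpha> \<omega> \<partial>driven)"
    if "D' \<in> sets (YF n)" for D'
    unfolding \<alpha>_def by (rule integral_next_prob[OF A B AB that])
  have "(\<lambda>\<omega>. past_of X n (fst \<omega>)) \<in> measurable (XF n) Past"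
    using X_XF by (intro past_measurable_of_letters) (simp add: comp_def)
  then have \<alpha>X [measurable]: "\<alpha> \<in> borel_measurable (XF n)"
    unfolding \<alpha>_def by (rule measurable_compose) measurable
  then have \<alpha>M [measurable]: "\<alpha> \<in> borel_measurable driven"
    unfolding \<alpha>_def by measurable
  have \<alpha>: "0 \<le> \<alpha> \<omega>" "\<alpha> \<omega> \<le> 1" for \<omega> unfolding \<alpha>_def by (rule next_prob_bounds)+
  have int_bd: "integrable driven f" if "f \<in> borel_measurable driven" "\<And>\<omega>. \<bar>f \<omega>\<bar> \<le> 1" for f :: "_ \<Rightarrow> real"
    using that by (intro E.integrable_const_bound[where B=1]) auto
  have ceA: "AE \<omega> in driven. real_cond_exp driven (XF n) (indicator A) \<omega> = \<alpha> \<omega>"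
  proof (rule S.real_cond_exp_charact)
    fix E' assume "E' \<in> sets (XF n)"
    then have "E' \<in> sets (YF n)" using XF_subset_YF by blast
    from key[OF this] show "(\<integral>\<omega>\<in>E'. indicator A \<omega> \<partial>driven) = (\<integral>\<omega>\<in>E'. \<alpha> \<omega> \<partial>driven)"
      by (simp add: set_lebesgue_integral_def)
  qed (use \<alpha> in \<open>auto intro!: int_bd simp: indicator_def abs_le_iff\<close>)
  have "AE \<omega> in driven. real_cond_exp driven (XF n) (indicator (A \<inter> D)) \<omega> =
    \<alpha> \<omega> * real_cond_exp driven (XF n) (indicator D) \<omega>"
  proof (rule S.real_cond_exp_charact)
    have int: "integrable driven (\<lambda>\<omega>. \<alpha> \<omega> * indicator D \<omega>)"
      using \<alpha> by (intro int_bd) (auto simp: indicator_def)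
    show "integrable driven (\<lambda>\<omega>. \<alpha> \<omega> * real_cond_exp driven (XF n) (indicator D) \<omega>)"
      by (rule S.real_cond_exp_intg(1)[OF int]) measurable
    fix E' assume E': "E' \<in> sets (XF n)"
    \<comment> \<open>The test event now involves D as well, so \<open>key\<close> is needed on
      \<open>YF n\<close>.\<close>
    then have E'D: "E' \<inter> D \<in> sets (YF n)" using XF_subset_YF D by blast
    have [measurable]: "E' \<in> sets driven" using E' XF_sub by blast
    have [measurable]: "E' \<in> sets (XF n)" by (rule E')
    have int': "integrable driven (\<lambda>\<omega>. (indicator E' \<omega> * \<alpha> \<omega>) * indicator D \<omega>)"
      using \<alpha> by (intro int_bd) (auto simp: indicator_def)
    have "(\<integral>\<omega>\<in>E'. indicat_real (A \<inter> D) \<omega> \<partial>driven) = (\<integral>\<omega>. indicator (E' \<inter> D) \<omega> * indicator A \<omega> \<partial>driven)"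
      unfolding set_lebesgue_integral_def by (intro Bochner_Integration.integral_cong) (auto simp: indicator_def)
    also have "\<dots> = (\<integral>\<omega>. indicator (E' \<inter> D) \<omega> * \<alpha> \<omega> \<partial>driven)" by (rule key[OF E'D])
    also have "\<dots> = (\<integral>\<omega>. (indicator E' \<omega> * \<alpha> \<omega>) * indicator D \<omega> \<partial>driven)"
      by (intro Bochner_Integration.integral_cong) (auto simp: indicator_def)
    also have "\<dots> = (\<integral>\<omega>. (indicator E' \<omega> * \<alpha> \<omega>) * real_cond_exp driven (XF n) (indicator D) \<omega> \<partial>driven)"
      by (rule S.real_cond_exp_intg(2)[OF int', symmetric]) measurable
    also have "\<dots> = (\<integral>\<omega>\<in>E'. \<alpha> \<omega> * real_cond_exp driven (XF n) (indicator D) \<omega> \<partial>driven)"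
      by (simp add: set_lebesgue_integral_def mult.assoc)
    finally show "(\<integral>\<omega>\<in>E'. indicat_real (A \<inter> D) \<omega> \<partial>driven) =
      (\<integral>\<omega>\<in>E'. \<alpha> \<omega> * real_cond_exp driven (XF n) (indicator D) \<omega> \<partial>driven)" .
  qed (auto intro!: int_bd simp: indicator_def)
  with ceA show "AE \<omega> in driven. real_cond_exp driven (XF n) (indicator (A \<inter> D)) \<omega> =
      real_cond_exp driven (XF n) (indicator A) \<omega> * real_cond_exp driven (XF n) (indicator D) \<omega>"
    by eventually_elim simp
qed

lemma standard: "standard_nat_filt M X"
  unfolding standard_nat_filt_def
proof (intro exI conjI)
  show "prob_space driven" by (rule prob_space_driven)
  show "fst \<in> measurable driven M" by (rule fst_driven)
  show "distr driven M fst = M" by (rule distr_driven_fst)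
  show "iid_process driven Y"
    unfolding iid_process_def using indep_vars_Y by (simp add: distr_Y)
  show "immersed driven XF YF"
    unfolding immersed_def using XF_subset_YF cond_indep_XF_YF by blast
qed

end

theorem theorem3:
  fixes M :: "'w measure" and X :: "int \<Rightarrow> 'w \<Rightarrow> 'a::finite"
    and q :: "(int \<Rightarrow> 'a) \<Rightarrow> 'a \<Rightarrow> real"
  assumes "prob_space M"
    and "\<And>n. X n \<in> measurable M (count_space UNIV)"
    and "stationary M X"
    and "regular_cond_law M X q"
    and "\<And>a. AE \<omega> in M. q (past_of X (-1) \<omega>) a > 0"
    and "summable (eta M X q)"
  shows "standard_nat_filt M X"
proof -
  text \<open>Restricting the argument makes \<open>q\<close> a probability vector even at the functions outside
    \<open>space Past\<close>, which \<open>regular_cond_law\<close> leaves unconstrained.\<close>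
  define q' where "q' x = q (restrict x {..-1})" for x
  have q'_eq: "q' x = q x" if "x \<in> space Past" for x
    using that by (simp add: q'_def space_Past extensional_restrict)
  have "prob_vec (q' x)" for x
  proof -
    have "restrict x {..-1} \<in> space Past" by (simp add: space_Past)
    then show ?thesis
      using assms(4) unfolding q'_def prob_vec_def regular_cond_law_def by blast
  qed
  moreover have "regular_cond_law M X q'"
  proof -
    have "(\<lambda>x. q' x a) \<in> borel_measurable Past \<longleftrightarrow> (\<lambda>x. q x a) \<in> borel_measurable Past" for a
      by (rule measurable_cong) (simp add: q'_eq)
    then show ?thesis
      using assms(4) unfolding regular_cond_law_def by (simp add: q'_eq)
  qed
  moreover have "eta M X q' = eta M X q"
    by (rule ext) (simp add: eta_def q'_eq)
  moreover have "AE \<omega> in M. q' (past_of X (-1) \<omega>) a > 0" for a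
    using assms(5)[of a] by (simp add: q'_eq)
  ultimately have "primed_process M X q'"
    using assms unfolding primed_process_def primed_process_axioms_def by auto
  then show ?thesis by (rule primed_process.standard)
qed

end
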